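(* Let $n\geq d\geq 3$ be integers, and write $n=dk+t$ with $k\geq 1$ and $t\in\{0,1,\dots,d-1\}$. Then $$\mathrm{Ind}_{d-2}(C_n)\simeq\begin{cases}\displaystyle\bigvee_{d-1}\mathbb{S}^{dk-2k-1}, & \text{if } t=0 \text{ (i.e. } n=dk),\\ \mathbb{S}^{dk-2k+t-2}, & \text{if } t\in\{1,2,\dots,d-1\} \text{ (i.e. } n=dk+t).\end{cases}$$
   Context: $C_n$ ($n\ge 3$) is the cycle graph with vertex set $\{1,\dots,n\}$ and edges $(i,i+1)$ for $1\le i\le n-1$ together with $(1,n)$. For a graph $G$ and an integer $r\geq 1$, a subset $I\subseteq V(G)$ is $r$-independent if every connected component of the induced subgraph $G[I]$ has at most $r$ vertices; the $r$-independence complex $\mathrm{Ind}_r(G)$ is the simplicial complex on vertex set $V(G)$ whose simplices are all $r$-independent subsets of $V(G)$ (identified with its geometric realization). Here $\simeq$ denotes homotopy equivalence and $\bigvee_{p}\mathbb{S}^q$ denotes a wedge of $p$ copies of the $q$-sphere. *)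

theory Defs
  imports "HOL-Analysis.Analysis" "Graph_Theory.Digraph_Component"
begin

section \<open>Cycle graphs and r-independence complexes\<close>

text \<open>
  As in the locale \<^locale>\<open>graph\<close>, an undirected simple graph is a finite, loop-free, symmetric
  digraph without parallel arcs: the edge between \<open>u\<close> and \<open>v\<close> is the pair of arcs
  \<open>(u, v)\<close>, \<open>(v, u)\<close>.
\<close>

definition cycle_graph :: "nat \<Rightarrow> (nat, nat \<times> nat) pre_digraph" where
  "cycle_graph n =
     (let E = {(i, i + 1) | i. 1 \<le> i \<and> i < n} \<union> {(1, n)}
      in \<lparr>verts = {1..n}, arcs = E \<union> E\<inverse>, tail = fst, head = snd\<rparr>)"

lemma graph_cycle_graph:
  assumes "n \<ge> 3"
  shows "graph (cycle_graph n)"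
proof -
  have fin: "finite {(i, i + 1) | i. 1 \<le> i \<and> i < n}"
    by (rule finite_subset[of _ "{..n} \<times> {..n}"]) auto
  then have "finite (arcs (cycle_graph n))"
    by (simp add: cycle_graph_def Let_def)
  moreover have "symmetric (cycle_graph n)"
    by (auto simp: symmetric_def arcs_ends_conv cycle_graph_def Let_def sym_def)
  ultimately show ?thesis
    using assms
    by unfold_locales (auto simp: cycle_graph_def Let_def arc_to_ends_def)
qed

text \<open>
  In a symmetric digraph the strongly connected components \<^const>\<open>pre_digraph.sccs\<close> are the
  connected components of the underlying undirected graph. Finiteness is required explicitly since
  \<^const>\<open>card\<close> is \<open>0\<close> on infinite sets.
\<close>

definition r_independent :: "nat \<Rightarrow> ('a, 'b) pre_digraph \<Rightarrow> 'a set \<Rightarrow> bool" where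
  "r_independent r G I \<longleftrightarrow>
     I \<subseteq> verts G \<and>
     (\<forall>C \<in> pre_digraph.sccs (G \<restriction> I). finite (verts C) \<and> card (verts C) \<le> r)"

definition independence_complex :: "nat \<Rightarrow> ('a, 'b) pre_digraph \<Rightarrow> 'a set set" where
  "independence_complex r G = {I. r_independent r G I}"

text \<open>
  Geometric realization of a finite abstract simplicial complex in barycentric coordinates.
  The subspace topology of the product topology agrees with the usual (coherent) topology because
  the complex has finitely many vertices. An infinite support is excluded by the last condition,
  as \<^const>\<open>sum\<close> is then \<open>0\<close>.
\<close>

definition geometric_realization :: "'a set set \<Rightarrow> ('a \<Rightarrow> real) topology" where
  "geometric_realization K =
     subtopology (powertop_real UNIV)
       {x. (\<forall>v. 0 \<le> x v) \<and> {v. x v \<noteq> 0} \<in> K \<and> (\<Sum>v | x v \<noteq> 0. x v) = 1}"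


section \<open>Wedges of spheres\<close>

definition quotient_topology :: "'a topology \<Rightarrow> 'a rel \<Rightarrow> 'a set topology" where
  "quotient_topology X r = topology (\<lambda>U. U \<subseteq> topspace X // r \<and> openin X (\<Union>U))"

lemma openin_quotient_topology:
  assumes "equiv (topspace X) r"
  shows "openin (quotient_topology X r) U \<longleftrightarrow> U \<subseteq> topspace X // r \<and> openin X (\<Union>U)"
proof -
  have Int: "\<Union>(S \<inter> T) = \<Union>S \<inter> \<Union>T" if "S \<subseteq> topspace X // r" "T \<subseteq> topspace X // r" for S T
  proof (intro subset_antisym subsetI)
    fix x assume "x \<in> \<Union>S \<inter> \<Union>T"
    then obtain A B where AB: "A \<in> S" "B \<in> T" "x \<in> A" "x \<in> B" by blast
    then have "A = B" using that quotient_disj[OF assms, of A B] by blast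
    then show "x \<in> \<Union>(S \<inter> T)" using AB by blast
  qed blast
  have "istopology (\<lambda>U. U \<subseteq> topspace X // r \<and> openin X (\<Union>U))"
    unfolding istopology_def
  proof (intro conjI allI impI)
    fix \<K> assume K: "\<forall>S\<in>\<K>. S \<subseteq> topspace X // r \<and> openin X (\<Union>S)"
    then show "\<Union>\<K> \<subseteq> topspace X // r" by blast
    have "\<Union>(\<Union>\<K>) = \<Union>((\<lambda>S. \<Union>S) ` \<K>)" by blast
    then show "openin X (\<Union>(\<Union>\<K>))" using K by (metis (no_types, lifting) imageE openin_Union)
  qed (auto simp: Int)
  then show ?thesis
    by (simp add: quotient_topology_def)
qed

lemma quotient_map_quotient_topology:
  assumes r: "equiv (topspace X) r"
  shows "quotient_map X (quotient_topology X r) (\<lambda>x. r `` {x})"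
proof -
  have Un: "\<Union>(topspace X // r) = topspace X"
    using Union_quotient[OF r] .
  have top: "topspace (quotient_topology X r) = topspace X // r"
    using Un by (auto simp: topspace_def[of "quotient_topology X r"] openin_quotient_topology[OF r])
  have pre: "{x \<in> topspace X. r `` {x} \<in> U} = \<Union>U" if U: "U \<subseteq> topspace X // r" for U
  proof -
    have "r `` {x} = u" if "u \<in> U" "x \<in> u" for u x
      using that U quotient_eq_iff[OF r, of u u] r
      by (metis (no_types, opaque_lifting) Image_singleton_iff equiv_class_eq_iff quotientE subsetD)
    moreover have "x \<in> r `` {x}" if "x \<in> topspace X" for x
      using equiv_class_self[OF r that] .
    moreover have "\<Union>U \<subseteq> topspace X" using U Un by blast
    ultimately show ?thesis by blast
  qed
  show ?thesis
    unfolding quotient_map_def top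
    by (auto simp: openin_quotient_topology[OF r] pre quotient_def)
qed

text \<open>
  Wedge of the pointed spaces \<open>(X i, b i)\<close>, \<open>i \<in> I\<close>, with \<open>I\<close> nonempty: the disjoint union
  with all basepoints identified.
\<close>

definition wedge_rel :: "('i \<Rightarrow> 'a topology) \<Rightarrow> ('i \<Rightarrow> 'a) \<Rightarrow> 'i set \<Rightarrow> ('i \<times> 'a) rel" where
  "wedge_rel X b I =
     Id_on (topspace (sum_topology X I)) \<union> ((\<lambda>i. (i, b i)) ` I) \<times> ((\<lambda>i. (i, b i)) ` I)"

definition wedge_sum ::
    "('i \<Rightarrow> 'a topology) \<Rightarrow> ('i \<Rightarrow> 'a) \<Rightarrow> 'i set \<Rightarrow> ('i \<times> 'a) set topology" where
  "wedge_sum X b I = quotient_topology (sum_topology X I) (wedge_rel X b I)"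

lemma equiv_wedge_rel:
  assumes "\<And>i. i \<in> I \<Longrightarrow> b i \<in> topspace (X i)"
  shows "equiv (topspace (sum_topology X I)) (wedge_rel X b I)"
  using assms
  by (auto simp: wedge_rel_def equiv_def refl_on_def sym_def trans_def)

text \<open>The basepoint of each \<open>nsphere q\<close> is the unit vector of coordinate \<open>0\<close>.\<close>

definition sphere_basepoint :: "nat \<Rightarrow> real" where
  "sphere_basepoint = (\<lambda>j. if j = 0 then 1 else 0)"

lemma sphere_basepoint_in_nsphere: "sphere_basepoint \<in> topspace (nsphere q)"
  by (simp add: sphere_basepoint_def nsphere if_distrib[of "\<lambda>x. x ^ 2"] cong: if_cong)

definition wedge_of_spheres :: "nat \<Rightarrow> nat \<Rightarrow> (nat \<times> (nat \<Rightarrow> real)) set topology" where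
  "wedge_of_spheres p q = wedge_sum (\<lambda>_. nsphere q) (\<lambda>_. sphere_basepoint) {..<p}"

end

theory Submission
  imports Defs
begin

text \<open>
  Put \<open>w = d - 1\<close>. A set of vertices of the cycle is \<open>(d - 2)\<close>-independent iff it does not contain \<open>w\<close>
  cyclically consecutive vertices, so the complex in question is \<open>cyclic_complex w n\<close>. The heart of the
  proof is that lengthening a cycle by \<open>d = w + 1\<close> vertices amounts to a join with the boundary of a
  simplex on \<open>w\<close> vertices, a sphere of dimension \<open>d - 3\<close> (\<open>cyclic_complex_add_block\<close>). This holds for
  all cycle lengths \<open>n \<ge> 1\<close>: when \<open>n \<le> w\<close>, every window of \<open>w\<close> consecutive positions runs through the
  whole cycle, and \<open>cyclic_complex w n\<close> is the boundary of a simplex on \<open>n\<close> vertices.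

  If \<open>1 \<le> t \<le> d - 1\<close>, start with the cycle of length \<open>t\<close> and insert \<open>k\<close> blocks of length \<open>d\<close>. The result
  is the join of a sphere of dimension \<open>t - 2\<close> with \<open>k\<close> spheres of dimension \<open>d - 3\<close>, hence a sphere
  of dimension \<open>(t - 2) + k (d - 2)\<close>. If \<open>t = 0\<close>, start with the cycle of length \<open>d\<close>. Its faces are the
  sets that miss at least two of the \<open>d\<close> vertices, and this skeleton is equivalent to the join of a
  sphere of dimension \<open>d - 4\<close> with \<open>d\<close> points (\<open>missing_two_equivalent\<close>). After \<open>k - 1\<close> insertions
  there is a join of a single sphere with \<open>d\<close> points, that is, a union of \<open>d\<close> discs with a
  common boundary sphere, and collapsing one of the discs leaves a wedge of \<open>d - 1\<close> spheres.

  The combinatorial equivalences are all composed of collapses, expansions and isomorphisms. A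
  collapse, in the generality used here, removes a set of faces that is closed under adding and
  deleting one fixed vertex; \<open>collapse_homotopy_equivalent\<close> turns it into an explicit deformation
  retraction in barycentric coordinates. Collapses persist when a further complex is joined on, so
  the insertion of a block can be repeated without ever joining topological spaces. Spheres appear
  as boundaries of cross-polytopes, whose joins are again of this kind, and only the comparison of these
  complexes with the concrete wedge of spheres
  (\<open>cross_polytope_join_discrete_wedge_of_spheres\<close>) works with explicit homotopies.
\<close>

section \<open>Simplicial complexes and their realizations\<close>

text \<open>
  The empty face is always present, so the complex \<open>{{}}\<close> is the smallest one; its realization is
  empty, and it is the unit of the join.
\<close>

definition simplicial_complex :: "'a set set \<Rightarrow> bool" where
  "simplicial_complex K \<longleftrightarrow>
     finite (\<Union>K) \<and> {} \<in> K \<and> (\<forall>\<sigma>\<in>K. \<forall>\<tau>. \<tau> \<subseteq> \<sigma> \<longrightarrow> \<tau> \<in> K)"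

lemma simplicial_complexD:
  assumes "simplicial_complex K"
  shows "finite (\<Union>K)" "{} \<in> K" "\<And>\<sigma> \<tau>. \<sigma> \<in> K \<Longrightarrow> \<tau> \<subseteq> \<sigma> \<Longrightarrow> \<tau> \<in> K" "\<And>\<sigma>. \<sigma> \<in> K \<Longrightarrow> finite \<sigma>"
    "finite K"
proof -
  show fin: "finite (\<Union>K)" and "{} \<in> K" and "\<And>\<sigma> \<tau>. \<sigma> \<in> K \<Longrightarrow> \<tau> \<subseteq> \<sigma> \<Longrightarrow> \<tau> \<in> K"
    using assms unfolding simplicial_complex_def by blast+
  show "finite \<sigma>" if "\<sigma> \<in> K" for \<sigma>
    using that fin by (meson Union_upper finite_subset)
  show "finite K"
    using fin by (simp add: finite_UnionD)
qed

definition realization_carrier :: "'a set set \<Rightarrow> ('a \<Rightarrow> real) set" where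
  "realization_carrier K =
     {x. (\<forall>v. 0 \<le> x v) \<and> {v. x v \<noteq> 0} \<in> K \<and> (\<Sum>v | x v \<noteq> 0. x v) = 1}"

lemma geometric_realization_top_of_set:
  "geometric_realization K = top_of_set (realization_carrier K)"
  by (simp add: geometric_realization_def realization_carrier_def euclidean_product_topology)

lemma realization_carrier_iff:
  assumes "simplicial_complex K"
  shows "x \<in> realization_carrier K \<longleftrightarrow>
     (\<forall>v. 0 \<le> x v) \<and> {v. x v \<noteq> 0} \<in> K \<and> (\<Sum>v\<in>\<Union>K. x v) = 1"
proof -
  have "(\<Sum>v | x v \<noteq> 0. x v) = (\<Sum>v\<in>\<Union>K. x v)" if "{v. x v \<noteq> 0} \<in> K"
    using that simplicial_complexD[OF assms] by (intro sum.mono_neutral_left) auto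
  then show ?thesis
    by (auto simp: realization_carrier_def)
qed

lemma realization_carrierD:
  assumes "simplicial_complex K" "x \<in> realization_carrier K"
  shows "0 \<le> x v" "{v. x v \<noteq> 0} \<in> K" "(\<Sum>v\<in>\<Union>K. x v) = 1" "v \<notin> \<Union>K \<Longrightarrow> x v = 0"
  using assms by (auto simp: realization_carrier_iff)

definition homotopy_equivalent_complexes :: "'a set set \<Rightarrow> 'b set set \<Rightarrow> bool" (infix "\<simeq>\<^sub>c" 50) where
  "K \<simeq>\<^sub>c L \<longleftrightarrow> geometric_realization K homotopy_equivalent_space geometric_realization L"

lemma continuous_on_coordinate: "continuous_on S (\<lambda>x. x i)"
  by (rule continuous_on_subset[OF continuous_on_product_coordinates]) simp

lemma continuous_on_Max:
  fixes f :: "'i \<Rightarrow> 'a::topological_space \<Rightarrow> real"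
  assumes "finite A" "A \<noteq> {}" "\<And>a. a \<in> A \<Longrightarrow> continuous_on S (f a)"
  shows "continuous_on S (\<lambda>x. Max ((\<lambda>a. f a x) ` A))"
  using assms
proof (induction rule: finite_ne_induct)
  case (insert a F)
  have "continuous_on S (\<lambda>x. max (f a x) (Max ((\<lambda>a. f a x) ` F)))"
    using insert by (intro continuous_on_max) auto
  then show ?case
    using insert by simp
qed auto

lemma continuous_on_Min:
  fixes f :: "'i \<Rightarrow> 'a::topological_space \<Rightarrow> real"
  assumes "finite A" "A \<noteq> {}" "\<And>a. a \<in> A \<Longrightarrow> continuous_on S (f a)"
  shows "continuous_on S (\<lambda>x. Min ((\<lambda>a. f a x) ` A))"
  using assms
proof (induction rule: finite_ne_induct)
  case (insert a F)
  have "continuous_on S (\<lambda>x. min (f a x) (Min ((\<lambda>a. f a x) ` F)))"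
    using insert by (intro continuous_on_min) auto
  then show ?case
    using insert by simp
qed auto

section \<open>Collapses\<close>

text \<open>
  The faces outside \<open>L\<close> come in pairs \<open>\<sigma> - {v}\<close>, \<open>\<sigma> \<union> {v}\<close>, and these faces form an upper set of \<open>K\<close> because
  \<open>L\<close> is a complex. Many elementary collapses with the same apex \<open>v\<close> are thus carried out at once, and
  \<open>{} \<in> L\<close> rules out the pair of \<open>{}\<close> and \<open>{v}\<close>.
\<close>

definition collapses_at :: "'a \<Rightarrow> 'a set set \<Rightarrow> 'a set set \<Rightarrow> bool" where
  "collapses_at v K L \<longleftrightarrow> simplicial_complex K \<and> simplicial_complex L \<and> L \<subseteq> K \<and>
     (\<forall>\<sigma>\<in>K - L. insert v \<sigma> \<in> K - L \<and> \<sigma> - {v} \<in> K - L)"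

text \<open>
  For a point \<open>x\<close> let \<open>s x\<close> be the largest level such that the coordinates other than \<open>v\<close> that are at
  least \<open>s x\<close> still contain a removed face. Lower every coordinate other than \<open>v\<close> by \<open>u * s x\<close>, cutting
  off at \<open>0\<close>, and give the mass to \<open>v\<close>. If \<open>s x > 0\<close>, the support of \<open>x\<close> is a removed face and may be
  enlarged by \<open>v\<close>, so this path stays inside \<open>K\<close>. At time \<open>u = 1\<close> the support outside \<open>v\<close> is the set
  where \<open>x > s x\<close>; by maximality of \<open>s x\<close> it is not a removed face, so the path has reached \<open>L\<close>.
  Points of \<open>L\<close> have \<open>s x = 0\<close> and do not move. As a maximum of minima of coordinates, \<open>s\<close> is continuous.
\<close>

theorem collapse_homotopy_equivalent:
  fixes K L :: "'a set set"
  assumes "collapses_at v K L"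
  shows "K \<simeq>\<^sub>c L"
proof (cases "K = L")
  case True
  then show ?thesis
    by (simp add: homotopy_equivalent_complexes_def homotopy_equivalent_space_refl)
next
  case False
  have K: "simplicial_complex K" and L: "simplicial_complex L" and LK: "L \<subseteq> K"
    and ins: "\<And>\<sigma>. \<sigma> \<in> K - L \<Longrightarrow> insert v \<sigma> \<in> K - L"
    and del: "\<And>\<sigma>. \<sigma> \<in> K - L \<Longrightarrow> \<sigma> - {v} \<in> K - L"
    using assms unfolding collapses_at_def by blast+
  define F where "F = {\<tau> \<in> K - L. v \<notin> \<tau>}"
  have "finite F"
    using simplicial_complexD(5)[OF K] by (simp add: F_def)
  obtain \<sigma>0 where "\<sigma>0 \<in> K - L"
    using False LK by blast
  then have "F \<noteq> {}"
    using del[of \<sigma>0] by (auto simp: F_def)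
  have F: "finite \<tau>" "\<tau> \<noteq> {}" if "\<tau> \<in> F" for \<tau>
    using that simplicial_complexD(4)[OF K] simplicial_complexD(2)[OF L] by (auto simp: F_def)
  define V where "V = \<Union>K"
  have "finite V"
    using simplicial_complexD(1)[OF K] by (simp add: V_def)
  have "v \<in> V"
    using ins[OF \<open>\<sigma>0 \<in> K - L\<close>] by (auto simp: V_def)
  define s where "s x = Max ((\<lambda>\<tau>. Min (x ` \<tau>)) ` F)" for x :: "'a \<Rightarrow> real"
  have s_ge: "Min (x ` \<tau>) \<le> s x" if "\<tau> \<in> F" for x \<tau>
    using that \<open>finite F\<close> by (simp add: s_def)
  have s_obtain: "\<exists>\<tau>\<in>F. s x = Min (x ` \<tau>)" for x
  proof -
    have "s x \<in> (\<lambda>\<tau>. Min (x ` \<tau>)) ` F"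
      unfolding s_def using \<open>finite F\<close> \<open>F \<noteq> {}\<close> by (intro Max_in) auto
    then show ?thesis
      by blast
  qed
  have cont_s: "continuous_on S s" for S
    unfolding s_def using \<open>finite F\<close> \<open>F \<noteq> {}\<close> F
    by (intro continuous_on_Max continuous_on_Min) (auto intro: continuous_on_coordinate)
  define H where "H u x i = (if i = v then x v + (\<Sum>j\<in>V - {v}. min (x j) (u * s x))
      else x i - min (x i) (u * s x))" for u and x :: "'a \<Rightarrow> real" and i
  have s_nonneg: "0 \<le> s x" if "x \<in> realization_carrier K" for x
    using s_obtain[of x] F realization_carrierD(1)[OF K that] by auto
  have s_pos: "\<exists>\<tau>\<in>F. \<tau> \<subseteq> {v. x v \<noteq> 0}" if "0 < s x" for x
  proof -
    obtain \<tau> where \<tau>: "\<tau> \<in> F" "s x = Min (x ` \<tau>)"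
      using s_obtain by blast
    then have "0 < x i" if "i \<in> \<tau>" for i
      using \<open>0 < s x\<close> F[OF \<tau>(1)] that by simp
    then have "\<tau> \<subseteq> {v. x v \<noteq> 0}"
      by fastforce
    with \<tau>(1) show ?thesis
      by blast
  qed
  have H_eq: "H u x = x" if "x \<in> realization_carrier K" "s x = 0" for u x
    using realization_carrierD(1)[OF K that(1)] that(2) by (auto simp: H_def fun_eq_iff)
  have s_L: "s x = 0" if "x \<in> realization_carrier L" for x
  proof (rule ccontr)
    have xK: "x \<in> realization_carrier K"
      using that LK by (auto simp: realization_carrier_def)
    assume "s x \<noteq> 0"
    then obtain \<tau> where "\<tau> \<in> F" "\<tau> \<subseteq> {v. x v \<noteq> 0}"
      using s_nonneg[OF xK] s_pos[of x] by fastforce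
    then show False
      using simplicial_complexD(3)[OF L realization_carrierD(2)[OF L that]] by (auto simp: F_def)
  qed
  have H_K: "H u x \<in> realization_carrier K" if x: "x \<in> realization_carrier K" and u: "0 \<le> u" "u \<le> 1" for u x
  proof (cases "s x = 0")
    case False
    then have "0 < s x"
      using s_nonneg[OF x] by simp
    then obtain \<tau> where \<tau>: "\<tau> \<in> F" "\<tau> \<subseteq> {v. x v \<noteq> 0}"
      using s_pos by blast
    note xD = realization_carrierD[OF K x]
    have "{v. x v \<noteq> 0} \<notin> L"
      using \<tau> simplicial_complexD(3)[OF L] by (auto simp: F_def)
    then have "insert v {v. x v \<noteq> 0} \<in> K"
      using ins xD(2) by blast
    moreover have "{i. H u x i \<noteq> 0} \<subseteq> insert v {v. x v \<noteq> 0}"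
      using mult_nonneg_nonneg[OF u(1) s_nonneg[OF x]] by (auto simp: H_def)
    ultimately have "{i. H u x i \<noteq> 0} \<in> K"
      using simplicial_complexD(3)[OF K] by blast
    moreover have "0 \<le> H u x i" for i
      using xD(1) mult_nonneg_nonneg[OF u(1) s_nonneg[OF x]] by (auto simp: H_def intro!: add_nonneg_nonneg sum_nonneg)
    moreover have "(\<Sum>i\<in>V. H u x i) = 1"
    proof -
      have "(\<Sum>i\<in>V. H u x i) = H u x v + (\<Sum>i\<in>V - {v}. H u x i)"
        using \<open>finite V\<close> \<open>v \<in> V\<close> by (simp add: sum.remove)
      also have "\<dots> = x v + (\<Sum>i\<in>V - {v}. x i)"
        by (simp add: H_def sum_subtractf)
      also have "\<dots> = (\<Sum>i\<in>V. x i)"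
        using \<open>finite V\<close> \<open>v \<in> V\<close> by (simp add: sum.remove)
      finally show ?thesis
        using xD(3) by (simp add: V_def)
    qed
    ultimately show ?thesis
      by (simp add: realization_carrier_iff[OF K] V_def)
  qed (use x H_eq in simp)
  have H_L: "H 1 x \<in> realization_carrier L" if x: "x \<in> realization_carrier K" for x
  proof -
    have HK: "H 1 x \<in> realization_carrier K"
      using H_K[OF x] by simp
    let ?\<sigma> = "{i. H 1 x i \<noteq> 0}"
    have "?\<sigma> \<in> L"
    proof (rule ccontr)
      assume "?\<sigma> \<notin> L"
      then have \<sigma>: "?\<sigma> - {v} \<in> F"
        using del realization_carrierD(2)[OF K HK] by (auto simp: F_def)
      then have "s x < x i" if "i \<in> ?\<sigma> - {v}" for i
        using that by (auto simp: H_def min_def split: if_splits)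
      then have "s x < Min (x ` (?\<sigma> - {v}))"
        using F[OF \<sigma>] by simp
      then show False
        using s_ge[OF \<sigma>, of x] by simp
    qed
    then show ?thesis
      using HK by (simp add: realization_carrier_def)
  qed
  have cont_H: "continuous_on ({0..1} \<times> realization_carrier K) (\<lambda>(u, x). H u x)"
    unfolding case_prod_unfold
  proof (rule continuous_on_coordinatewise_then_product)
    fix i
    have c: "continuous_on S (\<lambda>p. snd p j)" for S :: "(real \<times> ('a \<Rightarrow> real)) set" and j
      by (rule continuous_on_compose2[OF continuous_on_coordinate[of UNIV j]]) (auto intro: continuous_intros)
    have s: "continuous_on S (\<lambda>p. s (snd p))" for S :: "(real \<times> ('a \<Rightarrow> real)) set"
      by (rule continuous_on_compose2[OF cont_s[of UNIV]]) (auto intro: continuous_intros)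
    show "continuous_on ({0..1} \<times> realization_carrier K) (\<lambda>p. H (fst p) (snd p) i)"
      by (cases "i = v") (auto simp: H_def intro!: continuous_intros c s)
  qed
  have "retraction_maps (geometric_realization K) (geometric_realization L) (H 1) id"
    unfolding retraction_maps_def geometric_realization_top_of_set continuous_map_subtopology_eu
  proof (intro conjI ballI)
    have "continuous_on (realization_carrier K) ((\<lambda>(u, x). H u x) \<circ> Pair 1)"
      by (rule continuous_on_compose[OF _ continuous_on_subset[OF cont_H]]) (auto intro!: continuous_intros)
    then show "continuous_on (realization_carrier K) (H 1)"
      by (simp add: comp_def)
    show "continuous_on (realization_carrier L) id"
      by (simp add: id_def)
    show "id \<in> realization_carrier L \<rightarrow> realization_carrier K"
      using LK by (auto simp: realization_carrier_def)
    show "H 1 (id x) = x" if "x \<in> topspace (top_of_set (realization_carrier L))" for x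
      using that s_L H_eq LK by (auto simp: realization_carrier_def)
  qed (use H_L in auto)
  moreover have "homotopic_with (\<lambda>_. True) (geometric_realization K) (geometric_realization K) (id \<circ> H 1) id"
  proof -
    have H_0: "H 0 x = x" if "x \<in> realization_carrier K" for x
    proof -
      have "min (x j) 0 = 0" for j
        using realization_carrierD(1)[OF K that] by simp
      then show ?thesis
        by (simp add: H_def fun_eq_iff)
    qed
    have "homotopic_with_canon (\<lambda>_. True) (realization_carrier K) (realization_carrier K) (H 0) (H 1)"
      unfolding homotopic_with_def using cont_H H_K
      by (intro exI[of _ "\<lambda>(u, x). H u x"]) (auto simp: )
    then have "homotopic_with_canon (\<lambda>_. True) (realization_carrier K) (realization_carrier K) id (id \<circ> H 1)"
      by (rule homotopic_with_eq) (use H_0 in auto)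
    then show ?thesis
      by (simp add: geometric_realization_top_of_set homotopic_with_sym)
  qed
  ultimately show ?thesis
    unfolding homotopy_equivalent_complexes_def by (rule deformation_retraction_imp_homotopy_equivalent_space[rotated])
qed

section \<open>Isomorphic complexes\<close>

lemma homotopy_equivalent_complexes_refl: "K \<simeq>\<^sub>c K"
  by (simp add: homotopy_equivalent_complexes_def homotopy_equivalent_space_refl)

lemma homotopy_equivalent_complexes_sym: "K \<simeq>\<^sub>c L \<Longrightarrow> L \<simeq>\<^sub>c K"
  unfolding homotopy_equivalent_complexes_def using homotopy_equivalent_space_sym by blast

lemma homotopy_equivalent_complexes_trans [trans]: "K \<simeq>\<^sub>c L \<Longrightarrow> L \<simeq>\<^sub>c M \<Longrightarrow> K \<simeq>\<^sub>c M"
  unfolding homotopy_equivalent_complexes_def by (rule homotopy_eqv_trans)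

definition isomorphic_complexes :: "'a set set \<Rightarrow> 'b set set \<Rightarrow> bool" (infix "\<cong>\<^sub>c" 50) where
  "K \<cong>\<^sub>c L \<longleftrightarrow> (\<exists>f. inj_on f (\<Union>K) \<and> L = (`) f ` K)"

lemma isomorphic_complexesI: "inj_on f (\<Union>K) \<Longrightarrow> L = (`) f ` K \<Longrightarrow> K \<cong>\<^sub>c L"
  unfolding isomorphic_complexes_def by blast

lemma simplicial_complex_image:
  assumes "simplicial_complex K"
  shows "simplicial_complex ((`) f ` K)"
proof -
  have "\<tau> \<in> (`) f ` K" if "\<sigma> \<in> K" "\<tau> \<subseteq> f ` \<sigma>" for \<sigma> \<tau>
  proof -
    obtain \<rho> where "\<rho> \<subseteq> \<sigma>" "\<tau> = f ` \<rho>"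
      using \<open>\<tau> \<subseteq> f ` \<sigma>\<close> by (auto simp: subset_image_iff)
    then show ?thesis
      using simplicial_complexD(3)[OF assms \<open>\<sigma> \<in> K\<close>] by blast
  qed
  moreover have "\<Union>((`) f ` K) = f ` \<Union>K"
    by blast
  ultimately show ?thesis
    using simplicial_complexD[OF assms] unfolding simplicial_complex_def by auto
qed

lemma isomorphic_complexes_simplicial:
  "K \<cong>\<^sub>c L \<Longrightarrow> simplicial_complex K \<Longrightarrow> simplicial_complex L"
  unfolding isomorphic_complexes_def using simplicial_complex_image by blast

lemma isomorphic_complexes_imp_homotopy_equivalent:
  fixes K :: "'a set set" and L :: "'b set set"
  assumes "K \<cong>\<^sub>c L" "simplicial_complex K"
  shows "K \<simeq>\<^sub>c L"
proof -
  obtain f :: "'a \<Rightarrow> 'b" where inj: "inj_on f (\<Union>K)" and L: "L = (`) f ` K"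
    using assms unfolding isomorphic_complexes_def by blast
  have sL: "simplicial_complex L"
    using L simplicial_complex_image[OF assms(2)] by simp
  have UL: "\<Union>L = f ` \<Union>K"
    unfolding L by blast
  define g where "g = inv_into (\<Union>K) f"
  have gf: "g (f v) = v" if "v \<in> \<Union>K" for v
    using that inj by (simp add: g_def)
  have fg: "f (g w) = w" "g w \<in> \<Union>K" if "w \<in> \<Union>L" for w
    using that unfolding UL g_def by (rule f_inv_into_f, rule inv_into_into)
  define F where "F x w = (if w \<in> \<Union>L then x (g w) else 0)" for x :: "'a \<Rightarrow> real" and w
  define G where "G y v = (if v \<in> \<Union>K then y (f v) else 0)" for y :: "'b \<Rightarrow> real" and v
  have contF: "continuous_on S F" for S
  proof (rule continuous_on_coordinatewise_then_product)
    show "continuous_on S (\<lambda>x. F x w)" for w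
      by (cases "w \<in> \<Union>L") (simp_all add: F_def continuous_on_coordinate del: Union_iff)
  qed
  have contG: "continuous_on S G" for S
  proof (rule continuous_on_coordinatewise_then_product)
    show "continuous_on S (\<lambda>y. G y v)" for v
      by (cases "v \<in> \<Union>K") (simp_all add: G_def continuous_on_coordinate del: Union_iff)
  qed
  have F: "F x \<in> realization_carrier L" if x: "x \<in> realization_carrier K" for x
  proof -
    note xD = realization_carrierD[OF assms(2) x]
    have "{w. F x w \<noteq> 0} = f ` {v. x v \<noteq> 0}"
    proof (intro subset_antisym subsetI)
      fix w assume "w \<in> {w. F x w \<noteq> 0}"
      then have "w \<in> \<Union>L" "x (g w) \<noteq> 0"
        by (auto simp: F_def split: if_splits)
      then show "w \<in> f ` {v. x v \<noteq> 0}"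
        using fg(1) by (intro image_eqI[of _ _ "g w"]) auto
    next
      fix w assume "w \<in> f ` {v. x v \<noteq> 0}"
      then obtain v where "w = f v" "x v \<noteq> 0"
        by blast
      moreover from this have "v \<in> \<Union>K"
        using xD(4) by blast
      ultimately show "w \<in> {w. F x w \<noteq> 0}"
        using gf[of v] UL by (simp add: F_def del: Union_iff)
    qed
    moreover have "(\<Sum>w\<in>\<Union>L. F x w) = (\<Sum>v\<in>\<Union>K. x v)"
      unfolding UL by (subst sum.reindex[OF inj]) (auto simp: F_def UL gf intro!: sum.cong)
    moreover have "{w. F x w \<noteq> 0} \<in> L"
      using calculation(1) xD(2) by (simp add: L)
    moreover have "0 \<le> F x w" for w
      using xD(1) by (simp add: F_def)
    ultimately show ?thesis
      using xD(3) by (simp add: realization_carrier_iff[OF sL])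
  qed
  have G: "G y \<in> realization_carrier K" if y: "y \<in> realization_carrier L" for y
  proof -
    note yD = realization_carrierD[OF sL y]
    obtain \<sigma> where \<sigma>: "\<sigma> \<in> K" "{w. y w \<noteq> 0} = f ` \<sigma>"
      using yD(2) L by blast
    have "{v. G y v \<noteq> 0} \<subseteq> \<sigma>"
    proof
      fix v assume "v \<in> {v. G y v \<noteq> 0}"
      then have "v \<in> \<Union>K" "f v \<in> f ` \<sigma>"
        using \<sigma> by (auto simp: G_def split: if_splits)
      then show "v \<in> \<sigma>"
        using inj_on_image_mem_iff[OF inj] \<sigma>(1) by (metis Union_upper)
    qed
    then have "{v. G y v \<noteq> 0} \<in> K"
      using \<sigma>(1) simplicial_complexD(3)[OF assms(2)] by blast
    moreover have "(\<Sum>v\<in>\<Union>K. G y v) = (\<Sum>w\<in>\<Union>L. y w)"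
      unfolding UL by (subst sum.reindex[OF inj]) (auto simp: G_def intro!: sum.cong)
    ultimately show ?thesis
      using yD by (auto simp: realization_carrier_iff[OF assms(2)] G_def)
  qed
  have "homeomorphic_maps (geometric_realization K) (geometric_realization L) F G"
    unfolding homeomorphic_maps_def geometric_realization_top_of_set continuous_map_subtopology_eu
  proof (intro conjI ballI)
    fix x assume "x \<in> topspace (top_of_set (realization_carrier K))"
    then have x: "x \<in> realization_carrier K"
      by simp
    show "G (F x) = x"
      using realization_carrierD(4)[OF assms(2) x] gf UL by (auto simp: F_def G_def fun_eq_iff)
  next
    fix y assume "y \<in> topspace (top_of_set (realization_carrier L))"
    then have y: "y \<in> realization_carrier L"
      by simp
    show "F (G y) = y"
      using realization_carrierD(4)[OF sL y] fg by (auto simp: F_def G_def fun_eq_iff)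
  qed (use contF contG F G in auto)
  then show ?thesis
    unfolding homotopy_equivalent_complexes_def
    using homeomorphic_space homeomorphic_imp_homotopy_equivalent_space by (metis homeomorphic_space_def)
qed

section \<open>Joins\<close>

text \<open>
  Taking the disjoint sum of the vertex types avoids any side condition that the vertex sets be
  disjoint.
\<close>

definition join :: "'a set set \<Rightarrow> 'b set set \<Rightarrow> ('a + 'b) set set" where
  "join K M = {\<sigma>. Inl -` \<sigma> \<in> K \<and> Inr -` \<sigma> \<in> M}"

lemma Union_join:
  assumes "simplicial_complex K" "simplicial_complex M"
  shows "\<Union>(join K M) = \<Union>K <+> \<Union>M"
proof (intro subset_antisym subsetI)
  fix x assume "x \<in> \<Union>(join K M)"
  then obtain \<sigma> where "x \<in> \<sigma>" "Inl -` \<sigma> \<in> K" "Inr -` \<sigma> \<in> M"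
    by (auto simp: join_def)
  then show "x \<in> \<Union>K <+> \<Union>M"
    by (cases x) blast+
next
  fix x assume "x \<in> \<Union>K <+> \<Union>M"
  then obtain \<sigma> \<tau> where "\<sigma> \<in> K" "\<tau> \<in> M" "x \<in> \<sigma> <+> \<tau>"
    using simplicial_complexD(2)[OF assms(1)] simplicial_complexD(2)[OF assms(2)] by blast
  moreover have "Inl -` (\<sigma> <+> \<tau>) = \<sigma>" "Inr -` (\<sigma> <+> \<tau>) = \<tau>"
    by auto
  ultimately show "x \<in> \<Union>(join K M)"
    unfolding join_def by (metis (mono_tags, lifting) UnionI mem_Collect_eq)
qed

lemma simplicial_complex_join:
  assumes "simplicial_complex K" "simplicial_complex M"
  shows "simplicial_complex (join K M)"
proof -
  have "\<tau> \<in> join K M" if "\<sigma> \<in> join K M" "\<tau> \<subseteq> \<sigma>" for \<sigma> \<tau>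
    using that assms unfolding join_def simplicial_complex_def
    by (metis (mono_tags, lifting) mem_Collect_eq vimage_mono)
  moreover have "{} \<in> join K M"
    using assms by (auto simp: join_def simplicial_complex_def)
  moreover have "finite (\<Union>(join K M))"
    unfolding Union_join[OF assms] using assms by (auto simp: simplicial_complex_def)
  ultimately show ?thesis
    unfolding simplicial_complex_def by blast
qed

lemma collapses_at_join:
  assumes "collapses_at v K L" "simplicial_complex M"
  shows "collapses_at (Inl v) (join K M) (join L M)"
proof -
  have K: "simplicial_complex K" "simplicial_complex L" "L \<subseteq> K"
    and toggle: "\<And>\<sigma>. \<sigma> \<in> K - L \<Longrightarrow> insert v \<sigma> \<in> K - L \<and> \<sigma> - {v} \<in> K - L"
    using assms unfolding collapses_at_def by blast+
  have "Inl -` insert (Inl v) \<sigma> = insert v (Inl -` \<sigma>)" "Inr -` insert (Inl v) \<sigma> = Inr -` \<sigma>"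
       "Inl -` (\<sigma> - {Inl v}) = Inl -` \<sigma> - {v}" "Inr -` (\<sigma> - {Inl v}) = Inr -` \<sigma>" for \<sigma> :: "('a + 'b) set"
    by auto
  then have "insert (Inl v) \<sigma> \<in> join K M - join L M \<and> \<sigma> - {Inl v} \<in> join K M - join L M"
    if "\<sigma> \<in> join K M - join L M" for \<sigma>
    using that toggle[of "Inl -` \<sigma>"] by (auto simp: join_def)
  moreover have "join L M \<subseteq> join K M"
    using K by (auto simp: join_def)
  ultimately show ?thesis
    unfolding collapses_at_def using K assms(2) simplicial_complex_join by blast
qed

lemma join_isomorphic:
  assumes "K \<cong>\<^sub>c K'" "M \<cong>\<^sub>c M'" "simplicial_complex K" "simplicial_complex M"
  shows "join K M \<cong>\<^sub>c join K' M'"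
proof -
  obtain f g where f: "inj_on f (\<Union>K)" "K' = (`) f ` K" and g: "inj_on g (\<Union>M)" "M' = (`) g ` M"
    using assms unfolding isomorphic_complexes_def by blast
  have v: "Inl -` (map_sum f g ` \<sigma>) = f ` (Inl -` \<sigma>)" "Inr -` (map_sum f g ` \<sigma>) = g ` (Inr -` \<sigma>)" for \<sigma>
    by (auto simp: map_sum_def image_iff split: sum.splits; force split: sum.splits)+
  show ?thesis
  proof (rule isomorphic_complexesI)
    show "inj_on (map_sum f g) (\<Union>(join K M))"
      unfolding Union_join[OF assms(3,4)] using f(1) g(1) by (auto simp: inj_on_def)
    show "join K' M' = (`) (map_sum f g) ` join K M"
    proof (intro subset_antisym subsetI)
      fix \<rho> assume "\<rho> \<in> join K' M'"
      then obtain \<sigma> \<tau> where st: "\<sigma> \<in> K" "\<tau> \<in> M" "Inl -` \<rho> = f ` \<sigma>" "Inr -` \<rho> = g ` \<tau>"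
        using f g by (auto simp: join_def)
      have "x \<in> \<rho> \<longleftrightarrow> x \<in> f ` \<sigma> <+> g ` \<tau>" for x
        unfolding st(3,4)[symmetric] by (cases x) auto
      then have "\<rho> = f ` \<sigma> <+> g ` \<tau>"
        by blast
      also have "\<dots> = map_sum f g ` (\<sigma> <+> \<tau>)"
        by (auto simp: Plus_def image_Un image_image)
      finally have "\<rho> = map_sum f g ` (\<sigma> <+> \<tau>)" .
      moreover have "Inl -` (\<sigma> <+> \<tau>) = \<sigma>" "Inr -` (\<sigma> <+> \<tau>) = \<tau>"
        by auto
      ultimately show "\<rho> \<in> (`) (map_sum f g) ` join K M"
        using st by (auto simp: join_def)
    qed (use f g v in \<open>auto simp: join_def\<close>)
  qed
qed

lemma isomorphic_complexes_refl: "K \<cong>\<^sub>c K"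
  by (rule isomorphic_complexesI[of id]) auto

lemma isomorphic_complexes_bij:
  assumes "bij f" "\<And>\<sigma>. \<sigma> \<in> L \<longleftrightarrow> f -` \<sigma> \<in> K"
  shows "K \<cong>\<^sub>c L"
proof (rule isomorphic_complexesI)
  show "inj_on f (\<Union>K)"
    using assms(1) by (meson bij_betw_def inj_on_subset subset_UNIV)
  have "f -` (f ` \<sigma>) = \<sigma>" "f ` (f -` \<tau>) = \<tau>" for \<sigma> \<tau>
    using assms(1) by (simp_all add: bij_def inj_vimage_image_eq surj_image_vimage_eq)
  then show "L = (`) f ` K"
    using assms(2) by (metis (no_types, lifting) image_iff subsetI subset_antisym)
qed

lemma join_commute: "join K M \<cong>\<^sub>c join M K"
proof (rule isomorphic_complexes_bij)
  show "bij (case_sum Inr Inl :: 'a + 'b \<Rightarrow> 'b + 'a)"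
    by (rule o_bij[of "case_sum Inr Inl"]) (auto simp: fun_eq_iff split: sum.splits)
  show "\<sigma> \<in> join M K \<longleftrightarrow> case_sum Inr Inl -` \<sigma> \<in> join K M" for \<sigma>
    by (auto simp: join_def vimage_def)
qed

lemma join_assoc: "join (join K M) N \<cong>\<^sub>c join K (join M N)"
proof (rule isomorphic_complexes_bij)
  show "bij (case_sum (case_sum Inl (Inr \<circ> Inl)) (Inr \<circ> Inr) :: ('a + 'b) + 'c \<Rightarrow> 'a + ('b + 'c))"
    by (rule o_bij[of "case_sum (Inl \<circ> Inl) (case_sum (Inl \<circ> Inr) Inr)"])
       (auto simp: fun_eq_iff split: sum.splits)
  show "\<sigma> \<in> join K (join M N) \<longleftrightarrow> case_sum (case_sum Inl (Inr \<circ> Inl)) (Inr \<circ> Inr) -` \<sigma> \<in> join (join K M) N" for \<sigma>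
    by (auto simp: join_def vimage_def)
qed

lemma join_empty_face: "K \<cong>\<^sub>c join K ({{}} :: 'b set set)"
proof (rule isomorphic_complexesI)
  show "inj_on Inl (\<Union>K)"
    by simp
  have [simp]: "Inl -` (Inl ` \<sigma>) = \<sigma>" "Inr -` (Inl ` \<sigma>) = {}" for \<sigma>
    by auto
  have *: "\<sigma> = Inl ` (Inl -` \<sigma>)" if "Inr -` \<sigma> = {}" for \<sigma> :: "('a + 'b) set"
  proof -
    have "x \<in> \<sigma> \<longleftrightarrow> x \<in> Inl ` (Inl -` \<sigma>)" for x
      using that by (cases x) auto
    then show ?thesis
      by blast
  qed
  show "join K ({{}} :: 'b set set) = (`) Inl ` K"
  proof (intro subset_antisym subsetI)
    fix \<sigma> assume "\<sigma> \<in> join K ({{}} :: 'b set set)"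
    then have "Inl -` \<sigma> \<in> K" "Inr -` \<sigma> = {}"
      by (simp_all add: join_def)
    then show "\<sigma> \<in> (`) Inl ` K"
      using *[of \<sigma>] by (intro image_eqI[of _ _ "Inl -` \<sigma>"])
  qed (auto simp: join_def)
qed

text \<open>
  Joins inside one vertex type: if \<open>V\<close> separates the vertex sets, a face is determined by its parts
  inside and outside \<open>V\<close>.
\<close>

lemma join_disjoint:
  fixes K M :: "'a set set"
  assumes "simplicial_complex K" "simplicial_complex M" "\<Union>K \<subseteq> V" "\<Union>M \<inter> V = {}"
  shows "join K M \<cong>\<^sub>c {\<sigma>. \<sigma> \<inter> V \<in> K \<and> \<sigma> - V \<in> M}"
proof (rule isomorphic_complexesI[of "case_sum id id"])
  have disj: "a \<notin> \<Union>M" if "a \<in> \<Union>K" for a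
    using that assms(3) assms(4) by (metis IntI empty_iff subsetD)
  show "inj_on (case_sum id id) (\<Union>(join K M))"
    unfolding Union_join[OF assms(1,2)]
  proof (rule inj_onI)
    fix x y :: "'a + 'a"
    assume "x \<in> \<Union>K <+> \<Union>M" "y \<in> \<Union>K <+> \<Union>M" "case_sum id id x = case_sum id id y"
    then show "x = y"
      by (elim PlusE) (simp_all add: disj del: Union_iff)
  qed
  have im: "case_sum id id ` \<sigma> = Inl -` \<sigma> \<union> Inr -` \<sigma>" for \<sigma> :: "('a + 'a) set"
  proof (intro subset_antisym subsetI)
    fix x assume "x \<in> case_sum id id ` \<sigma>"
    then show "x \<in> Inl -` \<sigma> \<union> Inr -` \<sigma>"
      by (auto split: sum.splits)
  qed force
  show "{\<sigma>. \<sigma> \<inter> V \<in> K \<and> \<sigma> - V \<in> M} = (`) (case_sum id id) ` join K M"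
  proof (intro subset_antisym subsetI)
    fix \<sigma> assume "\<sigma> \<in> {\<sigma>. \<sigma> \<inter> V \<in> K \<and> \<sigma> - V \<in> M}"
    moreover have "Inl -` (\<sigma> \<inter> V <+> \<sigma> - V) = \<sigma> \<inter> V" "Inr -` (\<sigma> \<inter> V <+> \<sigma> - V) = \<sigma> - V"
      by auto
    moreover from this have "\<sigma> = case_sum id id ` (\<sigma> \<inter> V <+> \<sigma> - V)"
      unfolding im by auto
    ultimately show "\<sigma> \<in> (`) (case_sum id id) ` join K M"
      by (auto simp: join_def)
  next
    fix \<sigma> assume "\<sigma> \<in> (`) (case_sum id id) ` join K M"
    then obtain \<rho> where \<rho>: "Inl -` \<rho> \<in> K" "Inr -` \<rho> \<in> M" "\<sigma> = Inl -` \<rho> \<union> Inr -` \<rho>"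
      using im by (auto simp: join_def)
    then have "\<sigma> \<inter> V = Inl -` \<rho>" "\<sigma> - V = Inr -` \<rho>"
      using assms(3,4) by blast+
    then show "\<sigma> \<in> {\<sigma>. \<sigma> \<inter> V \<in> K \<and> \<sigma> - V \<in> M}"
      using \<rho> by simp
  qed
qed

text \<open>
  Homotopy equivalence that persists when an arbitrary complex is joined on. Collapses and
  isomorphisms have this property by inspection, whereas for plain homotopy equivalences it would
  require the joining of continuous maps. Test complexes on the natural numbers suffice, since every
  finite complex is isomorphic to one of them.
\<close>

definition join_equivalent :: "'a set set \<Rightarrow> 'b set set \<Rightarrow> bool" (infix "\<approx>\<^sub>c" 50) where
  "K \<approx>\<^sub>c L \<longleftrightarrow> simplicial_complex K \<and> simplicial_complex L \<and>
     (\<forall>J :: nat set set. simplicial_complex J \<longrightarrow> join K J \<simeq>\<^sub>c join L J)"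

lemma join_equivalent_refl: "simplicial_complex K \<Longrightarrow> K \<approx>\<^sub>c K"
  by (simp add: join_equivalent_def homotopy_equivalent_complexes_refl)

lemma join_equivalent_sym: "K \<approx>\<^sub>c L \<Longrightarrow> L \<approx>\<^sub>c K"
  unfolding join_equivalent_def using homotopy_equivalent_complexes_sym by blast

lemma join_equivalent_trans [trans]: "K \<approx>\<^sub>c L \<Longrightarrow> L \<approx>\<^sub>c M \<Longrightarrow> K \<approx>\<^sub>c M"
  unfolding join_equivalent_def using homotopy_equivalent_complexes_trans by blast

lemma collapses_at_imp_join_equivalent:
  assumes "collapses_at v K L"
  shows "K \<approx>\<^sub>c L"
  unfolding join_equivalent_def
proof (intro conjI allI impI)
  show "simplicial_complex K" "simplicial_complex L"
    using assms by (simp_all add: collapses_at_def)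
  show "join K J \<simeq>\<^sub>c join L J" if "simplicial_complex J" for J :: "nat set set"
    by (rule collapse_homotopy_equivalent[OF collapses_at_join[OF assms that]])
qed

lemma isomorphic_imp_join_equivalent:
  assumes "K \<cong>\<^sub>c L" "simplicial_complex K"
  shows "K \<approx>\<^sub>c L"
  unfolding join_equivalent_def
proof (intro conjI allI impI)
  show "simplicial_complex K" "simplicial_complex L"
    using assms isomorphic_complexes_simplicial by blast+
  show "join K J \<simeq>\<^sub>c join L J" if "simplicial_complex J" for J :: "nat set set"
    using that assms
    by (intro isomorphic_complexes_imp_homotopy_equivalent join_isomorphic isomorphic_complexes_refl
        simplicial_complex_join)
qed

lemma join_equivalent_imp_homotopy_equivalent:
  assumes "K \<approx>\<^sub>c L"
  shows "K \<simeq>\<^sub>c L"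
proof -
  have "K \<simeq>\<^sub>c join K ({{}} :: nat set set)" "L \<simeq>\<^sub>c join L ({{}} :: nat set set)"
    using assms join_empty_face isomorphic_complexes_imp_homotopy_equivalent
    unfolding join_equivalent_def by blast+
  moreover have "simplicial_complex ({{}} :: nat set set)"
    by (simp add: simplicial_complex_def)
  ultimately show ?thesis
    using assms unfolding join_equivalent_def
    by (meson homotopy_equivalent_complexes_sym homotopy_equivalent_complexes_trans)
qed

lemma isomorphic_to_nat_complex:
  assumes "simplicial_complex K"
  shows "\<exists>L :: nat set set. K \<cong>\<^sub>c L"
proof -
  obtain f :: "'a \<Rightarrow> nat" where "inj_on f (\<Union>K)"
    using finite_imp_inj_to_nat_seg[OF simplicial_complexD(1)[OF assms]] by blast
  then show ?thesis
    using isomorphic_complexesI by blast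
qed

text \<open>
  By associativity, the new factor \<open>M\<close> can be absorbed into the test complex.
\<close>

lemma join_equivalent_join:
  assumes "K \<approx>\<^sub>c L" "simplicial_complex M"
  shows "join K M \<approx>\<^sub>c join L M"
proof -
  have K: "simplicial_complex K" "simplicial_complex L"
    using assms(1) by (simp_all add: join_equivalent_def)
  have "join (join K M) J \<simeq>\<^sub>c join (join L M) J" if J: "simplicial_complex J" for J :: "nat set set"
  proof -
    obtain J' :: "nat set set" where J': "join M J \<cong>\<^sub>c J'"
      using isomorphic_to_nat_complex simplicial_complex_join[OF assms(2) J] by blast
    then have sJ': "simplicial_complex J'"
      using isomorphic_complexes_simplicial simplicial_complex_join[OF assms(2) J] by blast
    have *: "join (join N M) J \<simeq>\<^sub>c join N J'" if N: "simplicial_complex N" for N :: "'d set set"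
    proof -
      have "join (join N M) J \<simeq>\<^sub>c join N (join M J)"
        by (intro isomorphic_complexes_imp_homotopy_equivalent join_assoc simplicial_complex_join N J assms(2))
      also have "join N (join M J) \<simeq>\<^sub>c join N J'"
        by (intro isomorphic_complexes_imp_homotopy_equivalent join_isomorphic isomorphic_complexes_refl
            J' simplicial_complex_join N J assms(2))
      finally show ?thesis .
    qed
    have "join K J' \<simeq>\<^sub>c join L J'"
      using assms(1) sJ' by (simp add: join_equivalent_def)
    then show ?thesis
      using *[OF K(1)] *[OF K(2)]
      by (meson homotopy_equivalent_complexes_sym homotopy_equivalent_complexes_trans)
  qed
  then show ?thesis
    using K assms(2) by (simp add: join_equivalent_def simplicial_complex_join)
qed

lemma join_equivalent_join_right:
  assumes "K \<approx>\<^sub>c L" "simplicial_complex M"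
  shows "join M K \<approx>\<^sub>c join M L"
proof -
  have "simplicial_complex K" "simplicial_complex L"
    using assms(1) by (simp_all add: join_equivalent_def)
  then have "join M K \<approx>\<^sub>c join K M" and *: "join L M \<approx>\<^sub>c join M L"
    using assms(2) by (auto intro!: isomorphic_imp_join_equivalent join_commute simplicial_complex_join)
  note this(1)
  also note join_equivalent_join[OF assms]
  also note *
  finally show ?thesis .
qed

section \<open>Staged collapses and attached cones\<close>

text \<open>
  A sequence of collapses with varying apex: the faces of highest rank are removed first, and those of
  rank \<open>c\<close> are paired by the vertex \<open>v c\<close>. Monotonicity of the rank ensures that every
  intermediate stage is a complex.
\<close>

lemma staged_collapse:
  fixes rank :: "'a set \<Rightarrow> nat" and v :: "nat \<Rightarrow> 'a"
  assumes K: "simplicial_complex K" and L: "simplicial_complex L" and LK: "L \<subseteq> K"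
    and mono: "\<And>\<sigma> \<tau>. \<sigma> \<in> K - L \<Longrightarrow> \<tau> \<in> K - L \<Longrightarrow> \<sigma> \<subseteq> \<tau> \<Longrightarrow> rank \<sigma> \<le> rank \<tau>"
    and ins: "\<And>\<sigma>. \<sigma> \<in> K - L \<Longrightarrow> insert (v (rank \<sigma>)) \<sigma> \<in> K - L \<and> rank (insert (v (rank \<sigma>)) \<sigma>) = rank \<sigma>"
    and del: "\<And>\<sigma>. \<sigma> \<in> K - L \<Longrightarrow> \<sigma> - {v (rank \<sigma>)} \<in> K - L \<and> rank (\<sigma> - {v (rank \<sigma>)}) = rank \<sigma>"
  shows "K \<approx>\<^sub>c L"
proof -
  define M where "M c = L \<union> {\<sigma> \<in> K - L. rank \<sigma> < c}" for c
  have M_K: "M c \<subseteq> K" for c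
    using LK by (auto simp: M_def)
  have M: "simplicial_complex (M c)" for c
  proof -
    have "\<tau> \<in> M c" if \<sigma>: "\<sigma> \<in> M c" "\<tau> \<subseteq> \<sigma>" for \<sigma> \<tau>
    proof (cases "\<tau> \<in> L")
      case False
      then have \<sigma>L: "\<sigma> \<notin> L"
        using simplicial_complexD(3)[OF L _ \<sigma>(2)] by blast
      have "\<sigma> \<in> K"
        using M_K \<sigma> by blast
      then have "\<tau> \<in> K"
        using simplicial_complexD(3)[OF K _ \<sigma>(2)] by blast
      then have "rank \<tau> \<le> rank \<sigma>"
        using mono \<sigma> \<open>\<sigma> \<in> K\<close> \<sigma>L False by blast
      then show ?thesis
        using \<sigma> \<sigma>L \<open>\<tau> \<in> K\<close> by (auto simp: M_def)
    qed (simp add: M_def)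
    moreover have "{} \<in> M c"
      using simplicial_complexD(2)[OF L] by (simp add: M_def)
    moreover have "finite (\<Union>(M c))"
      using simplicial_complexD(1)[OF K] M_K by (meson Union_mono finite_subset)
    ultimately show ?thesis
      unfolding simplicial_complex_def by blast
  qed
  have "M c \<approx>\<^sub>c L" for c
  proof (induction c)
    case 0
    then show ?case
      using join_equivalent_refl[OF L] by (simp add: M_def)
  next
    case (Suc c)
    have "insert (v c) \<sigma> \<in> M (Suc c) - M c \<and> \<sigma> - {v c} \<in> M (Suc c) - M c" if "\<sigma> \<in> M (Suc c) - M c" for \<sigma>
    proof -
      have "\<sigma> \<in> K - L" "rank \<sigma> = c"
        using that by (auto simp: M_def)
      then show ?thesis
        using ins[of \<sigma>] del[of \<sigma>] by (auto simp: M_def)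
    qed
    then have "collapses_at (v c) (M (Suc c)) (M c)"
      unfolding collapses_at_def using M by (auto simp: M_def)
    then show ?case
      using join_equivalent_trans[OF collapses_at_imp_join_equivalent Suc] by blast
  qed
  moreover have "K = M (Suc (Max (rank ` K)))"
  proof -
    have "rank \<sigma> < Suc (Max (rank ` K))" if "\<sigma> \<in> K" for \<sigma>
      using that simplicial_complexD(5)[OF K] by (simp add: less_Suc_eq_le)
    then show ?thesis
      using LK by (auto simp: M_def)
  qed
  ultimately show ?thesis
    by metis
qed

text \<open>
  A new vertex \<open>b i\<close> is added for each \<open>i \<in> I\<close>, with prescribed link and with no edges between the
  new vertices.
\<close>

definition attach :: "'i set \<Rightarrow> ('i \<Rightarrow> 'a) \<Rightarrow> 'a set set \<Rightarrow> ('i \<Rightarrow> 'a set set) \<Rightarrow> 'a set set" where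
  "attach I b K link = K \<union> (\<Union>i\<in>I. insert (b i) ` link i)"

definition down_closed :: "'a set set \<Rightarrow> bool" where
  "down_closed K \<longleftrightarrow> (\<forall>\<sigma>\<in>K. \<forall>\<tau>. \<tau> \<subseteq> \<sigma> \<longrightarrow> \<tau> \<in> K)"

lemma in_attach_iff:
  assumes "\<And>i. i \<in> I \<Longrightarrow> b i \<notin> \<Union>K" "\<And>i. i \<in> I \<Longrightarrow> link i \<subseteq> K"
  shows "\<sigma> \<in> attach I b K link \<longleftrightarrow> \<sigma> \<in> K \<or> (\<exists>i\<in>I. b i \<in> \<sigma> \<and> \<sigma> - {b i} \<in> link i)"
proof -
  have "\<sigma> \<in> insert (b i) ` link i \<longleftrightarrow> b i \<in> \<sigma> \<and> \<sigma> - {b i} \<in> link i" if "i \<in> I" for i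
  proof
    assume "\<sigma> \<in> insert (b i) ` link i"
    then obtain \<tau> where "\<tau> \<in> link i" "\<sigma> = insert (b i) \<tau>"
      by blast
    moreover from this have "b i \<notin> \<tau>"
      using assms that by blast
    ultimately show "b i \<in> \<sigma> \<and> \<sigma> - {b i} \<in> link i"
      by simp
  next
    assume "b i \<in> \<sigma> \<and> \<sigma> - {b i} \<in> link i"
    then show "\<sigma> \<in> insert (b i) ` link i"
      by (intro image_eqI[of _ _ "\<sigma> - {b i}"]) auto
  qed
  then show ?thesis
    unfolding attach_def by blast
qed

lemma simplicial_complex_attach:
  assumes "simplicial_complex K" "finite I" "\<And>i. i \<in> I \<Longrightarrow> link i \<subseteq> K" "\<And>i. i \<in> I \<Longrightarrow> down_closed (link i)"
  shows "simplicial_complex (attach I b K link)"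
proof -
  have "\<tau> \<in> attach I b K link" if "\<sigma> \<in> attach I b K link" "\<tau> \<subseteq> \<sigma>" for \<sigma> \<tau>
  proof (cases "\<sigma> \<in> K")
    case True
    then show ?thesis
      using that simplicial_complexD(3)[OF assms(1)] by (auto simp: attach_def)
  next
    case False
    then obtain i \<rho> where i: "i \<in> I" "\<rho> \<in> link i" "\<sigma> = insert (b i) \<rho>"
      using \<open>\<sigma> \<in> attach I b K link\<close> by (auto simp: attach_def)
    then have "\<tau> - {b i} \<in> link i"
      using assms(4) that(2) unfolding down_closed_def by (metis Diff_subset_conv insert_is_Un)
    then have "\<tau> - {b i} \<in> attach I b K link" "insert (b i) (\<tau> - {b i}) \<in> attach I b K link"
      unfolding attach_def using i(1) assms(3) by blast+
    then show ?thesis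
      by (cases "b i \<in> \<tau>") (auto simp: attach_def insert_absorb)
  qed
  moreover have "\<Union>(attach I b K link) \<subseteq> \<Union>K \<union> b ` I"
    using assms(3) by (auto simp: attach_def)
  then have "finite (\<Union>(attach I b K link))"
    by (rule finite_subset) (use assms(2) simplicial_complexD(1)[OF assms(1)] in simp)
  ultimately show ?thesis
    using simplicial_complexD(2)[OF assms(1)] unfolding simplicial_complex_def by (auto simp: attach_def)
qed

text \<open>
  Faces that contain different new vertices are incomparable, so the index of the new vertex serves as
  a rank, and the links may be collapsed independently, each with its own apex \<open>w i\<close>.
\<close>

lemma attach_change_links:
  fixes I :: "nat set" and b w :: "nat \<Rightarrow> 'a"
  assumes K: "simplicial_complex K" and I: "finite I" "inj_on b I"
    and fresh: "\<And>i. i \<in> I \<Longrightarrow> b i \<notin> \<Union>K"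
    and link: "\<And>i. i \<in> I \<Longrightarrow> link i \<subseteq> K" "\<And>i. i \<in> I \<Longrightarrow> down_closed (link i)"
    and link': "\<And>i. i \<in> I \<Longrightarrow> link' i \<subseteq> link i" "\<And>i. i \<in> I \<Longrightarrow> down_closed (link' i)"
    and toggle: "\<And>i \<tau>. i \<in> I \<Longrightarrow> \<tau> \<in> link i - link' i \<Longrightarrow>
        insert (w i) \<tau> \<in> link i - link' i \<and> \<tau> - {w i} \<in> link i - link' i"
  shows "attach I b K link \<approx>\<^sub>c attach I b K link'"
proof (rule staged_collapse)
  let ?A = "attach I b K link" and ?B = "attach I b K link'"
  have l'K: "\<And>i. i \<in> I \<Longrightarrow> link' i \<subseteq> K"
    using link(1) link'(1) by blast
  show "simplicial_complex ?A" "simplicial_complex ?B"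
    by (intro simplicial_complex_attach K I(1) link link'(2) l'K; assumption)+
  show "?B \<subseteq> ?A"
    using link'(1) by (auto simp: attach_def)
  define rank where "rank \<sigma> = (THE i. i \<in> I \<and> b i \<in> \<sigma>)" for \<sigma>
  have diff: "\<exists>i\<in>I. \<exists>\<tau>. \<tau> \<in> link i - link' i \<and> \<sigma> = insert (b i) \<tau>" if "\<sigma> \<in> ?A - ?B" for \<sigma>
    using that by (auto simp: attach_def)
  have rank: "rank (insert (b i) \<tau>) = i" if "i \<in> I" "\<tau> \<in> K" for i \<tau>
    unfolding rank_def
  proof (rule the_equality)
    show "j = i" if "j \<in> I \<and> b j \<in> insert (b i) \<tau>" for j
      using that \<open>i \<in> I\<close> \<open>\<tau> \<in> K\<close> fresh I(2) by (auto simp: inj_on_def)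
  qed (use that in auto)
  have inB: "insert (b i) \<tau> \<notin> ?B" if "i \<in> I" "\<tau> \<in> link i - link' i" for i \<tau>
  proof
    assume "insert (b i) \<tau> \<in> ?B"
    moreover have "insert (b i) \<tau> \<notin> K"
      using fresh[OF that(1)] by blast
    ultimately obtain j where j: "j \<in> I" "insert (b i) \<tau> \<in> insert (b j) ` link' j"
      by (auto simp: attach_def)
    then obtain \<tau>' where \<tau>': "\<tau>' \<in> link' j" "insert (b i) \<tau> = insert (b j) \<tau>'"
      by blast
    have "\<tau> \<in> K" "\<tau>' \<in> K"
      using that link(1) \<tau>' l'K j by blast+
    then have "i = j"
      using rank that(1) j(1) \<tau>'(2) by metis
    moreover have "b i \<notin> \<tau>" "b i \<notin> \<tau>'"
      using fresh[OF that(1)] \<open>\<tau> \<in> K\<close> \<open>\<tau>' \<in> K\<close> by blast+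
    ultimately have "\<tau> = \<tau>'"
      using \<tau>'(2) by (metis insert_ident)
    then show False
      using \<tau>' that \<open>i = j\<close> by blast
  qed
  show "rank \<sigma> \<le> rank \<tau>" if "\<sigma> \<in> ?A - ?B" "\<tau> \<in> ?A - ?B" "\<sigma> \<subseteq> \<tau>" for \<sigma> \<tau>
  proof -
    obtain i \<sigma>' where i: "i \<in> I" "\<sigma>' \<in> link i" "\<sigma> = insert (b i) \<sigma>'"
      using diff[OF \<open>\<sigma> \<in> ?A - ?B\<close>] by blast
    obtain j \<tau>' where j: "j \<in> I" "\<tau>' \<in> link j" "\<tau> = insert (b j) \<tau>'"
      using diff[OF \<open>\<tau> \<in> ?A - ?B\<close>] by blast
    have "b i \<notin> \<tau>'"
      using fresh[OF i(1)] j link(1) by blast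
    then have "b i = b j"
      using i(3) j(3) \<open>\<sigma> \<subseteq> \<tau>\<close> by blast
    then have "i = j"
      using I(2) i(1) j(1) by (simp add: inj_on_def)
    then show ?thesis
      using rank i j link(1) by (metis order_refl subsetD)
  qed
  fix \<sigma> assume "\<sigma> \<in> ?A - ?B"
  then obtain i \<tau> where i: "i \<in> I" "\<tau> \<in> link i - link' i" "\<sigma> = insert (b i) \<tau>"
    using diff by blast
  have *: "insert (w i) \<tau> \<in> link i - link' i" "\<tau> - {w i} \<in> link i - link' i"
    using toggle[OF i(1,2)] by simp_all
  have "insert (w i) \<tau> \<in> K"
    using *(1) link(1)[OF i(1)] by blast
  then have "w i \<noteq> b i"
    using fresh[OF i(1)] by auto
  then have eq: "insert (w i) \<sigma> = insert (b i) (insert (w i) \<tau>)" "\<sigma> - {w i} = insert (b i) (\<tau> - {w i})"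
    using i(3) by auto
  have r: "rank \<sigma> = i" "rank (insert (b i) (insert (w i) \<tau>)) = i" "rank (insert (b i) (\<tau> - {w i})) = i"
    unfolding i(3) using link(1)[OF i(1)] * i(2) by (auto intro!: rank i(1))
  have inA: "insert (b i) \<rho> \<in> ?A" if "\<rho> \<in> link i" for \<rho>
    using that i(1) by (auto simp: attach_def)
  show "insert (w (rank \<sigma>)) \<sigma> \<in> ?A - ?B \<and> rank (insert (w (rank \<sigma>)) \<sigma>) = rank \<sigma>"
    unfolding r(1) eq using r inB[OF i(1) *(1)] inA * by simp
  show "\<sigma> - {w (rank \<sigma>)} \<in> ?A - ?B \<and> rank (\<sigma> - {w (rank \<sigma>)}) = rank \<sigma>"
    unfolding r(1) eq using r inB[OF i(1) *(2)] inA * by simp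
qed

lemma simplicial_complex_remove_facets:
  assumes K: "simplicial_complex K"
    and \<Phi>: "{} \<notin> \<Phi>" "\<And>\<phi> \<sigma>. \<phi> \<in> \<Phi> \<Longrightarrow> \<sigma> \<in> K \<Longrightarrow> \<phi> \<subseteq> \<sigma> \<Longrightarrow> \<sigma> = \<phi>"
  shows "simplicial_complex (K - \<Phi>)"
proof -
  have "\<tau> \<in> K - \<Phi>" if "\<sigma> \<in> K - \<Phi>" "\<tau> \<subseteq> \<sigma>" for \<sigma> \<tau>
  proof -
    have "\<tau> \<notin> \<Phi>"
      using \<Phi>(2)[of \<tau> \<sigma>] that by auto
    moreover have "\<tau> \<in> K"
      using simplicial_complexD(3)[OF K] that by blast
    ultimately show ?thesis
      by blast
  qed
  moreover have "{} \<in> K - \<Phi>"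
    using simplicial_complexD(2)[OF K] \<Phi>(1) by blast
  moreover have "finite (\<Union>(K - \<Phi>))"
    using simplicial_complexD(1)[OF K] by (rule rev_finite_subset) blast
  ultimately show ?thesis
    unfolding simplicial_complex_def by blast
qed

text \<open>
  Stellar subdivision of several facets at once. Attaching \<open>b i\<close> along the full simplex \<open>\<phi> i\<close> is an
  expansion, because that simplex is a cone over any of its vertices \<open>v i\<close>. Afterwards \<open>\<phi> i\<close> is a free
  face of \<open>\<phi> i \<union> {b i}\<close> and can be removed together with it.
\<close>

lemma subdivide_facets:
  fixes I :: "nat set" and b v :: "nat \<Rightarrow> 'a"
  assumes K: "simplicial_complex K" and I: "finite I" "inj_on b I" "inj_on \<phi> I"
    and fresh: "\<And>i. i \<in> I \<Longrightarrow> b i \<notin> \<Union>K"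
    and \<phi>: "\<And>i. i \<in> I \<Longrightarrow> \<phi> i \<in> K" "\<And>i. i \<in> I \<Longrightarrow> v i \<in> \<phi> i"
      "\<And>i \<sigma>. i \<in> I \<Longrightarrow> \<sigma> \<in> K \<Longrightarrow> \<phi> i \<subseteq> \<sigma> \<Longrightarrow> \<sigma> = \<phi> i"
  shows "K \<approx>\<^sub>c attach I b (K - \<phi> ` I) (\<lambda>i. {\<tau>. \<tau> \<subset> \<phi> i})"
proof -
  let ?M = "attach I b K (\<lambda>i. Pow (\<phi> i))" and ?L = "attach I b (K - \<phi> ` I) (\<lambda>i. {\<tau>. \<tau> \<subset> \<phi> i})"
  have Pow_K: "Pow (\<phi> i) \<subseteq> K" if "i \<in> I" for i
    using simplicial_complexD(3)[OF K \<phi>(1)[OF that]] by blast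
  have "?M \<approx>\<^sub>c attach I b K (\<lambda>i. {})"
    by (rule attach_change_links[where w = v, OF K I(1,2) fresh Pow_K])
       (use \<phi>(2) in \<open>auto simp: down_closed_def\<close>)
  then have MK: "?M \<approx>\<^sub>c K"
    by (simp add: attach_def)
  have ss: "{\<tau>. \<tau> \<subset> \<phi> i} \<subseteq> K - \<phi> ` I" if "i \<in> I" for i
  proof
    fix \<tau> assume "\<tau> \<in> {\<tau>. \<tau> \<subset> \<phi> i}"
    moreover have "\<tau> \<noteq> \<phi> j" if "j \<in> I" for j
      using \<phi>(3)[OF that \<phi>(1)[OF \<open>i \<in> I\<close>]] calculation by blast
    ultimately show "\<tau> \<in> K - \<phi> ` I"
      using Pow_K[OF that] by blast
  qed
  have KL: "simplicial_complex (K - \<phi> ` I)"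
  proof (rule simplicial_complex_remove_facets[OF K])
    show "{} \<notin> \<phi> ` I"
      using \<phi>(2) by auto
    show "\<sigma> = \<psi>" if "\<psi> \<in> \<phi> ` I" "\<sigma> \<in> K" "\<psi> \<subseteq> \<sigma>" for \<psi> \<sigma>
    proof -
      obtain i where "i \<in> I" "\<psi> = \<phi> i"
        using \<open>\<psi> \<in> \<phi> ` I\<close> by auto
      then show ?thesis
        using \<phi>(3)[of i \<sigma>] \<open>\<sigma> \<in> K\<close> \<open>\<psi> \<subseteq> \<sigma>\<close> by simp
    qed
  qed
  have "?M \<approx>\<^sub>c ?L"
  proof (rule staged_collapse)
    show "simplicial_complex ?M"
      by (rule simplicial_complex_attach[OF K I(1) Pow_K]) (auto simp: down_closed_def)
    show "simplicial_complex ?L"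
      by (rule simplicial_complex_attach[OF KL I(1) ss]) (auto simp: down_closed_def)
    show "?L \<subseteq> ?M"
      by (auto simp: attach_def)
    define rank where "rank \<sigma> = (THE i. i \<in> I \<and> \<phi> i \<subseteq> \<sigma>)" for \<sigma>
    have rank: "rank \<sigma> = i" if "i \<in> I" "\<sigma> = \<phi> i \<or> \<sigma> = insert (b i) (\<phi> i)" for \<sigma> i
      unfolding rank_def
    proof (rule the_equality)
      show "i \<in> I \<and> \<phi> i \<subseteq> \<sigma>"
        using that by blast
      show "j = i" if j: "j \<in> I \<and> \<phi> j \<subseteq> \<sigma>" for j
      proof -
        have "b i \<notin> \<phi> j"
          using fresh \<phi>(1) \<open>i \<in> I\<close> j by blast
        then have "\<phi> j \<subseteq> \<phi> i"
          using \<open>\<sigma> = \<phi> i \<or> _\<close> j by blast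
        then have "\<phi> i = \<phi> j"
          using \<phi>(1,3) \<open>i \<in> I\<close> j by blast
        then show ?thesis
          using I(3) \<open>i \<in> I\<close> j by (simp add: inj_on_def)
      qed
    qed
    have fresh': "b i \<notin> \<Union>(K - \<phi> ` I)" if "i \<in> I" for i
      using fresh that by blast
    have diff: "\<sigma> \<in> ?M - ?L \<longleftrightarrow> (\<exists>i\<in>I. \<sigma> = \<phi> i \<or> \<sigma> = insert (b i) (\<phi> i))" for \<sigma>
    proof
      assume "\<sigma> \<in> ?M - ?L"
      then show "\<exists>i\<in>I. \<sigma> = \<phi> i \<or> \<sigma> = insert (b i) (\<phi> i)"
        by (auto simp: attach_def)
    next
      assume "\<exists>i\<in>I. \<sigma> = \<phi> i \<or> \<sigma> = insert (b i) (\<phi> i)"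
      then obtain i where i: "i \<in> I" "\<sigma> = \<phi> i \<or> \<sigma> = insert (b i) (\<phi> i)"
        by blast
      have bi: "b j \<notin> \<phi> i" if "j \<in> I" for j
        using fresh[OF that] \<phi>(1)[OF i(1)] by blast
      have "\<sigma> \<in> ?M"
        using i \<phi>(1) by (auto simp: attach_def)
      moreover have "\<sigma> \<notin> ?L"
      proof
        assume "\<sigma> \<in> ?L"
        then consider "\<sigma> \<in> K - \<phi> ` I" | j where "j \<in> I" "b j \<in> \<sigma>" "\<sigma> - {b j} \<subset> \<phi> j"
          using in_attach_iff[of I b "K - \<phi> ` I" "\<lambda>i. {\<tau>. \<tau> \<subset> \<phi> i}" \<sigma>, OF fresh' ss] by auto
        then show False
        proof cases
          case 1
          then show False
            using i fresh[OF i(1)] by blast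
        next
          case 2
          then have *: "b j = b i" "\<sigma> = insert (b i) (\<phi> i)"
            using i(2) bi by blast+
          then have "j = i"
            using I(2) 2(1) i(1) by (simp add: inj_on_def)
          then show False
            using 2(3) * bi[OF i(1)] by auto
        qed
      qed
      ultimately show "\<sigma> \<in> ?M - ?L"
        by blast
    qed
    fix \<sigma> assume "\<sigma> \<in> ?M - ?L"
    then obtain i where i: "i \<in> I" "\<sigma> = \<phi> i \<or> \<sigma> = insert (b i) (\<phi> i)"
      using diff by blast
    have bi: "b i \<notin> \<phi> i"
      using fresh[OF i(1)] \<phi>(1)[OF i(1)] by blast
    then have eq: "insert (b i) \<sigma> = insert (b i) (\<phi> i)" "\<sigma> - {b i} = \<phi> i"
      using i(2) by auto
    have r: "rank \<sigma> = i"
      using rank i by blast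
    show "insert (b (rank \<sigma>)) \<sigma> \<in> ?M - ?L \<and> rank (insert (b (rank \<sigma>)) \<sigma>) = rank \<sigma>"
      unfolding diff r eq using rank[OF i(1)] i(1) by blast
    show "\<sigma> - {b (rank \<sigma>)} \<in> ?M - ?L \<and> rank (\<sigma> - {b (rank \<sigma>)}) = rank \<sigma>"
      unfolding diff r eq using rank[OF i(1)] i(1) by blast
    show "rank \<sigma> \<le> rank \<tau>" if "\<tau> \<in> ?M - ?L" "\<sigma> \<subseteq> \<tau>" for \<tau>
    proof -
      obtain j where j: "j \<in> I" "\<tau> = \<phi> j \<or> \<tau> = insert (b j) (\<phi> j)"
        using \<open>\<tau> \<in> ?M - ?L\<close> diff by blast
      have "b j \<notin> \<phi> i"
        using fresh[OF j(1)] \<phi>(1)[OF i(1)] by blast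
      then have "\<phi> i \<subseteq> \<phi> j"
        using i(2) j(2) \<open>\<sigma> \<subseteq> \<tau>\<close> by blast
      then have "\<phi> j = \<phi> i"
        using \<phi>(3)[OF i(1) \<phi>(1)[OF j(1)]] by simp
      then have "i = j"
        using I(3) i(1) j(1) by (simp add: inj_on_def)
      then show ?thesis
        using r rank[OF j] by simp
    qed
  qed
  then show ?thesis
    by (rule join_equivalent_trans[OF join_equivalent_sym[OF MK]])
qed

text \<open>
  The link of every face meeting \<open>A\<close> is a cone with apex \<open>p\<close>, so all these faces can go at once.
\<close>

lemma delete_vertices:
  assumes K: "simplicial_complex K" and p: "p \<notin> A"
    and ins: "\<And>\<sigma>. \<sigma> \<in> K \<Longrightarrow> \<sigma> \<inter> A \<noteq> {} \<Longrightarrow> insert p \<sigma> \<in> K"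
  shows "K \<approx>\<^sub>c {\<sigma> \<in> K. \<sigma> \<inter> A = {}}"
proof (rule collapses_at_imp_join_equivalent[of p])
  let ?L = "{\<sigma> \<in> K. \<sigma> \<inter> A = {}}"
  have "finite (\<Union>?L)"
    using simplicial_complexD(1)[OF K] by (rule rev_finite_subset) blast
  moreover have "\<tau> \<in> ?L" if "\<sigma> \<in> ?L" "\<tau> \<subseteq> \<sigma>" for \<sigma> \<tau>
    using that simplicial_complexD(3)[OF K] by blast
  ultimately have "simplicial_complex ?L"
    using simplicial_complexD(2)[OF K] unfolding simplicial_complex_def by blast
  moreover have "insert p \<sigma> \<in> K - ?L \<and> \<sigma> - {p} \<in> K - ?L" if "\<sigma> \<in> K - ?L" for \<sigma>
  proof -
    have "\<sigma> \<in> K" "\<sigma> \<inter> A \<noteq> {}"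
      using that by auto
    moreover have "\<sigma> - {p} \<in> K"
      using simplicial_complexD(3)[OF K \<open>\<sigma> \<in> K\<close>] by blast
    ultimately show ?thesis
      using ins p by blast
  qed
  ultimately show "collapses_at p K ?L"
    unfolding collapses_at_def using K by blast
qed

section \<open>Boundaries of simplices, discrete sets and cross-polytopes\<close>

definition simplex_boundary :: "'a set \<Rightarrow> 'a set set" where
  "simplex_boundary A = {\<sigma>. \<sigma> \<subset> A}"

definition discrete_complex :: "'a set \<Rightarrow> 'a set set" where
  "discrete_complex A = insert {} ((\<lambda>a. {a}) ` A)"

text \<open>
  The boundary complex of the \<open>m\<close>-dimensional cross-polytope, with \<open>2 i\<close> and \<open>2 i + 1\<close> as the \<open>i\<close>-th
  pair of opposite vertices; a sphere of dimension \<open>m - 1\<close>.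
\<close>

definition cross_polytope :: "nat \<Rightarrow> nat set set" where
  "cross_polytope m = {\<sigma>. \<sigma> \<subseteq> {..<2 * m} \<and> (\<forall>i. \<not> {2 * i, 2 * i + 1} \<subseteq> \<sigma>)}"

lemma simplicial_complex_simplex_boundary:
  "finite A \<Longrightarrow> A \<noteq> {} \<Longrightarrow> simplicial_complex (simplex_boundary A)"
  unfolding simplicial_complex_def simplex_boundary_def
  by (auto intro: finite_subset[of _ A])

lemma simplicial_complex_discrete_complex:
  "finite A \<Longrightarrow> simplicial_complex (discrete_complex A)"
  unfolding simplicial_complex_def discrete_complex_def by (auto simp: subset_singleton_iff)

lemma simplicial_complex_cross_polytope: "simplicial_complex (cross_polytope m)"
proof -
  have "finite (\<Union>(cross_polytope m))"
    by (rule finite_subset[of _ "{..<2 * m}"]) (auto simp: cross_polytope_def)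
  then show ?thesis
    unfolding simplicial_complex_def by (auto simp: cross_polytope_def)
qed

lemma simplex_boundary_isomorphic:
  assumes "finite A" "finite B" "card A = card B"
  shows "simplex_boundary A \<cong>\<^sub>c simplex_boundary B"
proof -
  obtain f where f: "bij_betw f A B"
    using assms finite_same_card_bij by blast
  then have inj: "inj_on f A" and B: "B = f ` A"
    by (auto simp: bij_betw_def)
  show ?thesis
  proof (rule isomorphic_complexesI[of f])
    show "inj_on f (\<Union>(simplex_boundary A))"
      using inj by (rule inj_on_subset) (auto simp: simplex_boundary_def)
    have "f ` \<sigma> \<subset> f ` A" if "\<sigma> \<subset> A" for \<sigma>
      using image_strict_mono[OF inj that] .
    moreover have "\<tau> \<in> (`) f ` simplex_boundary A" if \<tau>: "\<tau> \<subset> f ` A" for \<tau>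
    proof -
      obtain \<sigma> where "\<sigma> \<subseteq> A" "\<tau> = f ` \<sigma>"
        using \<tau> unfolding psubset_eq subset_image_iff by blast
      moreover from this have "\<sigma> \<noteq> A"
        using \<tau> by blast
      ultimately show ?thesis
        by (auto simp: simplex_boundary_def)
    qed
    ultimately show "simplex_boundary B = (`) f ` simplex_boundary A"
    proof (intro subset_antisym subsetI)
      fix \<tau> assume "\<tau> \<in> (`) f ` simplex_boundary A"
      then obtain \<sigma> where "\<sigma> \<subset> A" "\<tau> = f ` \<sigma>"
        unfolding simplex_boundary_def by blast
      then show "\<tau> \<in> simplex_boundary B"
        using image_strict_mono[OF inj] by (simp add: simplex_boundary_def B)
    qed (simp add: simplex_boundary_def B)
  qed
qed

lemma discrete_complex_isomorphic:
  assumes "finite A" "finite B" "card A = card B"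
  shows "discrete_complex A \<cong>\<^sub>c discrete_complex B"
proof -
  obtain f where f: "bij_betw f A B"
    using assms finite_same_card_bij by blast
  then have inj: "inj_on f A" and B: "B = f ` A"
    by (auto simp: bij_betw_def)
  show ?thesis
  proof (rule isomorphic_complexesI[of f])
    show "inj_on f (\<Union>(discrete_complex A))"
      using inj by (rule inj_on_subset) (auto simp: discrete_complex_def)
    show "discrete_complex B = (`) f ` discrete_complex A"
      by (auto simp: discrete_complex_def B)
  qed
qed

lemma join_simplex_boundary_discrete:
  fixes R :: "'a set"
  assumes "finite R" "R \<noteq> {}" "finite P" "R \<inter> P = {}"
  shows "{\<sigma>. \<sigma> \<inter> R \<subset> R \<and> \<sigma> - R \<in> discrete_complex P} \<approx>\<^sub>c
         join (simplex_boundary {..<card R}) (discrete_complex {..<card P})"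
proof -
  have c: "simplicial_complex (simplex_boundary R)" "simplicial_complex (discrete_complex P)"
    using assms(1-3) by (simp_all add: simplicial_complex_simplex_boundary simplicial_complex_discrete_complex)
  have iso: "join (simplex_boundary R) (discrete_complex P) \<cong>\<^sub>c
      {\<sigma>. \<sigma> \<inter> R \<in> simplex_boundary R \<and> \<sigma> - R \<in> discrete_complex P}"
    by (rule join_disjoint[OF c]) (use assms(4) in \<open>auto simp: simplex_boundary_def discrete_complex_def\<close>)
  have "{\<sigma>. \<sigma> \<inter> R \<subset> R \<and> \<sigma> - R \<in> discrete_complex P} \<approx>\<^sub>c join (simplex_boundary R) (discrete_complex P)"
    using join_equivalent_sym[OF isomorphic_imp_join_equivalent[OF iso simplicial_complex_join[OF c]]]
    by (simp add: simplex_boundary_def)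
  also have "\<dots> \<approx>\<^sub>c join (simplex_boundary {..<card R}) (discrete_complex {..<card P})"
    using assms
    by (intro isomorphic_imp_join_equivalent join_isomorphic simplex_boundary_isomorphic
          discrete_complex_isomorphic simplicial_complex_join c) auto
  finally show ?thesis .
qed

text \<open>
  Subdividing the facet \<open>A\<close> by a new vertex turns the boundary of the larger simplex into the suspension
  of the boundary of \<open>A\<close>; one pole is \<open>a\<close>, the other is the new vertex.
\<close>

lemma simplex_boundary_insert:
  fixes A :: "nat set"
  assumes "finite A" "A \<noteq> {}" "a \<notin> A"
  shows "simplex_boundary (insert a A) \<approx>\<^sub>c join (simplex_boundary {..<card A}) (discrete_complex {..<2::nat})"
proof -
  obtain y where y: "y \<notin> insert a A"
    using assms(1) ex_new_if_finite[of "insert a A"] infinite_UNIV_nat by auto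
  obtain v where v: "v \<in> A"
    using assms(2) by blast
  have "simplex_boundary (insert a A) \<approx>\<^sub>c
      attach {0::nat} (\<lambda>_. y) (simplex_boundary (insert a A) - (\<lambda>_. A) ` {0::nat}) (\<lambda>_. {\<tau>. \<tau> \<subset> A})"
    by (rule subdivide_facets[where v = "\<lambda>_. v" and \<phi> = "\<lambda>_. A"])
       (use assms y v simplicial_complex_simplex_boundary[of "insert a A"]
         in \<open>simp_all add: simplex_boundary_def, blast+\<close>)
  also have "\<dots> = {\<sigma>. \<sigma> \<inter> A \<subset> A \<and> \<sigma> - A \<in> discrete_complex {a, y}}" (is "?L = ?R")
  proof (intro subset_antisym subsetI)
    fix \<sigma> assume "\<sigma> \<in> ?L"
    then consider "\<sigma> \<subset> insert a A" "\<sigma> \<noteq> A" | \<tau> where "\<tau> \<subset> A" "\<sigma> = insert y \<tau>"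
      by (auto simp: attach_def simplex_boundary_def)
    then show "\<sigma> \<in> ?R"
    proof cases
      case 1
      then have "\<sigma> - A = {} \<or> \<sigma> - A = {a}" "\<sigma> \<inter> A \<subset> A"
        using assms(3) by blast+
      then show ?thesis
        by (auto simp: discrete_complex_def)
    next
      case 2
      then have "\<sigma> - A = {y}" "\<sigma> \<inter> A = \<tau>"
        using y by blast+
      then show ?thesis
        using 2 by (simp add: discrete_complex_def)
    qed
  next
    fix \<sigma> assume "\<sigma> \<in> ?R"
    then have *: "\<sigma> \<inter> A \<subset> A" and "\<sigma> - A = {} \<or> \<sigma> - A = {a} \<or> \<sigma> - A = {y}"
      by (auto simp: discrete_complex_def)
    then consider "\<sigma> \<subset> insert a A \<and> \<sigma> \<noteq> A" | "\<sigma> = insert y (\<sigma> \<inter> A)"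
      using assms(3) by blast
    then show "\<sigma> \<in> ?L"
      using * by cases (auto simp: attach_def simplex_boundary_def)
  qed
  also have "\<dots> \<approx>\<^sub>c join (simplex_boundary {..<card A}) (discrete_complex {..<card {a, y}})"
    using assms y by (intro join_simplex_boundary_discrete) auto
  finally show ?thesis
    using y by (simp add: numeral_2_eq_2)
qed

lemma cross_polytope_0: "cross_polytope 0 = {{}}"
  by (auto simp: cross_polytope_def)

lemma cross_polytope_Suc: "cross_polytope (Suc m) \<approx>\<^sub>c join (cross_polytope m) (discrete_complex {..<2::nat})"
proof -
  let ?P = "{2 * m, 2 * m + 1}"
  have c: "simplicial_complex (cross_polytope m)" "simplicial_complex (discrete_complex ?P)"
    by (auto intro: simplicial_complex_cross_polytope simplicial_complex_discrete_complex)
  have "join (cross_polytope m) (discrete_complex ?P) \<cong>\<^sub>c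
      {\<sigma>. \<sigma> \<inter> {..<2 * m} \<in> cross_polytope m \<and> \<sigma> - {..<2 * m} \<in> discrete_complex ?P}"
    by (rule join_disjoint[OF c]) (auto simp: cross_polytope_def discrete_complex_def)
  also have "\<dots> = cross_polytope (Suc m)"
  proof (intro subset_antisym subsetI)
    fix \<sigma> assume "\<sigma> \<in> {\<sigma>. \<sigma> \<inter> {..<2 * m} \<in> cross_polytope m \<and> \<sigma> - {..<2 * m} \<in> discrete_complex ?P}"
    then have 1: "\<And>i. \<not> {2 * i, 2 * i + 1} \<subseteq> \<sigma> \<inter> {..<2 * m}"
      and 2: "\<sigma> - {..<2 * m} = {} \<or> \<sigma> - {..<2 * m} = {2 * m} \<or> \<sigma> - {..<2 * m} = {2 * m + 1}"
      by (auto simp: cross_polytope_def discrete_complex_def)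
    have "\<not> {2 * i, 2 * i + 1} \<subseteq> \<sigma>" for i
    proof
      assume s: "{2 * i, 2 * i + 1} \<subseteq> \<sigma>"
      then have "\<not> i < m"
        using 1[of i] by auto
      then have "{2 * i, 2 * i + 1} \<subseteq> \<sigma> - {..<2 * m}"
        using s by auto
      then have "{2 * i, 2 * i + 1} \<subseteq> {2 * m} \<or> {2 * i, 2 * i + 1} \<subseteq> {2 * m + 1}"
        using 2 by (metis empty_subsetI order_trans)
      then show False
        by auto
    qed
    moreover have "\<sigma> \<subseteq> {..<2 * m} \<union> ?P"
      using 2 by blast
    then have "\<sigma> \<subseteq> {..<2 * Suc m}"
      by auto
    ultimately show "\<sigma> \<in> cross_polytope (Suc m)"
      by (simp add: cross_polytope_def)
  next
    fix \<sigma> assume "\<sigma> \<in> cross_polytope (Suc m)"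
    then have s: "\<sigma> \<subseteq> {..<2 * m} \<union> ?P" "\<And>i. \<not> {2 * i, 2 * i + 1} \<subseteq> \<sigma>"
      by (auto simp: cross_polytope_def)
    then have "\<sigma> - {..<2 * m} = {} \<or> \<sigma> - {..<2 * m} = {2 * m} \<or> \<sigma> - {..<2 * m} = {2 * m + 1}"
      using s(2)[of m] by auto
    then show "\<sigma> \<in> {\<sigma>. \<sigma> \<inter> {..<2 * m} \<in> cross_polytope m \<and> \<sigma> - {..<2 * m} \<in> discrete_complex ?P}"
      using s(2) by (auto simp: cross_polytope_def discrete_complex_def)
  qed
  finally have 1: "join (cross_polytope m) (discrete_complex ?P) \<approx>\<^sub>c cross_polytope (Suc m)"
    by (rule isomorphic_imp_join_equivalent[OF _ simplicial_complex_join[OF c]])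
  have "join (cross_polytope m) (discrete_complex ?P) \<approx>\<^sub>c join (cross_polytope m) (discrete_complex {..<2::nat})"
    by (intro isomorphic_imp_join_equivalent join_isomorphic isomorphic_complexes_refl
          discrete_complex_isomorphic simplicial_complex_join c) auto
  then show ?thesis
    by (rule join_equivalent_trans[OF join_equivalent_sym[OF 1]])
qed

lemma simplex_boundary_cross_polytope: "simplex_boundary {..<Suc m} \<approx>\<^sub>c cross_polytope m"
proof (induction m)
  case 0
  have "simplex_boundary {..<Suc 0} = cross_polytope 0"
    by (auto simp: simplex_boundary_def cross_polytope_def)
  then show ?case
    by (simp add: join_equivalent_refl simplicial_complex_cross_polytope)
next
  case (Suc m)
  have "simplex_boundary (insert (Suc m) {..<Suc m}) \<approx>\<^sub>c
      join (simplex_boundary {..<card {..<Suc m}}) (discrete_complex {..<2::nat})"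
    by (rule simplex_boundary_insert) auto
  also have "\<dots> \<approx>\<^sub>c join (cross_polytope m) (discrete_complex {..<2::nat})"
    using Suc by (simp add: join_equivalent_join simplicial_complex_discrete_complex)
  also have "\<dots> \<approx>\<^sub>c cross_polytope (Suc m)"
    by (rule join_equivalent_sym[OF cross_polytope_Suc])
  finally show ?case
    by (simp add: lessThan_Suc[of "Suc m"])
qed

lemma join_cross_polytopes: "join (cross_polytope m) (cross_polytope n) \<approx>\<^sub>c cross_polytope (m + n)"
proof (induction n)
  case 0
  show ?case
    unfolding cross_polytope_0
    using isomorphic_imp_join_equivalent[OF join_empty_face simplicial_complex_cross_polytope, of m]
      join_equivalent_sym by simp
next
  case (Suc n)
  let ?S = "discrete_complex {..<2::nat}"
  have S: "simplicial_complex ?S"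
    by (simp add: simplicial_complex_discrete_complex)
  note c = simplicial_complex_cross_polytope S simplicial_complex_join
  have "join (cross_polytope m) (cross_polytope (Suc n)) \<approx>\<^sub>c join (cross_polytope m) (join (cross_polytope n) ?S)"
    by (intro join_equivalent_join_right cross_polytope_Suc c)
  also have "\<dots> \<approx>\<^sub>c join (join (cross_polytope m) (cross_polytope n)) ?S"
    by (rule join_equivalent_sym[OF isomorphic_imp_join_equivalent[OF join_assoc]]) (intro c)
  also have "\<dots> \<approx>\<^sub>c join (cross_polytope (m + n)) ?S"
    by (intro join_equivalent_join Suc c)
  also have "\<dots> \<approx>\<^sub>c cross_polytope (Suc (m + n))"
    by (rule join_equivalent_sym[OF cross_polytope_Suc])
  finally show ?case
    by simp
qed

section \<open>The codimension-one skeleton of the boundary of a simplex\<close>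

text \<open>
  The skeleton of codimension one of the boundary of the simplex on \<open>V\<close>.
\<close>

definition missing_two :: "'a set \<Rightarrow> 'a set set" where
  "missing_two V = {\<sigma>. \<sigma> \<subseteq> V \<and> (\<forall>a\<in>V. \<not> V - {a} \<subseteq> \<sigma>)}"

text \<open>
  Write \<open>V = R \<union> {c, z}\<close>. The facets \<open>\<phi> i = (R - {i}) \<union> {c}\<close> are subdivided by new vertices \<open>b i\<close>. When the
  links of the \<open>b i\<close> have been enlarged suitably, the vertex \<open>c\<close> can be deleted, and what remains is the
  boundary of the simplex on \<open>R \<union> {z}\<close> together with a second copy of each facet except \<open>R\<close>, namely
  the cone with apex \<open>b i\<close> over its boundary. In the link of \<open>b i\<close> the vertex \<open>z\<close> is then exchanged for \<open>i\<close>, so that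
  all these cones have the common base \<open>\<partial>R\<close>. The cone with apex \<open>z\<close> has this base, too, and subdividing
  the remaining facet \<open>R\<close> by a vertex \<open>y\<close> yields the last cone: the complex has become the join of
  \<open>\<partial>R\<close> with the \<open>card R + 2\<close> points \<open>z\<close>, \<open>y\<close> and \<open>b i\<close>.
\<close>

lemma missing_two_equivalent:
  fixes R :: "nat set"
  assumes R: "finite R" "R \<noteq> {}" and co: "c \<notin> R" "z \<notin> R" "c \<noteq> z"
  defines "V \<equiv> insert c (insert z R)"
  shows "missing_two V \<approx>\<^sub>c join (simplex_boundary {..<card R}) (discrete_complex {..<card R + 2})"
proof -
  define N where "N = Suc (Max V)"
  have "finite V"
    using R by (simp add: V_def)
  have less_N: "x < N" if "x \<in> V" for x
    using that \<open>finite V\<close> by (simp add: N_def less_Suc_eq_le)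
  define b where "b i = N + i" for i
  have inj_b: "inj_on b R"
    by (simp add: b_def inj_on_def)
  have bV: "b i \<notin> V" for i
    using less_N[of "b i"] by (auto simp: b_def)
  define \<phi> where "\<phi> i = insert c (R - {i})" for i
  define B1 where "B1 = missing_two V - \<phi> ` R"
  have V: "simplicial_complex (missing_two V)"
  proof -
    have "finite (\<Union>(missing_two V))"
      by (rule finite_subset[OF _ \<open>finite V\<close>]) (auto simp: missing_two_def)
    moreover have "{} \<in> missing_two V"
      using R(2) co by (auto simp: missing_two_def V_def)
    moreover have "\<tau> \<in> missing_two V" if "\<sigma> \<in> missing_two V" "\<tau> \<subseteq> \<sigma>" for \<sigma> \<tau>
      using that unfolding missing_two_def by blast
    ultimately show ?thesis
      unfolding simplicial_complex_def by blast
  qed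
  have \<phi>_V: "\<phi> i \<in> missing_two V" if "i \<in> R" for i
  proof -
    have "i \<notin> \<phi> i" "z \<notin> \<phi> i" "i \<noteq> z" "i \<in> V" "z \<in> V" "\<phi> i \<subseteq> V"
      using that co by (auto simp: \<phi>_def V_def)
    then show ?thesis
      unfolding missing_two_def by blast
  qed
  have \<phi>_facet: "\<sigma> = \<phi> i" if "i \<in> R" "\<sigma> \<in> missing_two V" "\<phi> i \<subseteq> \<sigma>" for i \<sigma>
  proof -
    have "V - {i} \<subseteq> insert z (\<phi> i)" "V - {z} \<subseteq> insert i (\<phi> i)" "V \<subseteq> insert z (insert i (\<phi> i))"
      by (auto simp: \<phi>_def V_def)
    moreover have "i \<in> V" "z \<in> V" "\<sigma> \<subseteq> V" "\<not> V - {i} \<subseteq> \<sigma>" "\<not> V - {z} \<subseteq> \<sigma>"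
      using that by (auto simp: missing_two_def V_def)
    ultimately show ?thesis
      using \<open>\<phi> i \<subseteq> \<sigma>\<close> by blast
  qed
  have zc: "z \<notin> R" "c \<notin> R" "z \<noteq> c" "c \<noteq> z"
    using co by auto
  define link2 where
    "link2 i = {\<tau>. \<tau> \<subseteq> insert z (\<phi> i) \<and> \<not> \<phi> i \<subseteq> \<tau> \<and> \<not> (z \<in> \<tau> \<and> R - {i} \<subseteq> \<tau>)}" for i
  define B3 where "B3 = {\<sigma>. \<sigma> \<subset> insert z R}"
  define link4 where "link4 i = {\<tau>. \<tau> \<subseteq> insert z R \<and> \<not> (R - {i} \<subseteq> \<tau> \<and> (i \<in> \<tau> \<or> z \<in> \<tau>))}" for i
  have B1: "simplicial_complex B1"
    unfolding B1_def by (rule simplicial_complex_remove_facets[OF V]) (use \<phi>_facet in \<open>auto simp: \<phi>_def\<close>)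
  have bB1: "b i \<notin> \<Union>B1" for i
    using bV by (auto simp: B1_def missing_two_def)
  have link2_B1: "link2 i \<subseteq> B1" if "i \<in> R" for i
  proof
    fix \<tau> assume \<tau>: "\<tau> \<in> link2 i"
    have i: "i \<notin> \<tau>" "i \<in> V" "\<tau> \<subseteq> V"
      using \<tau> that co by (auto simp: link2_def \<phi>_def V_def)
    have "\<not> V - {a} \<subseteq> \<tau>" for a
    proof
      assume "V - {a} \<subseteq> \<tau>"
      then have "V - {i} \<subseteq> \<tau>"
        using i by blast
      then have "z \<in> \<tau> \<and> R - {i} \<subseteq> \<tau>"
        using that co by (auto simp: V_def)
      then show False
        using \<tau> by (simp add: link2_def)
    qed
    moreover have "\<tau> \<noteq> \<phi> j" for j
      using \<tau> i(1) that by (cases "i = j") (auto simp: link2_def \<phi>_def)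
    ultimately show "\<tau> \<in> B1"
      using i(3) by (auto simp: B1_def missing_two_def)
  qed
  have link2_closed: "down_closed (link2 i)" for i
    unfolding down_closed_def link2_def by blast
  have B3: "simplicial_complex B3"
    using simplicial_complex_simplex_boundary[of "insert z R"] R(1) by (simp add: B3_def simplex_boundary_def)
  have bB3: "b i \<notin> \<Union>B3" for i
    using bV[of i] by (auto simp: B3_def V_def)
  have link4_B3: "link4 i \<subseteq> B3" if "i \<in> R" for i
    using that by (auto simp: link4_def B3_def)
  have link4_closed: "down_closed (link4 i)" for i
    unfolding down_closed_def link4_def by blast
  obtain y where y: "y \<notin> V \<union> b ` R"
    using ex_new_if_finite[of "V \<union> b ` R"] infinite_UNIV_nat \<open>finite V\<close> R(1) by auto
  define P where "P = insert z (insert y (b ` R))"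
  have PR: "R \<inter> P = {}"
    using y bV co by (auto simp: P_def V_def)
  have "missing_two V \<approx>\<^sub>c attach R b B1 (\<lambda>i. {\<tau>. \<tau> \<subset> \<phi> i})"
    unfolding B1_def
  proof (rule subdivide_facets[where v = "\<lambda>_. c", OF V R(1) inj_b])
    show "inj_on \<phi> R"
      using co by (auto simp: inj_on_def \<phi>_def)
    show "b i \<notin> \<Union>(missing_two V)" for i
      using bV by (auto simp: missing_two_def)
    show "c \<in> \<phi> i" for i
      by (simp add: \<phi>_def)
    show "\<phi> i \<in> missing_two V" if "i \<in> R" for i
      by (rule \<phi>_V[OF that])
    show "\<sigma> = \<phi> i" if "i \<in> R" "\<sigma> \<in> missing_two V" "\<phi> i \<subseteq> \<sigma>" for i \<sigma>
      by (rule \<phi>_facet[OF that])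
  qed
  \<comment> \<open>An expansion of the links with apex \<open>c\<close>. Afterwards every face that contains \<open>c\<close> can be extended
    by \<open>z\<close>, so that \<open>c\<close> can be deleted in the next step.\<close>
  also have "attach R b B1 (\<lambda>i. {\<tau>. \<tau> \<subset> \<phi> i}) \<approx>\<^sub>c attach R b B1 link2"
  proof (rule join_equivalent_sym, rule attach_change_links[where w = "\<lambda>_. c", OF B1 R(1) inj_b bB1 link2_B1 link2_closed])
    show "{\<tau>. \<tau> \<subset> \<phi> i} \<subseteq> link2 i" for i
      using zc by (auto simp: link2_def \<phi>_def)
    show "down_closed {\<tau>. \<tau> \<subset> \<phi> i}" for i
      unfolding down_closed_def by blast
    fix i \<tau> assume "i \<in> R" and \<tau>: "\<tau> \<in> link2 i - {\<tau>. \<tau> \<subset> \<phi> i}"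
    then have "z \<in> \<tau>" "\<not> R - {i} \<subseteq> \<tau>" "\<tau> \<subseteq> insert z (\<phi> i)"
      unfolding link2_def by blast+
    then have "insert c \<tau> \<in> link2 i" "\<tau> - {c} \<in> link2 i" "z \<in> insert c \<tau>" "z \<in> \<tau> - {c}"
      using zc unfolding link2_def \<phi>_def by blast+
    moreover have "z \<notin> \<phi> i"
      using zc by (simp add: \<phi>_def)
    ultimately show "insert c \<tau> \<in> link2 i - {\<tau>. \<tau> \<subset> \<phi> i} \<and> \<tau> - {c} \<in> link2 i - {\<tau>. \<tau> \<subset> \<phi> i}"
      by blast
  qed
  also have "\<dots> \<approx>\<^sub>c {\<sigma> \<in> attach R b B1 link2. \<sigma> \<inter> {c} = {}}"
  proof (rule delete_vertices[of _ z])
    show "simplicial_complex (attach R b B1 link2)"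
      by (rule simplicial_complex_attach[OF B1 R(1) link2_B1 link2_closed])
    show "z \<notin> {c}"
      using co by simp
    fix \<sigma> assume \<sigma>: "\<sigma> \<in> attach R b B1 link2" "\<sigma> \<inter> {c} \<noteq> {}"
    then consider "\<sigma> \<in> B1" | i \<tau> where "i \<in> R" "\<tau> \<in> link2 i" "\<sigma> = insert (b i) \<tau>"
      by (auto simp: attach_def)
    then show "insert z \<sigma> \<in> attach R b B1 link2"
    proof cases
      case 1
      have no_ridge: "\<not> R - {i} \<subseteq> \<sigma>" if "i \<in> R" for i
      proof
        assume "R - {i} \<subseteq> \<sigma>"
        then have "\<phi> i \<subseteq> \<sigma>"
          using \<sigma>(2) by (auto simp: \<phi>_def)
        then have "\<sigma> = \<phi> i"
          using 1 that by (intro \<phi>_facet) (auto simp: B1_def)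
        then show False
          using 1 that by (auto simp: B1_def)
      qed
      have "\<not> V - {a} \<subseteq> insert z \<sigma>" for a
      proof
        assume "V - {a} \<subseteq> insert z \<sigma>"
        then have *: "R - {a} \<subseteq> \<sigma>"
          using zc by (auto simp: V_def)
        obtain i where "i \<in> R"
          using R(2) by blast
        show False
          using * no_ridge[of a] no_ridge[OF \<open>i \<in> R\<close>] by (cases "a \<in> R") auto
      qed
      moreover have "insert z \<sigma> \<noteq> \<phi> j" for j
        using zc by (auto simp: \<phi>_def)
      moreover have "insert z \<sigma> \<subseteq> V"
        using 1 by (auto simp: B1_def missing_two_def V_def)
      ultimately show ?thesis
        by (auto simp: attach_def B1_def missing_two_def)
    next
      case 2
      then have "c \<in> \<tau>"
        using \<sigma>(2) bV[of i] by (auto simp: V_def)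
      then have "insert z \<tau> \<in> link2 i"
        using 2(2) zc by (auto simp: link2_def \<phi>_def)
      then show ?thesis
        using 2 by (auto simp: attach_def insert_commute[of z])
    qed
  qed
  also have "\<dots> = attach R b B3 (\<lambda>i. {\<tau>. \<tau> \<subset> insert z (R - {i})})"
  proof -
    have base: "\<sigma> \<in> B1 \<and> c \<notin> \<sigma> \<longleftrightarrow> \<sigma> \<in> B3" for \<sigma>
    proof
      assume \<sigma>: "\<sigma> \<in> B1 \<and> c \<notin> \<sigma>"
      then have "\<not> V - {c} \<subseteq> \<sigma>" "\<sigma> \<subseteq> V"
        by (auto simp: B1_def missing_two_def V_def)
      then show "\<sigma> \<in> B3"
        using \<sigma> by (auto simp: B3_def V_def)
    next
      assume "\<sigma> \<in> B3"
      then obtain x where x: "x \<in> insert z R" "x \<notin> \<sigma>" "\<sigma> \<subseteq> insert z R"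
        by (auto simp: B3_def)
      then have c: "c \<notin> \<sigma>" "x \<noteq> c" "x \<in> V" "c \<in> V" "\<sigma> \<subseteq> V"
        using co by (auto simp: V_def)
      then have "\<sigma> \<in> missing_two V"
        using x unfolding missing_two_def by blast
      moreover have "\<sigma> \<noteq> \<phi> j" for j
        using c(1) by (auto simp: \<phi>_def)
      ultimately show "\<sigma> \<in> B1 \<and> c \<notin> \<sigma>"
        using c by (auto simp: B1_def)
    qed
    have link: "\<tau> \<in> link2 i \<and> c \<notin> \<tau> \<longleftrightarrow> \<tau> \<subset> insert z (R - {i})" for i \<tau>
      using zc by (auto simp: link2_def \<phi>_def)
    have cb: "c \<noteq> b i" for i
      using bV[of i] by (auto simp: V_def)
    have "{\<sigma> \<in> attach R b B1 link2. \<sigma> \<inter> {c} = {}} = attach R b {\<sigma> \<in> B1. c \<notin> \<sigma>} (\<lambda>i. {\<tau> \<in> link2 i. c \<notin> \<tau>})"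
      using cb by (auto simp: attach_def)
    then show ?thesis
      by (simp add: base link)
  qed
  \<comment> \<open>The link passes from the boundary of \<open>(R - {i}) \<union> {z}\<close> to that of \<open>R\<close> via \<open>link4\<close>, which collapses
    to the former with apex \<open>z\<close> and to the latter with apex \<open>i\<close>.\<close>
  also have "\<dots> \<approx>\<^sub>c attach R b B3 link4"
  proof (rule join_equivalent_sym, rule attach_change_links[where w = "\<lambda>_. z", OF B3 R(1) inj_b bB3 link4_B3 link4_closed])
    fix i assume "i \<in> R"
    show "{\<tau>. \<tau> \<subset> insert z (R - {i})} \<subseteq> link4 i"
      using zc \<open>i \<in> R\<close> unfolding link4_def by blast
    show "down_closed {\<tau>. \<tau> \<subset> insert z (R - {i})}"
      unfolding down_closed_def by blast
    fix \<tau> assume \<tau>: "\<tau> \<in> link4 i - {\<tau>. \<tau> \<subset> insert z (R - {i})}"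
    have "i \<in> \<tau>"
    proof (rule ccontr)
      assume "i \<notin> \<tau>"
      then have "\<tau> \<subseteq> insert z (R - {i})" "\<tau> \<noteq> insert z (R - {i})"
        using \<tau> unfolding link4_def by blast+
      then show False
        using \<tau> by blast
    qed
    then have "insert z \<tau> \<in> link4 i" "\<tau> - {z} \<in> link4 i" "i \<in> insert z \<tau>" "i \<in> \<tau> - {z}"
      using \<tau> zc \<open>i \<in> R\<close> unfolding link4_def by blast+
    moreover have "i \<notin> insert z (R - {i})"
      using zc \<open>i \<in> R\<close> by blast
    ultimately show "insert z \<tau> \<in> link4 i - {\<tau>. \<tau> \<subset> insert z (R - {i})} \<and>
        \<tau> - {z} \<in> link4 i - {\<tau>. \<tau> \<subset> insert z (R - {i})}"
      by blast
  qed
  also have "\<dots> \<approx>\<^sub>c attach R b B3 (\<lambda>_. {\<tau>. \<tau> \<subset> R})"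
  proof (rule attach_change_links[where w = "\<lambda>i. i", OF B3 R(1) inj_b bB3 link4_B3 link4_closed])
    fix i assume "i \<in> R"
    show "{\<tau>. \<tau> \<subset> R} \<subseteq> link4 i"
      using zc unfolding link4_def by blast
    show "down_closed {\<tau>. \<tau> \<subset> R}"
      unfolding down_closed_def by blast
    fix \<tau> assume \<tau>: "\<tau> \<in> link4 i - {\<tau>. \<tau> \<subset> R}"
    have "z \<in> \<tau>"
    proof (rule ccontr)
      assume "z \<notin> \<tau>"
      then have "\<tau> \<subseteq> R" "\<tau> \<noteq> R"
        using \<tau> \<open>i \<in> R\<close> unfolding link4_def by blast+
      then show False
        using \<tau> by blast
    qed
    then have "insert i \<tau> \<in> link4 i" "\<tau> - {i} \<in> link4 i" "z \<in> insert i \<tau>" "z \<in> \<tau> - {i}"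
      using \<tau> zc \<open>i \<in> R\<close> unfolding link4_def by blast+
    then show "insert i \<tau> \<in> link4 i - {\<tau>. \<tau> \<subset> R} \<and> \<tau> - {i} \<in> link4 i - {\<tau>. \<tau> \<subset> R}"
      using zc(1) by blast
  qed
  also have "\<dots> \<approx>\<^sub>c attach {0::nat} (\<lambda>_. y) (attach R b B3 (\<lambda>_. {\<tau>. \<tau> \<subset> R}) - (\<lambda>_. R) ` {0::nat}) (\<lambda>_. {\<tau>. \<tau> \<subset> R})"
  proof (rule subdivide_facets[where v = "\<lambda>_. SOME r. r \<in> R" and \<phi> = "\<lambda>_. R"])
    show "simplicial_complex (attach R b B3 (\<lambda>_. {\<tau>. \<tau> \<subset> R}))"
      by (rule simplicial_complex_attach[OF B3 R(1)]) (auto simp: B3_def down_closed_def)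
    show "y \<notin> \<Union>(attach R b B3 (\<lambda>_. {\<tau>. \<tau> \<subset> R}))"
      using y by (auto simp: attach_def B3_def V_def)
    show "R \<in> attach R b B3 (\<lambda>_. {\<tau>. \<tau> \<subset> R})"
      using co by (auto simp: attach_def B3_def)
    show "(SOME r. r \<in> R) \<in> R"
      using R(2) by (simp add: some_in_eq)
    show "\<sigma> = R" if "\<sigma> \<in> attach R b B3 (\<lambda>_. {\<tau>. \<tau> \<subset> R})" "R \<subseteq> \<sigma>" for \<sigma>
    proof -
      have "b i \<notin> R" for i
        using bV[of i] by (auto simp: V_def)
      then show ?thesis
        using that by (auto simp: attach_def B3_def)
    qed
  qed auto
  also have "\<dots> = {\<sigma>. \<sigma> \<inter> R \<subset> R \<and> \<sigma> - R \<in> discrete_complex P}" (is "?L = ?R")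
  proof (intro subset_antisym subsetI)
    fix \<sigma> assume "\<sigma> \<in> ?L"
    then consider "\<sigma> \<subset> insert z R" "\<sigma> \<noteq> R" | p \<tau> where "p \<in> P" "p \<notin> R" "\<tau> \<subset> R" "\<sigma> = insert p \<tau>"
      using PR by (auto simp: attach_def B3_def P_def)
    then show "\<sigma> \<in> ?R"
    proof cases
      case 1
      then have "\<sigma> - R = {} \<or> \<sigma> - R = {z}" "\<sigma> \<inter> R \<subset> R"
        using co by blast+
      then show ?thesis
        by (auto simp: discrete_complex_def P_def)
    next
      case 2
      then have "\<sigma> - R = {p}" "\<sigma> \<inter> R = \<tau>"
        by blast+
      then show ?thesis
        using 2 by (simp add: discrete_complex_def)
    qed
  next
    fix \<sigma> assume "\<sigma> \<in> ?R"
    then have *: "\<sigma> \<inter> R \<subset> R" and "\<sigma> - R = {} \<or> \<sigma> - R = {z} \<or> (\<exists>p \<in> insert y (b ` R). \<sigma> - R = {p})"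
      by (auto simp: discrete_complex_def P_def)
    then consider "\<sigma> \<subset> insert z R \<and> \<sigma> \<noteq> R" | p where "p \<in> insert y (b ` R)" "\<sigma> = insert p (\<sigma> \<inter> R)"
      using co(2) by blast
    then show "\<sigma> \<in> ?L"
    proof cases
      case 1
      then show ?thesis
        by (simp add: attach_def B3_def)
    next
      case 2
      then have "p \<notin> R"
        using PR by (auto simp: P_def)
      then have "\<sigma> \<noteq> R"
        using 2(2) by blast
      then show ?thesis
        using 2 * unfolding attach_def B3_def by blast
    qed
  qed
  also have "\<dots> \<approx>\<^sub>c join (simplex_boundary {..<card R}) (discrete_complex {..<card P})"
    using R PR by (intro join_simplex_boundary_discrete) (auto simp: P_def)
  also have "card P = card R + 2"
    using R(1) y bV co inj_b by (auto simp: P_def card_insert_if card_image V_def)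
  finally show ?thesis .
qed

section \<open>Sets without long cyclic runs\<close>

text \<open>
  Positions are taken modulo \<open>n\<close> so that windows longer than the cycle make sense: for \<open>n \<le> w\<close> each
  window covers everything, which gives the simplex boundaries from which the main induction
  starts.
\<close>

definition cyclic_complex :: "nat \<Rightarrow> nat \<Rightarrow> nat set set" where
  "cyclic_complex w n = {\<sigma>. \<sigma> \<subseteq> {..<n} \<and> (\<forall>a. \<exists>i<w. (a + i) mod n \<notin> \<sigma>)}"

lemma simplicial_complex_cyclic_complex:
  assumes "w > 0"
  shows "simplicial_complex (cyclic_complex w n)"
proof -
  have "finite (\<Union>(cyclic_complex w n))"
    by (rule finite_subset[of _ "{..<n}"]) (auto simp: cyclic_complex_def)
  moreover have "{} \<in> cyclic_complex w n"
    using assms by (auto simp: cyclic_complex_def)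
  moreover have "\<tau> \<in> cyclic_complex w n" if "\<sigma> \<in> cyclic_complex w n" "\<tau> \<subseteq> \<sigma>" for \<sigma> \<tau>
    using that unfolding cyclic_complex_def by blast
  ultimately show ?thesis
    unfolding simplicial_complex_def by blast
qed

lemma cyclic_window_subset_iff:
  fixes a w N :: nat
  assumes "a < N" "w \<le> N"
  shows "(\<forall>i<w. (a + i) mod N \<in> \<sigma>) \<longleftrightarrow>
    (if a + w \<le> N then {a..<a + w} \<subseteq> \<sigma> else {a..<N} \<subseteq> \<sigma> \<and> {..<a + w - N} \<subseteq> \<sigma>)"
proof
  assume L: "\<forall>i<w. (a + i) mod N \<in> \<sigma>"
  have 1: "x \<in> \<sigma>" if "a \<le> x" "x < a + w" "x < N" for x
    using L[rule_format, of "x - a"] that by simp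
  have 2: "x \<in> \<sigma>" if "x < a + w - N" "\<not> a + w \<le> N" for x
  proof -
    have "x < N" "a + (x + N - a) = x + N" "x + N - a < w"
      using that assms by auto
    then show ?thesis
      using L[rule_format, of "x + N - a"] by simp
  qed
  show "if a + w \<le> N then {a..<a + w} \<subseteq> \<sigma> else {a..<N} \<subseteq> \<sigma> \<and> {..<a + w - N} \<subseteq> \<sigma>"
    using 1 2 by auto
next
  assume R: "if a + w \<le> N then {a..<a + w} \<subseteq> \<sigma> else {a..<N} \<subseteq> \<sigma> \<and> {..<a + w - N} \<subseteq> \<sigma>"
  show "\<forall>i<w. (a + i) mod N \<in> \<sigma>"
  proof (intro allI impI)
    fix i assume i: "i < w"
    show "(a + i) mod N \<in> \<sigma>"
    proof (cases "a + i < N")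
      case True
      then show ?thesis
        using R i by (auto split: if_splits)
    next
      case False
      then have "(a + i) mod N = a + i - N"
        using assms i by (simp add: mod_if)
      moreover have "\<not> a + w \<le> N" "a + i - N < a + w - N"
        using False i by auto
      ultimately show ?thesis
        using R by auto
    qed
  qed
qed

lemma in_cyclic_complex_iff:
  assumes "0 < N" "w \<le> N"
  shows "\<sigma> \<in> cyclic_complex w N \<longleftrightarrow> \<sigma> \<subseteq> {..<N} \<and>
    (\<forall>a. a + w \<le> N \<longrightarrow> a < N \<longrightarrow> \<not> {a..<a + w} \<subseteq> \<sigma>) \<and>
    (\<forall>a. a < N \<longrightarrow> N < a + w \<longrightarrow> \<not> ({a..<N} \<subseteq> \<sigma> \<and> {..<a + w - N} \<subseteq> \<sigma>))"
proof -
  have "(\<forall>a. \<exists>i<w. (a + i) mod N \<notin> \<sigma>) \<longleftrightarrow> (\<forall>a<N. \<not> (\<forall>i<w. (a + i) mod N \<in> \<sigma>))"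
  proof (intro iffI allI impI)
    fix a assume "\<forall>a<N. \<not> (\<forall>i<w. (a + i) mod N \<in> \<sigma>)"
    then have "\<not> (\<forall>i<w. (a mod N + i) mod N \<in> \<sigma>)"
      using assms(1) by simp
    then show "\<exists>i<w. (a + i) mod N \<notin> \<sigma>"
      by (simp add: mod_add_left_eq)
  qed auto
  then show ?thesis
    unfolding cyclic_complex_def mem_Collect_eq
    using cyclic_window_subset_iff[OF _ assms(2)] by (auto simp: not_le)
qed

lemma full_not_in_cyclic_complex:
  assumes "0 < n" "{..<n} \<subseteq> \<sigma>"
  shows "\<sigma> \<inter> {..<n} \<notin> cyclic_complex w n"
proof -
  have "(a + i) mod n \<in> \<sigma> \<inter> {..<n}" for a i
    using assms by auto
  then show ?thesis
    by (auto simp: cyclic_complex_def)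
qed

lemma window_not_in_cyclic_complex:
  assumes "a + w \<le> n" "{a..<a + w} \<subseteq> \<sigma>"
  shows "\<sigma> \<inter> {..<n} \<notin> cyclic_complex w n"
proof -
  have "(a + i) mod n \<in> \<sigma> \<inter> {..<n}" if "i < w" for i
    using that assms by auto
  then show ?thesis
    by (auto simp: cyclic_complex_def)
qed

lemma wrapped_window_not_in_cyclic_complex:
  assumes "0 < n" "w \<le> i + j" "{n - i..<n} \<subseteq> \<sigma>" "{..<n} \<inter> {..<j} \<subseteq> \<sigma>"
  shows "\<sigma> \<inter> {..<n} \<notin> cyclic_complex w n"
proof (cases "n \<le> i")
  case True
  then show ?thesis
    using assms by (intro full_not_in_cyclic_complex) auto
next
  case False
  have "(n - i + x) mod n \<in> \<sigma> \<inter> {..<n}" if "x < w" for x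
  proof (cases "x < i")
    case True
    then have "n - i + x \<in> {n - i..<n}" "(n - i + x) mod n = n - i + x"
      using False by auto
    then show ?thesis
      using assms(3) by auto
  next
    case x: False
    then have "(n - i + x) mod n = (x - i) mod n"
      using False by (metis (no_types, lifting) Nat.add_diff_assoc2 add.commute le_add_diff_inverse2 mod_add_self2 nat_le_linear not_less)
    moreover have "x - i < j"
      using x that assms(2) by simp
    then have "(x - i) mod n < j"
      using le_less_trans[OF mod_less_eq_dividend] by blast
    ultimately have "(x - i) mod n \<in> {..<n} \<inter> {..<j}"
      using assms(1) by simp
    then show ?thesis
      using assms(4) \<open>(n - i + x) mod n = (x - i) mod n\<close> by auto
  qed
  then show ?thesis
    unfolding cyclic_complex_def by blast
qed

lemma not_in_cyclic_complex_small:
  assumes "0 < n" "n \<le> w" "\<sigma> \<inter> {..<n} \<notin> cyclic_complex w n"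
  shows "{..<n} \<subseteq> \<sigma>"
proof
  fix y assume "y \<in> {..<n}"
  obtain a where a: "\<And>i. i < w \<Longrightarrow> (a + i) mod n \<in> \<sigma>"
    using assms(3) by (auto simp: cyclic_complex_def)
  define i where "i = (y + (n - a mod n)) mod n"
  have "i < w"
    unfolding i_def using mod_less_divisor[OF assms(1)] assms(2) by (rule less_le_trans)
  have "(a + i) mod n = (a mod n + (y + (n - a mod n))) mod n"
    by (simp add: i_def mod_simps)
  also have "a mod n + (y + (n - a mod n)) = y + n"
    using mod_less_divisor[OF assms(1), of a] by simp
  also have "(y + n) mod n = y"
    using \<open>y \<in> {..<n}\<close> by simp
  finally show "y \<in> \<sigma>"
    using a[OF \<open>i < w\<close>] by simp
qed

lemma simplicial_complex_restricted:
  assumes "0 < w"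
  shows "simplicial_complex {\<sigma> \<in> cyclic_complex w N. \<sigma> \<inter> {..<n} \<in> cyclic_complex w n}" (is "simplicial_complex ?K")
proof -
  have N: "simplicial_complex (cyclic_complex w N)" and n: "simplicial_complex (cyclic_complex w n)"
    using assms by (simp_all add: simplicial_complex_cyclic_complex)
  have "finite (\<Union>?K)"
    using simplicial_complexD(1)[OF N] by (rule rev_finite_subset) blast
  moreover have "\<tau> \<in> ?K" if "\<sigma> \<in> ?K" "\<tau> \<subseteq> \<sigma>" for \<sigma> \<tau>
  proof -
    have "\<tau> \<inter> {..<n} \<subseteq> \<sigma> \<inter> {..<n}"
      using that by blast
    then show ?thesis
      using that simplicial_complexD(3)[OF N] simplicial_complexD(3)[OF n] by blast
  qed
  moreover have "{} \<in> ?K"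
    using simplicial_complexD(2)[OF N] simplicial_complexD(2)[OF n] by simp
  ultimately show ?thesis
    unfolding simplicial_complex_def by blast
qed

text \<open>
  The cycle of length \<open>n + w + 1\<close> consists of the old positions \<open>0, \<dots>, n - 1\<close> and a block of \<open>w + 1\<close> new
  ones. The first step is to remove the faces whose old part contains a window of the
  short cycle. Such a window is not yet forbidden in the long cycle only if it crosses the place where
  the block was inserted. So suppose that the last \<open>r\<close> old positions, but no more, belong to \<open>\<sigma>\<close>; then
  the first \<open>w - r\<close> old positions belong to \<open>\<sigma>\<close> as well. The windows around the two ends of the block
  prevent \<open>\<sigma>\<close> from containing all of the first \<open>w - r\<close> or all of the last \<open>r\<close> positions of the block.
  Between these lies the single position \<open>n + w - r\<close>. Every window through it contains one of the two
  sets, so it can be toggled freely.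
  The rank is the length \<open>r\<close> of the run.
\<close>

lemma restrict_large_cycle:
  assumes w: "0 < w" "w \<le> n"
  defines "N \<equiv> n + w + 1"
  shows "cyclic_complex w N \<approx>\<^sub>c {\<sigma> \<in> cyclic_complex w N. \<sigma> \<inter> {..<n} \<in> cyclic_complex w n}"
    (is "?K \<approx>\<^sub>c ?L")
proof -
  have K: "simplicial_complex ?K"
    using w(1) by (rule simplicial_complex_cyclic_complex)
  have inK: "\<sigma> \<in> ?K \<longleftrightarrow> \<sigma> \<subseteq> {..<N} \<and>
    (\<forall>a. a + w \<le> N \<longrightarrow> a < N \<longrightarrow> \<not> {a..<a + w} \<subseteq> \<sigma>) \<and>
    (\<forall>a. a < N \<longrightarrow> N < a + w \<longrightarrow> \<not> ({a..<N} \<subseteq> \<sigma> \<and> {..<a + w - N} \<subseteq> \<sigma>))" for \<sigma>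
    by (rule in_cyclic_complex_iff) (auto simp: N_def)
  define rank where "rank \<sigma> = (GREATEST i. i \<le> w \<and> {n - i..<n} \<subseteq> \<sigma>)" for \<sigma> :: "nat set"
  have rank_in: "rank \<sigma> \<le> w" "{n - rank \<sigma>..<n} \<subseteq> \<sigma>" for \<sigma>
    using GreatestI_nat[of "\<lambda>i. i \<le> w \<and> {n - i..<n} \<subseteq> \<sigma>" 0 w] by (auto simp: rank_def)
  have rank_ge: "i \<le> rank \<sigma>" if "i \<le> w" "{n - i..<n} \<subseteq> \<sigma>" for i \<sigma>
    unfolding rank_def using that by (intro Greatest_le_nat) auto
  have rank_mono: "rank \<sigma> \<le> rank \<tau>" if "\<sigma> \<inter> {..<n} \<subseteq> \<tau>" for \<sigma> \<tau>
  proof (rule rank_ge)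
    show "{n - rank \<sigma>..<n} \<subseteq> \<tau>"
      using rank_in(2)[of \<sigma>] that by auto
  qed (rule rank_in)
  have run: "0 < rank \<sigma> \<and> rank \<sigma> < w \<and> {..<w - rank \<sigma>} \<subseteq> \<sigma>" if \<sigma>: "\<sigma> \<in> ?K - ?L" for \<sigma>
  proof -
    have nw: "\<not> {a..<a + w} \<subseteq> \<sigma>" if "a + w \<le> n" for a
      using \<sigma> that w inK[of \<sigma>] by (auto simp: N_def)
    have "\<sigma> \<inter> {..<n} \<notin> cyclic_complex w n"
      using \<sigma> by blast
    then obtain a where a: "a < n" "n < a + w" "{a..<n} \<subseteq> \<sigma>" "{..<a + w - n} \<subseteq> \<sigma>"
      using in_cyclic_complex_iff[of n w "\<sigma> \<inter> {..<n}"] w nw by auto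
    have "n - a \<le> rank \<sigma>"
      using a by (intro rank_ge) auto
    moreover have "rank \<sigma> \<noteq> w"
      using rank_in(2)[of \<sigma>] nw[of "n - w"] w by auto
    moreover have "{..<w - rank \<sigma>} \<subseteq> {..<a + w - n}"
      using \<open>n - a \<le> rank \<sigma>\<close> a(1) by auto
    ultimately show ?thesis
      using a rank_in(1)[of \<sigma>] by auto
  qed
  have insert_K: "insert (n + w - rank \<sigma>) \<sigma> \<in> ?K" if \<sigma>: "\<sigma> \<in> ?K - ?L" for \<sigma>
  proof -
    define r where "r = rank \<sigma>"
    define v where "v = n + w - r"
    have r: "0 < r" "r < w" "{..<w - r} \<subseteq> \<sigma>" "{n - r..<n} \<subseteq> \<sigma>"
      using run[OF \<sigma>] rank_in(2)[of \<sigma>] by (auto simp: r_def)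
    have \<sigma>K: "\<sigma> \<in> ?K"
      using \<sigma> by blast
    have v: "n < v" "v < n + w"
      using r by (auto simp: v_def)
    have left: False if "{n..<v} \<subseteq> \<sigma>"
    proof -
      have "{n - r..<n - r + w} \<subseteq> {n - r..<n} \<union> {n..<v}"
        using r w by (auto simp: v_def)
      then have "{n - r..<n - r + w} \<subseteq> \<sigma>"
        using r(4) that by blast
      then show False
        using \<sigma>K inK[of \<sigma>] w by (auto simp: N_def)
    qed
    have right: False if "{v + 1..<N} \<subseteq> \<sigma>"
    proof -
      have "v + 1 < N" "N < v + 1 + w" "v + 1 + w - N = w - r"
        using r by (auto simp: v_def N_def)
      then show False
        using \<sigma>K inK[of \<sigma>] that r(3) by metis
    qed
    have "\<not> {a..<a + w} \<subseteq> insert v \<sigma>" if a: "a + w \<le> N" "a < N" for a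
    proof
      assume *: "{a..<a + w} \<subseteq> insert v \<sigma>"
      have "v \<in> {a..<a + w}"
      proof (rule ccontr)
        assume "v \<notin> {a..<a + w}"
        then have "{a..<a + w} \<subseteq> \<sigma>"
          using * by blast
        then show False
          using \<sigma>K inK[of \<sigma>] a by blast
      qed
      show False
      proof (cases "a \<le> n")
        case True
        then have "{n..<v} \<subseteq> {a..<a + w} - {v}"
          using \<open>v \<in> {a..<a + w}\<close> by auto
        then show False
          using * left by blast
      next
        case False
        then have "{v + 1..<N} \<subseteq> {a..<a + w} - {v}"
          using \<open>v \<in> {a..<a + w}\<close> a by (auto simp: N_def)
        then show False
          using * right by blast
      qed
    qed
    moreover have "\<not> ({a..<N} \<subseteq> insert v \<sigma> \<and> {..<a + w - N} \<subseteq> insert v \<sigma>)" if a: "a < N" "N < a + w" for a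
    proof
      assume *: "{a..<N} \<subseteq> insert v \<sigma> \<and> {..<a + w - N} \<subseteq> insert v \<sigma>"
      have vn: "v \<notin> {..<a + w - N}"
        using a v w by (auto simp: N_def)
      show False
      proof (cases "v \<in> {a..<N}")
        case True
        then have "{v + 1..<N} \<subseteq> {a..<N} - {v}"
          by auto
        then show False
          using * right by blast
      next
        case False
        then have "{a..<N} \<subseteq> \<sigma> \<and> {..<a + w - N} \<subseteq> \<sigma>"
          using * vn by blast
        then show False
          using \<sigma>K inK[of \<sigma>] a by blast
      qed
    qed
    moreover have "insert v \<sigma> \<subseteq> {..<N}"
      using \<sigma>K inK[of \<sigma>] v by (auto simp: N_def)
    ultimately show ?thesis
      unfolding inK v_def r_def by blast
  qed
  show ?thesis
  proof (rule staged_collapse[where rank = rank and v = "\<lambda>r. n + w - r"])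
    show "simplicial_complex ?K" "simplicial_complex ?L"
      by (rule K, rule simplicial_complex_restricted[OF w(1)])
    show "?L \<subseteq> ?K"
      by blast
    show "rank \<sigma> \<le> rank \<tau>" if "\<sigma> \<subseteq> \<tau>" for \<sigma> \<tau>
      using that by (intro rank_mono) blast
    fix \<sigma> assume \<sigma>: "\<sigma> \<in> ?K - ?L"
    let ?v = "n + w - rank \<sigma>"
    have "n \<le> ?v"
      using rank_in(1)[of \<sigma>] by simp
    then have eq: "insert ?v \<sigma> \<inter> {..<n} = \<sigma> \<inter> {..<n}" "(\<sigma> - {?v}) \<inter> {..<n} = \<sigma> \<inter> {..<n}"
      by auto
    have r: "rank (insert ?v \<sigma>) = rank \<sigma>" "rank (\<sigma> - {?v}) = rank \<sigma>"
      by (rule antisym; rule rank_mono; use eq in blast)+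
    have "\<sigma> - {?v} \<in> ?K"
      using simplicial_complexD(3)[OF K, of \<sigma> "\<sigma> - {?v}"] \<sigma> by blast
    then show "insert ?v \<sigma> \<in> ?K - ?L \<and> rank (insert ?v \<sigma>) = rank \<sigma>"
      "\<sigma> - {?v} \<in> ?K - ?L \<and> rank (\<sigma> - {?v}) = rank \<sigma>"
      using insert_K[OF \<sigma>] \<sigma> r eq by auto
  qed
qed

text \<open>
  Here a forbidden old part is all of \<open>{..<n}\<close>. The first new position \<open>n\<close> is toggled whenever it can be
  added. It cannot be added to \<open>\<sigma>\<close> iff \<open>\<sigma>\<close> contains \<open>{n + 1..<w - c}\<close>, where \<open>c\<close> is the length of
  the run of \<open>\<sigma>\<close> at the end of the block, and in that case the position \<open>w - c\<close> is unconstrained: it lies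
  strictly between the absent positions \<open>n\<close> and \<open>n + w - c\<close>, which are too close to each other to
  have a window between them.
\<close>

lemma restrict_small_cycle:
  assumes n: "0 < n" "n < w"
  defines "N \<equiv> n + w + 1"
  shows "cyclic_complex w N \<approx>\<^sub>c {\<sigma> \<in> cyclic_complex w N. \<sigma> \<inter> {..<n} \<in> cyclic_complex w n}"
    (is "?K \<approx>\<^sub>c ?L")
proof -
  have K: "simplicial_complex ?K"
    using n by (intro simplicial_complex_cyclic_complex) simp
  have inK: "\<sigma> \<in> ?K \<longleftrightarrow> \<sigma> \<subseteq> {..<N} \<and>
    (\<forall>a. a + w \<le> N \<longrightarrow> a < N \<longrightarrow> \<not> {a..<a + w} \<subseteq> \<sigma>) \<and>
    (\<forall>a. a < N \<longrightarrow> N < a + w \<longrightarrow> \<not> ({a..<N} \<subseteq> \<sigma> \<and> {..<a + w - N} \<subseteq> \<sigma>))" for \<sigma>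
    by (rule in_cyclic_complex_iff) (auto simp: N_def)
  have diff: "\<sigma> \<in> ?K - ?L \<longleftrightarrow> \<sigma> \<in> ?K \<and> {..<n} \<subseteq> \<sigma>" for \<sigma>
    using not_in_cyclic_complex_small[of n w \<sigma>] full_not_in_cyclic_complex[of n \<sigma> w] n by auto
  define run where "run \<sigma> = (GREATEST c. c \<le> w \<and> {N - c..<N} \<subseteq> \<sigma>)" for \<sigma> :: "nat set"
  have run_in: "run \<sigma> \<le> w" "{N - run \<sigma>..<N} \<subseteq> \<sigma>" for \<sigma>
    using GreatestI_nat[of "\<lambda>c. c \<le> w \<and> {N - c..<N} \<subseteq> \<sigma>" 0 w] by (auto simp: run_def)
  have run_ge: "c \<le> run \<sigma>" if "c \<le> w" "{N - c..<N} \<subseteq> \<sigma>" for c \<sigma>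
    unfolding run_def using that by (intro Greatest_le_nat) auto
  have run_mono: "run \<sigma> \<le> run \<tau>" if "{N - run \<sigma>..<N} \<subseteq> \<tau>" for \<sigma> \<tau>
    using that run_in(1) by (rule run_ge[rotated])
  have run: "run \<sigma> < w - n" "N - run \<sigma> - 1 \<notin> \<sigma>" if \<sigma>: "\<sigma> \<in> ?K - ?L" for \<sigma>
  proof -
    have \<sigma>': "\<sigma> \<in> ?K" "{..<n} \<subseteq> \<sigma>"
      using \<sigma> diff by blast+
    show less: "run \<sigma> < w - n"
    proof (rule ccontr)
      assume "\<not> run \<sigma> < w - n"
      then have "{2 * n + 1..<N} \<subseteq> {N - run \<sigma>..<N}"
        by (auto simp: N_def)
      then have "{2 * n + 1..<N} \<subseteq> \<sigma>"
        using run_in(2)[of \<sigma>] by blast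
      moreover have "2 * n + 1 < N" "N < 2 * n + 1 + w" "2 * n + 1 + w - N = n"
        using n by (auto simp: N_def)
      ultimately show False
        using \<sigma>' inK[of \<sigma>] by metis
    qed
    show "N - run \<sigma> - 1 \<notin> \<sigma>"
    proof
      assume "N - run \<sigma> - 1 \<in> \<sigma>"
      moreover have "{N - Suc (run \<sigma>)..<N} \<subseteq> insert (N - run \<sigma> - 1) {N - run \<sigma>..<N}"
        by auto
      ultimately have "{N - Suc (run \<sigma>)..<N} \<subseteq> \<sigma>"
        using run_in(2)[of \<sigma>] by blast
      moreover have "Suc (run \<sigma>) \<le> w"
        using less by linarith
      ultimately show False
        using run_ge[of "Suc (run \<sigma>)" \<sigma>] by simp
    qed
  qed
  have blocked_iff: "insert n \<sigma> \<notin> ?K \<longleftrightarrow> {n + 1..<w - run \<sigma>} \<subseteq> \<sigma>"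
    if \<sigma>: "\<sigma> \<in> ?K - ?L" "n \<notin> \<sigma>" for \<sigma>
  proof
    have \<sigma>': "\<sigma> \<in> ?K" "{..<n} \<subseteq> \<sigma>"
      using \<sigma> diff by blast+
    have "insert n \<sigma> \<subseteq> {..<N}"
      using \<sigma>'(1) inK[of \<sigma>] by (auto simp: N_def)
    moreover assume "insert n \<sigma> \<notin> ?K"
    ultimately consider a where "a + w \<le> N" "a < N" "{a..<a + w} \<subseteq> insert n \<sigma>"
      | a where "a < N" "N < a + w" "{a..<N} \<subseteq> insert n \<sigma>" "{..<a + w - N} \<subseteq> insert n \<sigma>"
      unfolding inK by blast
    then show "{n + 1..<w - run \<sigma>} \<subseteq> \<sigma>"
    proof cases
      case 1
      have "n \<in> {a..<a + w}"
      proof (rule ccontr)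
        assume "n \<notin> {a..<a + w}"
        then have "{a..<a + w} \<subseteq> \<sigma>"
          using 1(3) by blast
        then show False
          using \<sigma>'(1) inK[of \<sigma>] 1 by blast
      qed
      then have "{n + 1..<w - run \<sigma>} \<subseteq> {a..<a + w} - {n}"
        by auto
      then show ?thesis
        using 1(3) by blast
    next
      case 2
      have "n \<notin> {a..<N}"
        using 2 by (auto simp: N_def)
      then have aN: "{a..<N} \<subseteq> \<sigma>"
        using 2(3) by blast
      have "N - a \<le> run \<sigma>"
        using aN 2 by (intro run_ge) auto
      then have "{n + 1..<w - run \<sigma>} \<subseteq> {..<a + w - N} - {n}"
        using 2(1) by auto
      then show ?thesis
        using 2(4) by blast
    qed
  next
    have \<sigma>': "\<sigma> \<in> ?K" "{..<n} \<subseteq> \<sigma>"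
      using \<sigma> diff by blast+
    assume *: "{n + 1..<w - run \<sigma>} \<subseteq> \<sigma>"
    have "{..<w - run \<sigma>} \<subseteq> {..<n} \<union> insert n {n + 1..<w - run \<sigma>}"
      by auto
    then have **: "{..<w - run \<sigma>} \<subseteq> insert n \<sigma>"
      using * \<sigma>'(2) by blast
    show "insert n \<sigma> \<notin> ?K"
    proof (cases "run \<sigma> = 0")
      case True
      then have "{0..<0 + w} \<subseteq> insert n \<sigma>"
        using ** by (simp add: lessThan_atLeast0)
      moreover have "0 + w \<le> N" "0 < N"
        by (auto simp: N_def)
      ultimately show ?thesis
        using inK[of "insert n \<sigma>"] by blast
    next
      case False
      have "N - run \<sigma> < N" "N < N - run \<sigma> + w" "N - run \<sigma> + w - N = w - run \<sigma>"
        using False run(1)[OF \<sigma>(1)] by (auto simp: N_def)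
      moreover have "{N - run \<sigma>..<N} \<subseteq> insert n \<sigma>"
        using run_in(2)[of \<sigma>] by blast
      ultimately show ?thesis
        using inK[of "insert n \<sigma>"] ** by metis
    qed
  qed
  define rank where "rank \<sigma> = (if insert n \<sigma> \<in> ?K then 0 else Suc (run \<sigma>))" for \<sigma>
  define v where "v r = (case r of 0 \<Rightarrow> n | Suc c \<Rightarrow> w - c)" for r
  have free: "insert n \<sigma> \<in> ?K - ?L \<and> rank (insert n \<sigma>) = 0 \<and> \<sigma> - {n} \<in> ?K - ?L \<and> rank (\<sigma> - {n}) = 0"
    if \<sigma>: "\<sigma> \<in> ?K - ?L" "insert n \<sigma> \<in> ?K" for \<sigma>
  proof -
    have "{..<n} \<subseteq> \<sigma> - {n}" "{..<n} \<subseteq> insert n \<sigma>"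
      using \<sigma>(1) diff[of \<sigma>] by auto
    moreover have "\<sigma> - {n} \<in> ?K"
      using simplicial_complexD(3)[OF K \<sigma>(2), of "\<sigma> - {n}"] by blast
    moreover have "insert n (\<sigma> - {n}) = insert n \<sigma>" "insert n (insert n \<sigma>) = insert n \<sigma>"
      by auto
    ultimately show ?thesis
      unfolding diff rank_def using \<sigma>(2) by simp
  qed
  have blocked: "insert u \<sigma> \<in> ?K - ?L \<and> rank (insert u \<sigma>) = rank \<sigma> \<and> \<sigma> - {u} \<in> ?K - ?L \<and> rank (\<sigma> - {u}) = rank \<sigma>"
    if \<sigma>: "\<sigma> \<in> ?K - ?L" "insert n \<sigma> \<notin> ?K" and u_def: "u = w - run \<sigma>" for \<sigma> u
  proof -
    define c where "c = run \<sigma>"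
    have \<sigma>': "\<sigma> \<in> ?K" "{..<n} \<subseteq> \<sigma>"
      using \<sigma> diff by blast+
    have "n \<notin> \<sigma>"
      using \<sigma> by (metis DiffD1 insert_absorb)
    have c: "c < w - n" "N - c - 1 \<notin> \<sigma>" "{N - c..<N} \<subseteq> \<sigma>"
      using run[OF \<sigma>(1)] run_in(2)[of \<sigma>] by (auto simp: c_def)
    have u: "n < u" "u < N - c - 1"
      using c(1) n by (auto simp: u_def c_def[symmetric] N_def)
    have gap: "n \<notin> insert u \<sigma>" "N - c - 1 \<notin> insert u \<sigma>"
      using \<open>n \<notin> \<sigma>\<close> c(2) u by auto
    have ins: "insert u \<sigma> \<in> ?K"
    proof -
      have "\<not> {a..<a + w} \<subseteq> insert u \<sigma>" if a: "a + w \<le> N" "a < N" for a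
      proof (cases "a \<le> n")
        case True
        then have "n \<in> {a..<a + w}"
          using n by auto
        then show ?thesis
          using gap(1) by blast
      next
        case False
        then have "N - c - 1 \<in> {a..<a + w}"
          using a c(1) by (auto simp: N_def)
        then show ?thesis
          using gap(2) by blast
      qed
      moreover have "\<not> ({a..<N} \<subseteq> insert u \<sigma> \<and> {..<a + w - N} \<subseteq> insert u \<sigma>)" if a: "a < N" "N < a + w" for a
      proof (cases "n < a + w - N")
        case True
        then show ?thesis
          using gap(1) by blast
      next
        case False
        then have "N - c - 1 \<in> {a..<N}"
          using a c(1) by (auto simp: N_def)
        then show ?thesis
          using gap(2) by blast
      qed
      moreover have "insert u \<sigma> \<subseteq> {..<N}"
        using \<sigma>'(1) inK[of \<sigma>] u by auto
      ultimately show ?thesis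
        unfolding inK by blast
    qed
    have del: "\<sigma> - {u} \<in> ?K"
      using simplicial_complexD(3)[OF K \<sigma>'(1), of "\<sigma> - {u}"] by blast
    have F: "insert u \<sigma> \<in> ?K - ?L" "\<sigma> - {u} \<in> ?K - ?L"
      unfolding diff using ins del \<sigma>'(2) u(1) by auto
    have "run (insert u \<sigma>) = c"
    proof (rule antisym)
      show "run (insert u \<sigma>) \<le> c"
      proof (rule ccontr)
        assume "\<not> run (insert u \<sigma>) \<le> c"
        then have "N - c - 1 \<in> {N - run (insert u \<sigma>)..<N}"
          using c(1) by (auto simp: N_def)
        then show False
          using run_in(2)[of "insert u \<sigma>"] gap(2) by blast
      qed
      show "c \<le> run (insert u \<sigma>)"
        unfolding c_def using run_in(2)[of \<sigma>] by (intro run_mono) blast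
    qed
    moreover have "run (\<sigma> - {u}) = c"
    proof (rule antisym)
      show "run (\<sigma> - {u}) \<le> c"
        unfolding c_def using run_in(2)[of "\<sigma> - {u}"] by (intro run_mono) blast
      have "u \<notin> {N - c..<N}"
        using u by auto
      then show "c \<le> run (\<sigma> - {u})"
        using c(3) run_in(1)[of \<sigma>] by (intro run_ge) (auto simp: c_def)
    qed
    moreover have "insert n (insert u \<sigma>) \<notin> ?K"
      using simplicial_complexD(3)[OF K, of "insert n (insert u \<sigma>)" "insert n \<sigma>"] \<sigma>(2) by blast
    moreover have "insert n (\<sigma> - {u}) \<notin> ?K"
    proof -
      have "{n + 1..<w - c} \<subseteq> \<sigma>"
        using blocked_iff[OF \<sigma>(1) \<open>n \<notin> \<sigma>\<close>] \<sigma>(2) by (simp add: c_def)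
      moreover have "u \<notin> {n + 1..<w - c}"
        by (simp add: u_def c_def)
      ultimately have "{n + 1..<w - run (\<sigma> - {u})} \<subseteq> \<sigma> - {u}"
        using \<open>run (\<sigma> - {u}) = c\<close> by auto
      then show ?thesis
        using blocked_iff[OF F(2)] \<open>n \<notin> \<sigma>\<close> by blast
    qed
    ultimately show ?thesis
      using F \<sigma>(2) by (simp add: rank_def c_def)
  qed
  show ?thesis
  proof (rule staged_collapse[where rank = rank and v = v])
    show "simplicial_complex ?K" "simplicial_complex ?L"
      using n by (auto intro!: K simplicial_complex_restricted)
    show "?L \<subseteq> ?K"
      by blast
    show "rank \<sigma> \<le> rank \<tau>" if "\<sigma> \<subseteq> \<tau>" for \<sigma> \<tau>
    proof -
      have "insert n \<sigma> \<subseteq> insert n \<tau>"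
        using that by blast
      then have "insert n \<tau> \<in> ?K \<Longrightarrow> insert n \<sigma> \<in> ?K"
        using simplicial_complexD(3)[OF K] by blast
      moreover have "run \<sigma> \<le> run \<tau>"
        using that run_in(2)[of \<sigma>] by (intro run_mono) blast
      ultimately show ?thesis
        by (simp add: rank_def)
    qed
    fix \<sigma> assume \<sigma>: "\<sigma> \<in> ?K - ?L"
    show "insert (v (rank \<sigma>)) \<sigma> \<in> ?K - ?L \<and> rank (insert (v (rank \<sigma>)) \<sigma>) = rank \<sigma>"
      "\<sigma> - {v (rank \<sigma>)} \<in> ?K - ?L \<and> rank (\<sigma> - {v (rank \<sigma>)}) = rank \<sigma>"
      using free[OF \<sigma>] blocked[OF \<sigma> _ refl] by (cases "insert n \<sigma> \<in> ?K"; simp add: rank_def v_def)+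
  qed
qed

text \<open>
  Once the old part is a face of the short cycle, the only windows of the long cycle left to
  check are those that overlap the start of the block in \<open>w - i\<close> positions or its end in \<open>w - j\<close>.
  Natural number subtraction and the intersection with \<open>{..<n}\<close> take care of windows that are longer
  than the old part.
\<close>

lemma in_restricted_complex_iff:
  assumes n: "0 < n" and w: "0 < w"
  defines "N \<equiv> n + w + 1"
  shows "\<sigma> \<in> cyclic_complex w N \<and> \<sigma> \<inter> {..<n} \<in> cyclic_complex w n \<longleftrightarrow>
    \<sigma> \<subseteq> {..<N} \<and> \<sigma> \<inter> {..<n} \<in> cyclic_complex w n \<and>
    (\<forall>i<w. \<not> ({n..<n + w - i} \<subseteq> \<sigma> \<and> {n - i..<n} \<subseteq> \<sigma>)) \<and>
    (\<forall>j<w. \<not> ({n + j + 1..<N} \<subseteq> \<sigma> \<and> {..<n} \<inter> {..<j} \<subseteq> \<sigma>))"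
    (is "?L \<longleftrightarrow> ?R")
proof -
  have inK: "\<sigma> \<in> cyclic_complex w N \<longleftrightarrow> \<sigma> \<subseteq> {..<N} \<and>
    (\<forall>a. a + w \<le> N \<longrightarrow> a < N \<longrightarrow> \<not> {a..<a + w} \<subseteq> \<sigma>) \<and>
    (\<forall>a. a < N \<longrightarrow> N < a + w \<longrightarrow> \<not> ({a..<N} \<subseteq> \<sigma> \<and> {..<a + w - N} \<subseteq> \<sigma>))" for \<sigma>
    by (rule in_cyclic_complex_iff) (auto simp: N_def)
  show ?thesis
  proof
    assume L: ?L
    have not_full: "\<not> {..<n} \<subseteq> \<sigma>"
      using L full_not_in_cyclic_complex[OF n] by blast
    have "\<not> ({n..<n + w - i} \<subseteq> \<sigma> \<and> {n - i..<n} \<subseteq> \<sigma>)" if "i < w" for i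
    proof
      assume *: "{n..<n + w - i} \<subseteq> \<sigma> \<and> {n - i..<n} \<subseteq> \<sigma>"
      show False
      proof (cases "i \<le> n")
        case True
        then have "{n - i..<n - i + w} \<subseteq> {n - i..<n} \<union> {n..<n + w - i}"
          using that by auto
        then have "{n - i..<n - i + w} \<subseteq> \<sigma>"
          using * by blast
        moreover have "n - i + w \<le> N" "n - i < N"
          by (auto simp: N_def)
        ultimately show False
          using L inK[of \<sigma>] by blast
      next
        case False
        then show False
          using * not_full by (simp add: lessThan_atLeast0)
      qed
    qed
    moreover have "\<not> ({n + j + 1..<N} \<subseteq> \<sigma> \<and> {..<n} \<inter> {..<j} \<subseteq> \<sigma>)" if "j < w" for j
    proof
      assume *: "{n + j + 1..<N} \<subseteq> \<sigma> \<and> {..<n} \<inter> {..<j} \<subseteq> \<sigma>"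
      consider "j = 0" | "0 < j" "j \<le> n" | "n < j"
        by linarith
      then show False
      proof cases
        case 1
        have "n + 1 + w \<le> N" "n + 1 < N" "{n + 1..<n + 1 + w} \<subseteq> \<sigma>"
          using * 1 w by (auto simp: N_def)
        then show False
          using L inK[of \<sigma>] by blast
      next
        case 2
        have "n + j + 1 < N" "N < n + j + 1 + w" "n + j + 1 + w - N = j"
          using that 2 by (auto simp: N_def)
        moreover have "{..<j} \<subseteq> \<sigma>"
          using * 2 by auto
        ultimately show False
          using L inK[of \<sigma>] * by metis
      next
        case 3
        then have "{..<n} \<inter> {..<j} = {..<n}"
          by auto
        then show False
          using * not_full by simp
      qed
    qed
    ultimately show ?R
      using L inK[of \<sigma>] by blast
  next
    assume R: ?R
    have A: "\<not> ({n..<n + w - i} \<subseteq> \<sigma> \<and> {n - i..<n} \<subseteq> \<sigma>)" if "i < w" for i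
      using R that by blast
    have C: "\<not> ({n + j + 1..<N} \<subseteq> \<sigma> \<and> {..<n} \<inter> {..<j} \<subseteq> \<sigma>)" if "j < w" for j
      using R that by blast
    have "\<not> {a..<a + w} \<subseteq> \<sigma>" if a: "a + w \<le> N" for a
    proof
      assume *: "{a..<a + w} \<subseteq> \<sigma>"
      have "a \<le> n + 1"
        using a by (simp add: N_def)
      then consider "a = n + 1" | "a + w \<le> n" | "a \<le> n" "n < a + w"
        by linarith
      then show False
      proof cases
        case 1
        then show False
          using * C[of 0] w by (simp add: N_def)
      next
        case 2
        then show False
          using * R window_not_in_cyclic_complex by blast
      next
        case 3
        then have "{n..<n + w - (n - a)} \<subseteq> {a..<a + w}" "{n - (n - a)..<n} \<subseteq> {a..<a + w}" "n - a < w"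
          by auto
        then show False
          using * A[of "n - a"] by blast
      qed
    qed
    moreover have "\<not> ({a..<N} \<subseteq> \<sigma> \<and> {..<a + w - N} \<subseteq> \<sigma>)" if a: "a < N" "N < a + w" for a
    proof
      assume *: "{a..<N} \<subseteq> \<sigma> \<and> {..<a + w - N} \<subseteq> \<sigma>"
      have "n + (a - n - 1) + 1 = a" "a + w - N = a - n - 1" "a - n - 1 < w"
        using a by (auto simp: N_def)
      then show False
        using * C[of "a - n - 1"] by auto
    qed
    ultimately show ?L
      using R inK[of \<sigma>] by blast
  qed
qed

text \<open>
  Let \<open>K2\<close> be the complex obtained by restricting the old parts. A new vertex \<open>N\<close> is brought in such
  that \<open>N\<close> and the interior of the block form a minimal nonface \<open>B\<close>, a set of \<open>w\<close> vertices. Then both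
  end positions \<open>n\<close> and \<open>n + w\<close> of the block can be deleted, as each of them together with the interior
  of the block is already a window and thus \<open>N\<close> is an apex of its link. After
  this deletion no window meets both the old part and the block, and the join of \<open>cyclic_complex w n\<close>
  with the boundary of \<open>B\<close> remains.
  
  That \<open>N\<close> can be added is seen in two steps. With the additional nonfaces \<open>N \<union> E j\<close>, where \<open>E j\<close> is
  the \<open>j\<close>-th window at the end of the block without the position \<open>n + w\<close>, this position becomes
  an apex of the link of \<open>N\<close> (\<open>K3\<close> collapses to \<open>K2\<close>). The faces containing some
  \<open>N \<union> E j\<close> are then restored with apex \<open>n\<close> (\<open>K4\<close> collapses to \<open>K3\<close>): a window at the start of the block
  and \<open>E j\<close> overlap so much that, without \<open>n\<close>, they together with \<open>N\<close> already cover \<open>B\<close> or a window of the old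
  part.
\<close>

theorem cyclic_complex_add_block:
  assumes n: "0 < n" and w: "2 \<le> w"
  shows "cyclic_complex w (n + w + 1) \<approx>\<^sub>c join (cyclic_complex w n) (simplex_boundary {..<w})"
proof -
  define N where "N = n + w + 1"
  define K2 where "K2 = {\<sigma> \<in> cyclic_complex w N. \<sigma> \<inter> {..<n} \<in> cyclic_complex w n}"
  have inK2: "\<sigma> \<in> K2 \<longleftrightarrow> \<sigma> \<subseteq> {..<N} \<and> \<sigma> \<inter> {..<n} \<in> cyclic_complex w n \<and>
    (\<forall>i<w. \<not> ({n..<n + w - i} \<subseteq> \<sigma> \<and> {n - i..<n} \<subseteq> \<sigma>)) \<and>
    (\<forall>j<w. \<not> ({n + j + 1..<N} \<subseteq> \<sigma> \<and> {..<n} \<inter> {..<j} \<subseteq> \<sigma>))" for \<sigma>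
    using in_restricted_complex_iff[of n w \<sigma>] n w by (simp add: K2_def N_def)
  have K2: "simplicial_complex K2"
    unfolding K2_def using w by (intro simplicial_complex_restricted) simp
  have step1: "cyclic_complex w N \<approx>\<^sub>c K2"
    unfolding K2_def N_def using restrict_large_cycle[of w n] restrict_small_cycle[of n w] n w
    by (cases "w \<le> n") auto
  define B where "B = insert N {n + 1..<n + w}"
  define K4 where "K4 = {\<sigma>. \<sigma> \<subseteq> {..N} \<and> \<sigma> - {N} \<in> K2 \<and> \<not> B \<subseteq> \<sigma>}"
  define E where "E j \<sigma> \<longleftrightarrow> {n + j + 1..<n + w} \<subseteq> \<sigma> \<and> {..<n} \<inter> {..<j} \<subseteq> \<sigma>" for j and \<sigma> :: "nat set"
  define K3 where "K3 = {\<sigma> \<in> K4. N \<in> \<sigma> \<longrightarrow> (\<forall>j<w. \<not> E j \<sigma>)}"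
  have K4: "simplicial_complex K4"
  proof -
    have "finite (\<Union>K4)"
      by (rule finite_subset[of _ "{..N}"]) (auto simp: K4_def)
    moreover have "{} \<in> K4"
      using simplicial_complexD(2)[OF K2] by (simp add: K4_def B_def)
    moreover have "\<tau> \<in> K4" if "\<sigma> \<in> K4" "\<tau> \<subseteq> \<sigma>" for \<sigma> \<tau>
    proof -
      have "\<tau> - {N} \<in> K2"
        using that simplicial_complexD(3)[OF K2, of "\<sigma> - {N}" "\<tau> - {N}"] by (auto simp: K4_def)
      then show ?thesis
        using that by (auto simp: K4_def)
    qed
    ultimately show ?thesis
      unfolding simplicial_complex_def by blast
  qed
  have K3: "simplicial_complex K3"
  proof -
    have "finite (\<Union>K3)"
      by (rule finite_subset[of _ "{..N}"]) (auto simp: K3_def K4_def)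
    moreover have "{} \<in> K3"
      using simplicial_complexD(2)[OF K4] by (simp add: K3_def)
    moreover have "\<tau> \<in> K3" if "\<sigma> \<in> K3" "\<tau> \<subseteq> \<sigma>" for \<sigma> \<tau>
    proof -
      have "\<tau> \<in> K4"
        using that simplicial_complexD(3)[OF K4] by (auto simp: K3_def)
      moreover have "E j \<tau> \<Longrightarrow> E j \<sigma>" for j
        using that(2) unfolding E_def by blast
      ultimately show ?thesis
        using that unfolding K3_def by blast
    qed
    ultimately show ?thesis
      unfolding simplicial_complex_def by blast
  qed
  have not_full: "\<not> {..<n} \<subseteq> \<sigma>" if "\<sigma> - {N} \<in> K2" for \<sigma>
  proof
    assume "{..<n} \<subseteq> \<sigma>"
    then have "{..<n} \<subseteq> \<sigma> - {N}"
      by (auto simp: N_def)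
    then show False
      using that full_not_in_cyclic_complex[OF n] unfolding inK2 by blast
  qed
  have step2: "K3 \<approx>\<^sub>c K2"
  proof -
    have "K3 \<approx>\<^sub>c {\<sigma> \<in> K3. \<sigma> \<inter> {N} = {}}"
    proof (rule delete_vertices[OF K3, of "n + w"])
      show "n + w \<notin> {N}"
        by (simp add: N_def)
      fix \<sigma> assume \<sigma>: "\<sigma> \<in> K3" "\<sigma> \<inter> {N} \<noteq> {}"
      then have \<sigma>': "\<sigma> \<subseteq> {..N}" "\<sigma> - {N} \<in> K2" "\<not> B \<subseteq> \<sigma>" "\<And>j. j < w \<Longrightarrow> \<not> E j \<sigma>"
        by (auto simp: K3_def K4_def)
      let ?\<tau> = "insert (n + w) \<sigma>"
      have E: "\<not> E j ?\<tau>" if "j < w" for j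
      proof
        assume "E j ?\<tau>"
        then have "E j \<sigma>"
          by (auto simp: E_def)
        then show False
          using \<sigma>'(4)[OF that] by blast
      qed
      have eq: "(?\<tau> - {N}) \<inter> {..<n} = (\<sigma> - {N}) \<inter> {..<n}"
        by auto
      have "\<not> ({n..<n + w - i} \<subseteq> ?\<tau> - {N} \<and> {n - i..<n} \<subseteq> ?\<tau> - {N})" if "i < w" for i
      proof
        assume *: "{n..<n + w - i} \<subseteq> ?\<tau> - {N} \<and> {n - i..<n} \<subseteq> ?\<tau> - {N}"
        have "n + w \<notin> {n..<n + w - i}" "n + w \<notin> {n - i..<n}"
          by auto
        then have "{n..<n + w - i} \<subseteq> \<sigma> - {N} \<and> {n - i..<n} \<subseteq> \<sigma> - {N}"
          using * by blast
        then show False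
          using \<sigma>'(2) that unfolding inK2 by blast
      qed
      moreover have "\<not> ({n + j + 1..<N} \<subseteq> ?\<tau> - {N} \<and> {..<n} \<inter> {..<j} \<subseteq> ?\<tau> - {N})" if "j < w" for j
      proof
        assume *: "{n + j + 1..<N} \<subseteq> ?\<tau> - {N} \<and> {..<n} \<inter> {..<j} \<subseteq> ?\<tau> - {N}"
        have "{n + j + 1..<n + w} \<subseteq> {n + j + 1..<N}"
          by (auto simp: N_def)
        then have "E j ?\<tau>"
          using * unfolding E_def by blast
        then show False
          using E[OF that] by blast
      qed
      moreover have "?\<tau> - {N} \<subseteq> {..<N}"
        using \<sigma>'(1) by (auto simp: N_def)
      ultimately have "?\<tau> - {N} \<in> K2"
        using \<sigma>'(2) unfolding inK2 eq by blast
      moreover have "?\<tau> \<subseteq> {..N}"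
        using \<sigma>'(1) by (auto simp: N_def)
      moreover have "\<not> B \<subseteq> ?\<tau>"
        using \<sigma>'(3) by (auto simp: B_def N_def)
      ultimately show "?\<tau> \<in> K3"
        unfolding K3_def K4_def using E by blast
    qed
    also have "{\<sigma> \<in> K3. \<sigma> \<inter> {N} = {}} = K2"
    proof (intro subset_antisym subsetI)
      fix \<sigma> assume "\<sigma> \<in> {\<sigma> \<in> K3. \<sigma> \<inter> {N} = {}}"
      then have "\<sigma> - {N} \<in> K2" "\<sigma> - {N} = \<sigma>"
        by (auto simp: K3_def K4_def)
      then show "\<sigma> \<in> K2"
        by simp
    next
      fix \<sigma> assume \<sigma>: "\<sigma> \<in> K2"
      then have "\<sigma> \<subseteq> {..<N}"
        by (simp add: inK2)
      then have "N \<notin> \<sigma>" "\<sigma> - {N} = \<sigma>" "\<sigma> \<subseteq> {..N}"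
        by auto
      then show "\<sigma> \<in> {\<sigma> \<in> K3. \<sigma> \<inter> {N} = {}}"
        using \<sigma> by (simp add: K3_def K4_def B_def)
    qed
    finally show ?thesis .
  qed
  have step3: "K4 \<approx>\<^sub>c K3"
  proof (rule collapses_at_imp_join_equivalent[of n])
    have "insert n \<sigma> \<in> K4 - K3 \<and> \<sigma> - {n} \<in> K4 - K3" if \<sigma>: "\<sigma> \<in> K4 - K3" for \<sigma>
    proof -
      have \<sigma>': "\<sigma> \<subseteq> {..N}" "\<sigma> - {N} \<in> K2" "\<not> B \<subseteq> \<sigma>" "N \<in> \<sigma>"
        using \<sigma> by (auto simp: K3_def K4_def)
      obtain j where j: "j < w" "E j \<sigma>"
        using \<sigma> by (auto simp: K3_def)
      have jn: "j < n"
      proof (rule ccontr)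
        assume "\<not> j < n"
        then have "{..<n} \<inter> {..<j} = {..<n}"
          by auto
        then show False
          using j(2) not_full[OF \<sigma>'(2)] by (simp add: E_def)
      qed
      have nN: "n \<noteq> N"
        by (simp add: N_def)
      have "E j (insert n \<sigma>)" "E j (\<sigma> - {n})"
        using j(2) unfolding E_def by auto
      moreover have "\<sigma> - {n} \<in> K4"
        using simplicial_complexD(3)[OF K4, of \<sigma> "\<sigma> - {n}"] \<sigma> by blast
      moreover have "insert n \<sigma> \<in> K4"
      proof -
        let ?\<tau> = "insert n \<sigma>"
        have eq: "(?\<tau> - {N}) \<inter> {..<n} = (\<sigma> - {N}) \<inter> {..<n}"
          by auto
        have "\<not> ({n..<n + w - i} \<subseteq> ?\<tau> - {N} \<and> {n - i..<n} \<subseteq> ?\<tau> - {N})" if "i < w" for i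
        proof
          assume *: "{n..<n + w - i} \<subseteq> ?\<tau> - {N} \<and> {n - i..<n} \<subseteq> ?\<tau> - {N}"
          show False
          proof (cases "w \<le> i + j")
            case True
            have "{n - i..<n} \<subseteq> \<sigma> - {N}"
              using * by auto
            moreover have "{..<n} \<inter> {..<j} \<subseteq> \<sigma> - {N}"
              using j(2) by (auto simp: E_def N_def)
            ultimately show False
              using wrapped_window_not_in_cyclic_complex[OF n True] \<sigma>'(2) unfolding inK2 by blast
          next
            case False
            then have "{n + 1..<n + w} \<subseteq> ({n..<n + w - i} - {n}) \<union> {n + j + 1..<n + w}"
              by auto
            moreover have "{n + j + 1..<n + w} \<subseteq> \<sigma>"
              using j(2) by (simp add: E_def)
            ultimately have "{n + 1..<n + w} \<subseteq> \<sigma>"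
              using * by blast
            then show False
              using \<sigma>'(3,4) by (simp add: B_def)
          qed
        qed
        moreover have "\<not> ({n + j + 1..<N} \<subseteq> ?\<tau> - {N} \<and> {..<n} \<inter> {..<j} \<subseteq> ?\<tau> - {N})" if "j < w" for j
        proof
          assume *: "{n + j + 1..<N} \<subseteq> ?\<tau> - {N} \<and> {..<n} \<inter> {..<j} \<subseteq> ?\<tau> - {N}"
          have "n \<notin> {n + j + 1..<N}" "n \<notin> {..<n} \<inter> {..<j}"
            by auto
          then have "{n + j + 1..<N} \<subseteq> \<sigma> - {N} \<and> {..<n} \<inter> {..<j} \<subseteq> \<sigma> - {N}"
            using * by blast
          then show False
            using \<sigma>'(2) that unfolding inK2 by blast
        qed
        moreover have "?\<tau> - {N} \<subseteq> {..<N}"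
          using \<sigma>'(1) by (auto simp: N_def)
        ultimately have "?\<tau> - {N} \<in> K2"
          using \<sigma>'(2) unfolding inK2 eq by blast
        moreover have "?\<tau> \<subseteq> {..N}"
          using \<sigma>'(1) by (auto simp: N_def)
        moreover have "\<not> B \<subseteq> ?\<tau>"
          using \<sigma>'(3) by (auto simp: B_def N_def)
        ultimately show ?thesis
          by (simp add: K4_def)
      qed
      ultimately show ?thesis
        using j(1) \<sigma>'(4) nN by (auto simp: K3_def)
    qed
    moreover have "K3 \<subseteq> K4"
      by (auto simp: K3_def)
    ultimately show "collapses_at n K4 K3"
      unfolding collapses_at_def using K3 K4 by blast
  qed
  have step4: "K4 \<approx>\<^sub>c {\<sigma> \<in> K4. \<sigma> \<inter> {n, n + w} = {}}"
  proof (rule delete_vertices[OF K4, of N])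
    show "N \<notin> {n, n + w}"
      by (simp add: N_def)
    fix \<sigma> assume \<sigma>: "\<sigma> \<in> K4" "\<sigma> \<inter> {n, n + w} \<noteq> {}"
    then have \<sigma>': "\<sigma> \<subseteq> {..N}" "\<sigma> - {N} \<in> K2" "\<not> B \<subseteq> \<sigma>"
      by (auto simp: K4_def)
    have "insert N \<sigma> - {N} = \<sigma> - {N}"
      by auto
    moreover have "\<not> B \<subseteq> insert N \<sigma>"
    proof
      assume "B \<subseteq> insert N \<sigma>"
      then have mid: "{n + 1..<n + w} \<subseteq> \<sigma> - {N}"
        by (auto simp: B_def N_def)
      consider "n \<in> \<sigma>" | "n + w \<in> \<sigma>"
        using \<sigma>(2) by blast
      then show False
      proof cases
        case 1
        have "{n..<n + w - 0} \<subseteq> insert n {n + 1..<n + w}"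
          by auto
        then have "{n..<n + w - 0} \<subseteq> \<sigma> - {N}" "{n - 0..<n} \<subseteq> \<sigma> - {N}"
          using mid 1 by (auto simp: N_def)
        then show False
          using \<sigma>'(2) w unfolding inK2 by (metis not_numeral_le_zero gr0I)
      next
        case 2
        have "{n + 0 + 1..<N} \<subseteq> insert (n + w) {n + 1..<n + w}"
          by (auto simp: N_def)
        then have "{n + 0 + 1..<N} \<subseteq> \<sigma> - {N}" "{..<n} \<inter> {..<0} \<subseteq> \<sigma> - {N}"
          using mid 2 by (auto simp: N_def)
        then show False
          using \<sigma>'(2) w unfolding inK2 by (metis not_numeral_le_zero gr0I)
      qed
    qed
    ultimately show "insert N \<sigma> \<in> K4"
      using \<sigma>' by (simp add: K4_def)
  qed
  have K6: "{\<sigma> \<in> K4. \<sigma> \<inter> {n, n + w} = {}} = {\<sigma>. \<sigma> \<inter> {..<n} \<in> cyclic_complex w n \<and> \<sigma> - {..<n} \<in> simplex_boundary B}"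
    (is "?L = ?R")
  proof (intro subset_antisym subsetI)
    fix \<sigma> assume "\<sigma> \<in> ?L"
    then have \<sigma>: "\<sigma> \<subseteq> {..N}" "\<sigma> - {N} \<in> K2" "\<not> B \<subseteq> \<sigma>" "n \<notin> \<sigma>" "n + w \<notin> \<sigma>"
      by (auto simp: K4_def)
    have "(\<sigma> - {N}) \<inter> {..<n} = \<sigma> \<inter> {..<n}"
      by (auto simp: N_def)
    then have "\<sigma> \<inter> {..<n} \<in> cyclic_complex w n"
      using \<sigma>(2) by (simp add: inK2)
    moreover have "\<sigma> - {..<n} \<subseteq> B"
    proof
      fix x assume "x \<in> \<sigma> - {..<n}"
      then have "n \<le> x" "x \<le> N" "x \<noteq> n" "x \<noteq> n + w"
        using \<sigma> by auto
      then show "x \<in> B"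
        by (auto simp: B_def N_def)
    qed
    ultimately show "\<sigma> \<in> ?R"
      using \<sigma>(3) by (auto simp: simplex_boundary_def)
  next
    fix \<sigma> assume \<sigma>: "\<sigma> \<in> ?R"
    then have \<sigma>': "\<sigma> \<inter> {..<n} \<in> cyclic_complex w n" "\<sigma> - {..<n} \<subset> B"
      by (auto simp: simplex_boundary_def)
    have nB: "n \<notin> B" "n + w \<notin> B"
      by (auto simp: B_def N_def)
    then have n_\<sigma>: "n \<notin> \<sigma>" "n + w \<notin> \<sigma>"
      using \<sigma>'(2) by auto
    have "B \<inter> {..<n} = {}"
      by (auto simp: B_def N_def)
    then have "\<not> B \<subseteq> \<sigma>"
      using \<sigma>'(2) by blast
    moreover have "\<sigma> \<subseteq> {..<n} \<union> B"
      using \<sigma>'(2) by blast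
    then have "\<sigma> \<subseteq> {..N}"
      by (auto simp: B_def N_def)
    moreover have "\<sigma> - {N} \<in> K2"
    proof -
      have "(\<sigma> - {N}) \<inter> {..<n} = \<sigma> \<inter> {..<n}"
        by (auto simp: N_def)
      moreover have "\<not> ({n..<n + w - i} \<subseteq> \<sigma> - {N} \<and> {n - i..<n} \<subseteq> \<sigma> - {N})" if "i < w" for i
        using that n_\<sigma>(1) by (auto simp: subset_iff)
      moreover have "\<not> ({n + j + 1..<N} \<subseteq> \<sigma> - {N} \<and> {..<n} \<inter> {..<j} \<subseteq> \<sigma> - {N})" if "j < w" for j
        using that n_\<sigma>(2) by (auto simp: subset_iff N_def)
      moreover have "\<sigma> - {N} \<subseteq> {..<N}"
        using \<open>\<sigma> \<subseteq> {..N}\<close> by auto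
      ultimately show ?thesis
        using \<sigma>'(1) by (simp only: inK2) blast
    qed
    ultimately show "\<sigma> \<in> ?L"
      using n_\<sigma> by (simp add: K4_def)
  qed
  have c: "simplicial_complex (cyclic_complex w n)" "simplicial_complex (simplex_boundary B)"
    by (rule simplicial_complex_cyclic_complex, use w in simp)
       (rule simplicial_complex_simplex_boundary, simp_all add: B_def)
  have "join (cyclic_complex w n) (simplex_boundary B) \<cong>\<^sub>c {\<sigma> \<in> K4. \<sigma> \<inter> {n, n + w} = {}}"
    unfolding K6
    by (rule join_disjoint[OF c]) (auto simp: cyclic_complex_def simplex_boundary_def B_def N_def)
  then have step5: "join (cyclic_complex w n) (simplex_boundary B) \<approx>\<^sub>c {\<sigma> \<in> K4. \<sigma> \<inter> {n, n + w} = {}}"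
    by (rule isomorphic_imp_join_equivalent) (rule simplicial_complex_join[OF c])
  have "card B = w"
    using w by (simp add: B_def N_def)
  then have step6: "join (cyclic_complex w n) (simplex_boundary B) \<approx>\<^sub>c join (cyclic_complex w n) (simplex_boundary {..<w})"
    by (intro isomorphic_imp_join_equivalent join_isomorphic isomorphic_complexes_refl
          simplex_boundary_isomorphic simplicial_complex_join c) (auto simp: B_def)
  note step1
  also note join_equivalent_sym[OF step2]
  also note join_equivalent_sym[OF step3]
  also note step4
  also note join_equivalent_sym[OF step5]
  also note step6
  finally show ?thesis
    by (simp add: N_def)
qed

section \<open>The wedge of spheres\<close>

lemma continuous_on_apply:
  fixes F :: "'z::topological_space \<Rightarrow> 'w \<Rightarrow> 'v::topological_space"
  assumes "continuous_on A F"
  shows "continuous_on A (\<lambda>q. F q k)"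
  by (rule continuous_on_compose2[OF continuous_on_product_coordinates[of k] assms]) simp

text \<open>
  The wedge as a subspace of a power: the union of the coordinate axes through the base point. Maps and
  homotopies into the wedge can thus be given coordinatewise.
\<close>

definition wedge_axes :: "'a set \<Rightarrow> 'a \<Rightarrow> nat \<Rightarrow> (nat \<Rightarrow> 'a) set" where
  "wedge_axes S b p = {y. \<exists>i<p. \<exists>u\<in>S. y = (\<lambda>j. if j = i then u else b)}"

text \<open>
  The map from the wedge to the axes comes from the universal property of the quotient. Its inverse is
  continuous on each of the finitely many axes, and these are closed.
\<close>

lemma wedge_sum_homeomorphic_axes:
  fixes S :: "'a::t2_space set"
  assumes b: "b \<in> S"
  shows "wedge_sum (\<lambda>_. top_of_set S) (\<lambda>_. b) {..<p} homeomorphic_space top_of_set (wedge_axes S b p)"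
proof -
  define X where "X = sum_topology (\<lambda>_. top_of_set S) {..<p}"
  define r where "r = wedge_rel (\<lambda>_. top_of_set S) (\<lambda>_. b) {..<p}"
  define q where "q x = r `` {x}" for x
  let ?W = "wedge_sum (\<lambda>_. top_of_set S) (\<lambda>_. b) {..<p}"
  have top_X: "topspace X = {..<p} \<times> S"
    by (auto simp: X_def)
  have r: "equiv (topspace X) r"
    unfolding X_def r_def using b by (intro equiv_wedge_rel) auto
  have q: "quotient_map X ?W q"
    unfolding wedge_sum_def q_def using quotient_map_quotient_topology[OF r] by (simp add: X_def r_def)
  have q_eq: "q x = q y \<longleftrightarrow> x = y \<or> snd x = b \<and> snd y = b" if "x \<in> topspace X" "y \<in> topspace X" for x y
  proof -
    have "q x = q y \<longleftrightarrow> (x, y) \<in> r"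
      unfolding q_def using eq_equiv_class_iff[OF r that] .
    then show ?thesis
      using that by (auto simp: r_def wedge_rel_def top_X image_iff)
  qed
  define h where "h x j = (if j = fst x then snd x else b)" for x :: "nat \<times> 'a" and j
  have "continuous_on S (\<lambda>u. h (i, u))" for i
  proof (rule continuous_on_coordinatewise_then_product)
    show "continuous_on S (\<lambda>u. h (i, u) j)" for j
      by (cases "j = i") (simp_all add: h_def)
  qed
  moreover have h_axes: "h (i, u) \<in> wedge_axes S b p" if "i < p" "u \<in> S" for i u
    using that by (auto simp: wedge_axes_def h_def fun_eq_iff)
  ultimately have "continuous_map (top_of_set S) (top_of_set (wedge_axes S b p)) (\<lambda>u. h (i, u))" if "i < p" for i
    using that by auto
  then have "continuous_map X (top_of_set (wedge_axes S b p)) h"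
    using h_axes by (auto simp: X_def continuous_map_def openin_sum_topology)
  moreover have "h x = h y" if "x \<in> topspace X" "y \<in> topspace X" "q x = q y" for x y
    using that q_eq[of x y] by (auto simp: h_def fun_eq_iff)
  ultimately obtain F where F: "continuous_map ?W (top_of_set (wedge_axes S b p)) F"
    and F_q: "\<And>x. x \<in> topspace X \<Longrightarrow> F (q x) = h x"
    using quotient_map_lift_exists[OF q, of "top_of_set (wedge_axes S b p)" h] by metis
  define T where "T i = {y \<in> wedge_axes S b p. \<forall>j. j \<noteq> i \<longrightarrow> y j = b}" for i
  define idx where "idx y = (SOME i. i < p \<and> y \<in> T i)" for y
  define G where "G y = q (idx y, y (idx y))" for y
  have idx: "idx y < p" "y \<in> T (idx y)" if "y \<in> wedge_axes S b p" for y
  proof -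
    have "\<exists>i. i < p \<and> y \<in> T i"
      using that by (auto simp: T_def wedge_axes_def)
    then show "idx y < p" "y \<in> T (idx y)"
      unfolding idx_def by (metis (mono_tags, lifting) someI_ex)+
  qed
  have coord: "y i \<in> S" if "y \<in> wedge_axes S b p" for y i
    using that b by (auto simp: wedge_axes_def)
  have glue: "q (i, y i) = q (j, y j)" if "i < p" "j < p" "y \<in> T i" "y \<in> T j" for i j y
  proof (cases "i = j")
    case False
    then have "y i = b" "y j = b"
      using that by (auto simp: T_def)
    then show ?thesis
      using that b by (subst q_eq) (auto simp: top_X)
  qed simp
  have G: "continuous_map (top_of_set (wedge_axes S b p)) ?W G"
  proof (rule pasting_lemma_closed[where I = "{..<p}" and T = T and f = "\<lambda>i y. q (i, y i)"])
    show "closedin (top_of_set (wedge_axes S b p)) (T i)" for i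
    proof -
      have "closed {y :: nat \<Rightarrow> 'a. j \<noteq> i \<longrightarrow> y j = b}" for j
      proof (cases "j = i")
        case False
        have "closed {y :: nat \<Rightarrow> 'a. y j = b}"
          by (intro closed_Collect_eq continuous_on_const continuous_on_product_coordinates)
        then show ?thesis
          using False by simp
      qed simp
      then have "closed {y :: nat \<Rightarrow> 'a. \<forall>j. j \<noteq> i \<longrightarrow> y j = b}"
        by (intro closed_Collect_all)
      then show ?thesis
        unfolding closedin_closed by (intro exI conjI) (auto simp: T_def)
    qed
    show "continuous_map (subtopology (top_of_set (wedge_axes S b p)) (T i)) ?W (\<lambda>y. q (i, y i))"
      if "i \<in> {..<p}" for i
    proof -
      have "continuous_on (wedge_axes S b p \<inter> T i) (\<lambda>y. y i)"
        by (rule continuous_on_subset[OF continuous_on_product_coordinates]) simp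
      then have "continuous_map (subtopology (top_of_set (wedge_axes S b p)) (T i)) (top_of_set S) (\<lambda>y. y i)"
        using coord by (auto simp: subtopology_subtopology)
      moreover have "continuous_map (top_of_set S) X (Pair i)"
        using that unfolding X_def by (intro continuous_map_component_injection) auto
      ultimately have "continuous_map (subtopology (top_of_set (wedge_axes S b p)) (T i)) ?W (q \<circ> (Pair i \<circ> (\<lambda>y. y i)))"
        by (rule continuous_map_compose[OF continuous_map_compose quotient_imp_continuous_map[OF q]])
      then show ?thesis
        by (simp add: comp_def)
    qed
    show "\<exists>j. j \<in> {..<p} \<and> y \<in> T j \<and> G y = q (j, y j)" if "y \<in> topspace (top_of_set (wedge_axes S b p))" for y
      using that idx[of y] by (auto simp: G_def)
    show "q (i, y i) = q (j, y j)"
      if "i \<in> {..<p}" "j \<in> {..<p}" "y \<in> topspace (top_of_set (wedge_axes S b p)) \<inter> T i \<inter> T j" for i j y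
      by (rule glue) (use that in simp_all)
  qed simp
  have "homeomorphic_maps ?W (top_of_set (wedge_axes S b p)) F G"
    unfolding homeomorphic_maps_def
  proof (intro conjI F G ballI)
    fix c assume "c \<in> topspace ?W"
    then obtain i u where iu: "(i, u) \<in> topspace X" "c = q (i, u)"
      using quotient_imp_surjective_map[OF q] by (metis imageE surj_pair)
    define y where "y = h (i, u)"
    have "i < p" "u \<in> S"
      using iu(1) by (auto simp: top_X)
    then have y: "y \<in> wedge_axes S b p" "y \<in> T i" "y i = u"
      using h_axes by (auto simp: y_def T_def h_def)
    have "G (F c) = q (idx y, y (idx y))"
      unfolding iu(2) F_q[OF iu(1)] y_def[symmetric] G_def ..
    also have "\<dots> = q (i, y i)"
      using idx[OF y(1)] y(2) \<open>i < p\<close> by (intro glue)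
    finally show "G (F c) = c"
      using iu(2) y(3) by simp
  next
    fix y assume "y \<in> topspace (top_of_set (wedge_axes S b p))"
    then have y: "y \<in> wedge_axes S b p"
      by simp
    have "F (G y) = h (idx y, y (idx y))"
      unfolding G_def using idx(1)[OF y] coord[OF y] by (intro F_q) (simp add: top_X)
    also have "\<dots> = y"
      using idx(2)[OF y] by (auto simp: h_def T_def fun_eq_iff)
    finally show "F (G y) = y" .
  qed
  then show ?thesis
    unfolding homeomorphic_space_def by blast
qed

lemma wedge_axes_one_homeomorphic:
  fixes S :: "'a::t2_space set"
  shows "top_of_set (wedge_axes S b 1) homeomorphic_space top_of_set S"
proof -
  have "homeomorphic_maps (top_of_set (wedge_axes S b 1)) (top_of_set S) (\<lambda>y. y 0) (\<lambda>u j. if j = 0 then u else b)"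
    unfolding homeomorphic_maps_def continuous_map_subtopology_eu
  proof (intro conjI ballI)
    show "continuous_on (wedge_axes S b 1) (\<lambda>y. y 0)"
      by (rule continuous_on_subset[OF continuous_on_product_coordinates]) simp
    show "continuous_on S (\<lambda>u j :: nat. if j = 0 then u else b)"
    proof (rule continuous_on_coordinatewise_then_product)
      show "continuous_on S (\<lambda>u. if j = 0 then u else b)" for j :: nat
        by (cases "j = 0") simp_all
    qed
  qed (auto simp: wedge_axes_def fun_eq_iff)
  then show ?thesis
    unfolding homeomorphic_space_def by blast
qed

definition sphere_set :: "nat \<Rightarrow> (nat \<Rightarrow> real) set" where
  "sphere_set m = {y. (\<Sum>i<Suc m. (y i)\<^sup>2) = 1 \<and> (\<forall>i>m. y i = 0)}"

lemma nsphere_eq_sphere_set: "nsphere m = top_of_set (sphere_set m)"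
  by (simp add: nsphere sphere_set_def euclidean_product_topology lessThan_Suc_atMost del: sum.lessThan_Suc)

lemma sphere_basepoint_in_sphere_set: "sphere_basepoint \<in> sphere_set m"
  using sphere_basepoint_in_nsphere[of m] by (simp add: nsphere_eq_sphere_set)

text \<open>
  The function \<open>arm i h\<close> encodes a signed height: positive heights are recorded at index \<open>i + 1\<close>, which
  belongs to the \<open>i\<close>-th sphere, and negative ones at the common index \<open>0\<close>.
\<close>

definition arm :: "nat \<Rightarrow> real \<Rightarrow> nat \<Rightarrow> real" where
  "arm i h = (\<lambda>j. if j = 0 then max (-h) 0 else if j = Suc i then max h 0 else 0)"

text \<open>
  The boundaries of \<open>p\<close> octahedra \<open>\<bar>h\<bar> + (\<Sum>k<m. \<bar>z k\<bar>) = 1\<close>, glued along their lower halves \<open>h \<le> 0\<close>.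
\<close>

definition octahedra_wedge :: "nat \<Rightarrow> nat \<Rightarrow> ((nat \<Rightarrow> real) \<times> (nat \<Rightarrow> real)) set" where
  "octahedra_wedge m p =
     {(z, s). \<exists>i<p. \<exists>h. s = arm i h \<and> (\<forall>k\<ge>m. z k = 0) \<and> \<bar>h\<bar> + (\<Sum>k<m. \<bar>z k\<bar>) = 1}"

lemma sum_arm:
  assumes "i < p"
  shows "(\<Sum>j<p. arm i h (Suc j)) = max h 0" "(\<Sum>j<Suc p. arm i h j) = \<bar>h\<bar>"
proof -
  show *: "(\<Sum>j<p. arm i h (Suc j)) = max h 0"
    using assms by (simp add: arm_def)
  show "(\<Sum>j<Suc p. arm i h j) = \<bar>h\<bar>"
    unfolding sum.lessThan_Suc_shift * by (auto simp: arm_def)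
qed

lemma sum_double_index: "(\<Sum>i<2 * m. f i) = (\<Sum>k<m. f (2 * k) + f (2 * k + 1 :: nat) :: real)"
  by (induction m) (simp_all add: algebra_simps)

text \<open>
  The barycentric coordinates of two opposite vertices, at most one of which is nonzero, are the positive
  and negative part of one signed coordinate.
\<close>

lemma realization_homeomorphic_octahedra:
  assumes p: "0 < p"
  shows "geometric_realization (join (cross_polytope m) (discrete_complex {..<Suc p}))
    homeomorphic_space top_of_set (octahedra_wedge m p)"
proof -
  let ?D = "discrete_complex {..<Suc p}"
  let ?K = "join (cross_polytope m) ?D"
  have c: "simplicial_complex (cross_polytope m)" "simplicial_complex ?D"
    by (simp_all only: simplicial_complex_cross_polytope simplicial_complex_discrete_complex finite_lessThan)
  have K: "simplicial_complex ?K"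
    by (rule simplicial_complex_join[OF c])
  have "\<Union>(cross_polytope m) = {..<2 * m}"
  proof (intro subset_antisym subsetI)
    fix i assume "i \<in> {..<2 * m}"
    then have "{i} \<in> cross_polytope m"
      by (auto simp: cross_polytope_def)
    then show "i \<in> \<Union>(cross_polytope m)"
      by blast
  qed (auto simp: cross_polytope_def)
  moreover have "\<Union>?D = {..<Suc p}"
    by (auto simp: discrete_complex_def)
  ultimately have U: "\<Union>?K = {..<2 * m} <+> {..<Suc p}"
    by (simp add: Union_join[OF c])
  have sum_U: "(\<Sum>v\<in>\<Union>?K. x v) = (\<Sum>k<m. x (Inl (2 * k)) + x (Inl (2 * k + 1))) + (\<Sum>j<Suc p. x (Inr j))"
    for x :: "nat + nat \<Rightarrow> real"
    unfolding U by (simp add: sum.Plus sum_double_index del: sum.lessThan_Suc)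
  define F where "F x = (\<lambda>k. x (Inl (2 * k)) - x (Inl (2 * k + 1)), \<lambda>j. x (Inr j))" for x :: "nat + nat \<Rightarrow> real"
  define G where "G = (\<lambda>(z, s). case_sum (\<lambda>i. if even i then max (z (i div 2)) 0 else max (- z (i div 2)) 0) s
      :: nat + nat \<Rightarrow> real)"
  have KD: "0 \<le> x v" "x (Inl (2 * k)) = 0 \<or> x (Inl (2 * k + 1)) = 0" "m \<le> k \<Longrightarrow> x (Inl (2 * k)) = 0 \<and> x (Inl (2 * k + 1)) = 0"
    "(\<forall>j. x (Inr j) = 0) \<or> (\<exists>a<Suc p. \<forall>j. j \<noteq> a \<longrightarrow> x (Inr j) = 0)"
    "(\<Sum>k<m. x (Inl (2 * k)) + x (Inl (2 * k + 1))) + (\<Sum>j<Suc p. x (Inr j)) = 1"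
    if x: "x \<in> realization_carrier ?K" for x v k
  proof -
    note xD = realization_carrierD[OF K x]
    show "0 \<le> x v"
      by (rule xD)
    have "Inl -` {v. x v \<noteq> 0} \<in> cross_polytope m" "Inr -` {v. x v \<noteq> 0} \<in> ?D"
      using xD(2) by (simp_all add: join_def)
    then have 1: "Inl -` {v. x v \<noteq> 0} \<subseteq> {..<2 * m}" "\<forall>k. \<not> {2 * k, 2 * k + 1} \<subseteq> Inl -` {v. x v \<noteq> 0}"
      and 2: "Inr -` {v. x v \<noteq> 0} = {} \<or> (\<exists>a<Suc p. Inr -` {v. x v \<noteq> 0} = {a})"
      by (auto simp: cross_polytope_def discrete_complex_def)
    show "x (Inl (2 * k)) = 0 \<or> x (Inl (2 * k + 1)) = 0"
      using 1(2) by auto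
    show "x (Inl (2 * k)) = 0 \<and> x (Inl (2 * k + 1)) = 0" if "m \<le> k"
      using 1(1) that by (auto simp: subset_iff)
    show "(\<forall>j. x (Inr j) = 0) \<or> (\<exists>a<Suc p. \<forall>j. j \<noteq> a \<longrightarrow> x (Inr j) = 0)"
      using 2 by blast
    show "(\<Sum>k<m. x (Inl (2 * k)) + x (Inl (2 * k + 1))) + (\<Sum>j<Suc p. x (Inr j)) = 1"
      using xD(3) unfolding sum_U .
  qed
  have F: "F x \<in> octahedra_wedge m p" if x: "x \<in> realization_carrier ?K" for x
  proof -
    note xD = KD[OF x]
    define s where "s = (\<lambda>j. x (Inr j))"
    have "\<exists>i<p. \<exists>h. s = arm i h"
    proof -
      obtain a where a: "a < Suc p" "\<And>j. j \<noteq> a \<Longrightarrow> s j = 0"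
        using xD(4) p unfolding s_def by blast
      show ?thesis
      proof (cases a)
        case 0
        have "s = arm 0 (- s 0)"
          using a(2) xD(1) unfolding 0 by (auto simp: arm_def s_def fun_eq_iff)
        then show ?thesis
          using p by blast
      next
        case (Suc i)
        have "s = arm i (s (Suc i))"
          using a(2) xD(1) unfolding Suc by (auto simp: arm_def s_def fun_eq_iff)
        then show ?thesis
          using a(1) Suc by blast
      qed
    qed
    then obtain i h where i: "i < p" "s = arm i h"
      by blast
    have "\<bar>x (Inl (2 * k)) - x (Inl (2 * k + 1))\<bar> = x (Inl (2 * k)) + x (Inl (2 * k + 1))" for k
      using xD(1)[of "Inl (2 * k)"] xD(1)[of "Inl (2 * k + 1)"] xD(2)[of k] by auto
    then have "\<bar>h\<bar> + (\<Sum>k<m. \<bar>x (Inl (2 * k)) - x (Inl (2 * k + 1))\<bar>) = 1"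
      using xD(5) sum_arm(2)[OF i(1), of h] i(2) by (simp add: s_def fun_eq_iff del: sum.lessThan_Suc)
    then show ?thesis
      using i xD(3) by (auto simp: octahedra_wedge_def F_def s_def)
  qed
  have G: "G (z, s) \<in> realization_carrier ?K" if zs: "(z, s) \<in> octahedra_wedge m p" for z s
  proof -
    obtain i h where i: "i < p" "s = arm i h" and z: "\<And>k. m \<le> k \<Longrightarrow> z k = 0" "\<bar>h\<bar> + (\<Sum>k<m. \<bar>z k\<bar>) = 1"
      using zs by (auto simp: octahedra_wedge_def)
    have "(\<Sum>v\<in>\<Union>?K. G (z, s) v) = (\<Sum>k<m. \<bar>z k\<bar>) + \<bar>h\<bar>"
    proof -
      have "G (z, s) (Inl (2 * k)) + G (z, s) (Inl (2 * k + 1)) = \<bar>z k\<bar>" for k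
        by (auto simp: G_def)
      moreover have "(\<Sum>j<Suc p. G (z, s) (Inr j)) = \<bar>h\<bar>"
        using sum_arm(2)[OF i(1), of h] by (simp add: G_def i(2) del: sum.lessThan_Suc)
      ultimately show ?thesis
        unfolding sum_U by simp
    qed
    moreover have "0 \<le> G (z, s) v" for v
      by (auto simp: G_def i(2) arm_def split: sum.splits)
    moreover have "{v. G (z, s) v \<noteq> 0} \<in> ?K"
    proof -
      have "i < 2 * m" if "G (z, s) (Inl i) \<noteq> 0" for i
      proof (rule ccontr)
        assume "\<not> i < 2 * m"
        then have "z (i div 2) = 0"
          by (intro z) auto
        then show False
          using that by (simp add: G_def split: if_splits)
      qed
      then have "Inl -` {v. G (z, s) v \<noteq> 0} \<subseteq> {..<2 * m}"
        by blast
      moreover have "\<not> {2 * k, 2 * k + 1} \<subseteq> Inl -` {v. G (z, s) v \<noteq> 0}" for k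
        by (auto simp: G_def)
      moreover have "Inr -` {v. G (z, s) v \<noteq> 0} = (if h < 0 then {0} else if 0 < h then {Suc i} else {})"
        by (auto simp: G_def i(2) arm_def)
      then have "Inr -` {v. G (z, s) v \<noteq> 0} \<in> ?D"
        using i(1) by (auto simp: discrete_complex_def)
      ultimately show ?thesis
        unfolding join_def cross_polytope_def by blast
    qed
    ultimately show ?thesis
      using z(2) by (simp add: realization_carrier_iff[OF K])
  qed
  have "homeomorphic_maps (geometric_realization ?K) (top_of_set (octahedra_wedge m p)) F G"
    unfolding homeomorphic_maps_def geometric_realization_top_of_set continuous_map_subtopology_eu
  proof (intro conjI ballI)
    show "continuous_on (realization_carrier ?K) F"
      unfolding F_def
      by (intro continuous_on_Pair continuous_on_coordinatewise_then_product continuous_intros continuous_on_coordinate)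
    show "continuous_on (octahedra_wedge m p) G"
    proof (rule continuous_on_coordinatewise_then_product)
      fix v
      have fz: "continuous_on S (\<lambda>q. fst q k)" and sn: "continuous_on S (\<lambda>q. snd q k)"
        for S :: "((nat \<Rightarrow> real) \<times> (nat \<Rightarrow> real)) set" and k
        by (rule continuous_on_apply[OF continuous_on_fst[OF continuous_on_id]])
           (rule continuous_on_apply[OF continuous_on_snd[OF continuous_on_id]])
      show "continuous_on (octahedra_wedge m p) (\<lambda>q. G q v)"
      proof (cases v)
        case (Inl i)
        then show ?thesis
          by (cases "even i") (simp_all add: G_def case_prod_unfold continuous_intros fz)
      next
        case (Inr j)
        then show ?thesis
          by (simp add: G_def case_prod_unfold sn)
      qed
    qed
    show "G (F x) = x" if "x \<in> topspace (top_of_set (realization_carrier ?K))" for x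
    proof
      fix v
      have x: "x \<in> realization_carrier ?K"
        using that by simp
      show "G (F x) v = x v"
      proof (cases v)
        case (Inl i)
        have k: "x (Inl (2 * (i div 2))) = 0 \<or> x (Inl (2 * (i div 2) + 1)) = 0"
          "0 \<le> x (Inl (2 * (i div 2)))" "0 \<le> x (Inl (2 * (i div 2) + 1))"
          using KD(1,2)[OF x] by blast+
        show ?thesis
        proof (cases "even i")
          case True
          then have "2 * (i div 2) = i"
            by simp
          then show ?thesis
            using k True Inl by (auto simp: G_def F_def)
        next
          case False
          then have "2 * (i div 2) + 1 = i"
            by simp
          then show ?thesis
            using k False Inl by (auto simp: G_def F_def)
        qed
      next
        case (Inr j)
        then show ?thesis
          by (simp add: G_def F_def)
      qed
    qed
    show "F (G q) = q" if "q \<in> topspace (top_of_set (octahedra_wedge m p))" for q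
      by (cases q) (auto simp: F_def G_def fun_eq_iff)
  qed (use F G in auto)
  then show ?thesis
    unfolding homeomorphic_space_def by blast
qed

text \<open>
  The common lower half is contractible, and collapsing it to a point produces the wedge. Explicitly, \<open>f\<close>
  sends the lower half to the base point and stretches the \<open>i\<close>-th upper half over the \<open>i\<close>-th sphere;
  \<open>g\<close> includes the \<open>i\<close>-th sphere as the \<open>i\<close>-th octahedron. In the coordinates \<open>(h, z)\<close> of a single
  octahedron \<open>g \<circ> f\<close> is \<open>(h, z) \<mapsto> (2 s - 1, s z)\<close> up to scaling, where \<open>s = max h 0\<close>. It is
  homotopic to the identity by a straight line followed by normalization. The path
  never passes through the origin, and it does not leave the \<open>i\<close>-th octahedron; on the lower half it is
  independent of \<open>i\<close>, so the paths on the different octahedra fit together. A straight line of the same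
  kind on each sphere fixes the base point and deforms \<open>f \<circ> g\<close> into the identity.
\<close>

lemma octahedra_homotopy_equivalent_axes:
  assumes p: "0 < p"
  shows "top_of_set (octahedra_wedge m p) homotopy_equivalent_space
    top_of_set (wedge_axes (sphere_set m) sphere_basepoint p)"
proof -
  let ?M = "octahedra_wedge m p" and ?W = "wedge_axes (sphere_set m) sphere_basepoint p"
  let ?e = "sphere_basepoint"
  note [simp del] = sum.lessThan_Suc
  define nrm where "nrm y = sqrt (\<Sum>i<Suc m. (y i)\<^sup>2)" for y :: "nat \<Rightarrow> real"
  define N where "N y = (\<lambda>i. y i / nrm y)" for y :: "nat \<Rightarrow> real"
  define L where "L y = (\<Sum>i<Suc m. \<bar>y i\<bar>)" for y :: "nat \<Rightarrow> real"
  have L_split: "L y = \<bar>y 0\<bar> + (\<Sum>k<m. \<bar>y (Suc k)\<bar>)" for y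
    unfolding L_def sum.lessThan_Suc_shift by simp
  have nrm_pos: "0 < nrm y" if "\<exists>i\<le>m. y i \<noteq> 0" for y
  proof -
    obtain i where "i \<le> m" "y i \<noteq> 0"
      using \<open>\<exists>i\<le>m. y i \<noteq> 0\<close> by blast
    then show ?thesis
      unfolding nrm_def real_sqrt_gt_0_iff by (intro sum_pos2[of _ i]) auto
  qed
  have N_sphere: "N y \<in> sphere_set m" if "\<And>i. m < i \<Longrightarrow> y i = 0" "\<exists>i\<le>m. y i \<noteq> 0" for y
  proof -
    have "(\<Sum>i<Suc m. (y i / nrm y)\<^sup>2) = (\<Sum>i<Suc m. (y i)\<^sup>2) / (nrm y)\<^sup>2"
      by (simp add: power_divide sum_divide_distrib)
    also have "(nrm y)\<^sup>2 = (\<Sum>i<Suc m. (y i)\<^sup>2)"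
      unfolding nrm_def by (intro real_sqrt_pow2 sum_nonneg) auto
    finally show ?thesis
      using nrm_pos[OF that(2)] that(1) by (auto simp: sphere_set_def N_def nrm_def)
  qed
  have L_pos: "0 < L u" if "u \<in> sphere_set m" for u
  proof -
    have "(\<Sum>i<Suc m. (u i)\<^sup>2) \<noteq> 0"
      using that by (simp add: sphere_set_def)
    then obtain i where "i < Suc m" "u i \<noteq> 0"
      by (metis (mono_tags, lifting) lessThan_iff sum.neutral zero_power2)
    then show ?thesis
      unfolding L_def by (intro sum_pos2[of _ i]) auto
  qed
  have e: "?e 0 = 1" "?e (Suc k) = 0" for k
    by (simp_all add: sphere_basepoint_def)
  have L_e: "L ?e = 1"
    by (simp add: L_split e)
  have N_e: "N ?e = ?e"
    unfolding N_def nrm_def sum.lessThan_Suc_shift by (simp add: e)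
  \<comment> \<open>Coordinate \<open>0\<close> of the sphere runs against the height, since the lower half has to go to the base
    point, where this coordinate is \<open>1\<close>.\<close>
  define raw where "raw s z = (\<lambda>i. if i = 0 then 1 - 2 * s else s * z (i - 1))" for s :: real and z :: "nat \<Rightarrow> real"
  have raw_0: "raw 0 z = ?e" for z
    by (auto simp: raw_def sphere_basepoint_def)
  have raw_nonzero: "\<exists>i\<le>m. raw (max h 0) z i \<noteq> 0" if "\<bar>h\<bar> + (\<Sum>k<m. \<bar>z k\<bar>) = 1" for h z
  proof (cases "max h 0 = 1 / 2")
    case True
    then have "h = 1 / 2"
      by (simp add: max_def split: if_splits)
    then have "(\<Sum>k<m. \<bar>z k\<bar>) \<noteq> 0"
      using that by simp
    then obtain k where "k < m" "z k \<noteq> 0"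
      by (metis (mono_tags, lifting) abs_zero lessThan_iff sum.neutral)
    then show ?thesis
      using True by (intro exI[of _ "Suc k"]) (simp add: raw_def)
  qed (auto simp: raw_def intro!: exI[of _ 0])
  define f where "f q = (\<lambda>j. N (raw (snd q (Suc j)) (fst q)))" for q :: "(nat \<Rightarrow> real) \<times> (nat \<Rightarrow> real)"
  define g where "g y = (\<lambda>k. \<Sum>j<p. y j (Suc k) / L (y j),
      \<lambda>j. case j of 0 \<Rightarrow> 1 - (\<Sum>j<p. 1 - max (y j 0 / L (y j)) 0) | Suc j \<Rightarrow> max (- (y j 0 / L (y j))) 0)"
    for y :: "nat \<Rightarrow> nat \<Rightarrow> real"
  have f_arm: "f (z, arm i h) = (\<lambda>j. if j = i then N (raw (max h 0) z) else ?e)" for z i h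
    by (auto simp: f_def arm_def raw_0 N_e)
  have f_M: "f q \<in> ?W" if "q \<in> ?M" for q
  proof -
    obtain i h z where *: "i < p" "q = (z, arm i h)" "\<And>k. m \<le> k \<Longrightarrow> z k = 0" "\<bar>h\<bar> + (\<Sum>k<m. \<bar>z k\<bar>) = 1"
      using \<open>q \<in> ?M\<close> by (auto simp: octahedra_wedge_def)
    have "raw (max h 0) z i = 0" if "m < i" for i
      using *(3)[of "i - 1"] that by (simp add: raw_def)
    then have "N (raw (max h 0) z) \<in> sphere_set m"
      using raw_nonzero[OF *(4)] by (intro N_sphere)
    then show ?thesis
      using *(1,2) by (auto simp: f_arm wedge_axes_def)
  qed
  have g_axis: "g (\<lambda>j. if j = i then u else ?e) = (\<lambda>k. u (Suc k) / L u, arm i (- (u 0 / L u)))"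
    if "i < p" "u \<in> sphere_set m" for i u
  proof -
    have "(\<Sum>j<p. (if j = i then u else ?e) (Suc k) / L (if j = i then u else ?e)) =
        (\<Sum>j<p. if j = i then u (Suc k) / L u else 0)" for k
      by (intro sum.cong) (auto simp: e)
    moreover have "(\<Sum>j<p. 1 - max ((if j = i then u else ?e) 0 / L (if j = i then u else ?e)) 0) =
        (\<Sum>j<p. if j = i then 1 - max (u 0 / L u) 0 else 0)"
      by (intro sum.cong) (auto simp: e L_e)
    ultimately show ?thesis
      using that(1) by (auto simp: g_def arm_def e L_e fun_eq_iff split: nat.splits)
  qed
  have g_W: "g y \<in> ?M" if "y \<in> ?W" for y
  proof -
    obtain i u where *: "i < p" "u \<in> sphere_set m" "y = (\<lambda>j. if j = i then u else ?e)"
      using \<open>y \<in> ?W\<close> by (auto simp: wedge_axes_def)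
    have "\<bar>- (u 0 / L u)\<bar> + (\<Sum>k<m. \<bar>u (Suc k) / L u\<bar>) = (\<bar>u 0\<bar> + (\<Sum>k<m. \<bar>u (Suc k)\<bar>)) / L u"
      using L_pos[OF *(2)] by (simp add: sum_divide_distrib add_divide_distrib)
    also have "\<dots> = 1"
      using L_pos[OF *(2)] unfolding L_split[of u, symmetric] by simp
    finally have "\<bar>- (u 0 / L u)\<bar> + (\<Sum>k<m. \<bar>u (Suc k) / L u\<bar>) = 1" .
    moreover have "u (Suc k) / L u = 0" if "m \<le> k" for k
      using *(2) that by (simp add: sphere_set_def)
    ultimately show ?thesis
      unfolding *(3) g_axis[OF *(1,2)] octahedra_wedge_def using *(1) by blast
  qed
  have cont_f: "continuous_on ?M f"
  proof (intro continuous_on_coordinatewise_then_product)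
    fix j i
    have c: "continuous_on ?M (\<lambda>q. fst q k)" "continuous_on ?M (\<lambda>q. snd q k)" for k
      by (rule continuous_on_apply[OF continuous_on_fst[OF continuous_on_id]])
         (rule continuous_on_apply[OF continuous_on_snd[OF continuous_on_id]])
    have raw: "continuous_on ?M (\<lambda>q. raw (snd q (Suc j)) (fst q) i)" for i
      by (cases "i = 0") (auto simp: raw_def intro!: continuous_intros c)
    have "nrm (raw (snd q (Suc j)) (fst q)) \<noteq> 0" if "q \<in> ?M" for q
    proof -
      obtain i h z where *: "q = (z, arm i h)" "\<bar>h\<bar> + (\<Sum>k<m. \<bar>z k\<bar>) = 1"
        using \<open>q \<in> ?M\<close> by (auto simp: octahedra_wedge_def)
      show ?thesis
      proof (cases "j = i")
        case True
        then have "snd q (Suc j) = max h 0"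
          by (simp add: * arm_def)
        then show ?thesis
          using nrm_pos[OF raw_nonzero[OF *(2)]] *(1) by simp
      next
        case False
        then have "raw (snd q (Suc j)) (fst q) = ?e"
          by (simp add: * arm_def raw_0)
        then show ?thesis
          using nrm_pos[of ?e] e(1) by fastforce
      qed
    qed
    then show "continuous_on ?M (\<lambda>q. f q j i)"
      unfolding f_def N_def nrm_def by (intro continuous_intros raw) blast
  qed
  have L_coord: "0 < L (y j)" if "y \<in> ?W" for y j
    using that L_pos L_e by (auto simp: wedge_axes_def)
  have cont_L: "continuous_on A (\<lambda>q. L (F q))" if "\<And>i. continuous_on A (\<lambda>q. F q i)"
    for A :: "'z::topological_space set" and F
    unfolding L_def by (intro continuous_intros that)
  have cy: "continuous_on ?W (\<lambda>y. y j i)" for j i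
    by (rule continuous_on_apply[OF continuous_on_apply[OF continuous_on_id]])
  have cont_g: "continuous_on ?W g"
    unfolding g_def
  proof (intro continuous_on_Pair continuous_on_coordinatewise_then_product)
    have d: "continuous_on ?W (\<lambda>y. y j i / L (y j))" for j i
      by (intro continuous_intros cy cont_L) (use L_coord[of _ j] in \<open>simp add: less_imp_neq[symmetric]\<close>)
    show "continuous_on ?W (\<lambda>y. \<Sum>j<p. y j (Suc k) / L (y j))" for k
      by (intro continuous_intros d)
    show "continuous_on ?W (\<lambda>y. case j of 0 \<Rightarrow> 1 - (\<Sum>j<p. 1 - max (y j 0 / L (y j)) 0)
        | Suc j \<Rightarrow> max (- (y j 0 / L (y j))) 0)" for j
      by (cases j) (auto intro!: continuous_intros d)
  qed
  \<comment> \<open>\<open>hgt\<close> and \<open>c * z\<close> are the straight line from \<open>(h, z)\<close> to \<open>(2 * max h 0 - 1, max h 0 * z)\<close>, written in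
    terms of the coordinates \<open>s\<close> of the arm so that continuity is evident. For \<open>v = s (Suc j)\<close> with \<open>j \<noteq> i\<close>
    the value of \<open>hgt\<close> is at most \<open>0\<close>, and the cut-off in \<open>H\<close> makes the coordinate vanish.\<close>
  define c where "c t s = (1 - t) + t * (\<Sum>j<p. s (Suc j))" for t :: real and s :: "nat \<Rightarrow> real"
  define hgt where "hgt t s v = (1 - t) * (v - s 0) + t * (2 * v - 1)" for t v :: real and s :: "nat \<Rightarrow> real"
  define D where "D t q = \<bar>hgt t (snd q) (\<Sum>j<p. snd q (Suc j))\<bar> + c t (snd q) * (\<Sum>k<m. \<bar>fst q k\<bar>)"
    for t :: real and q :: "(nat \<Rightarrow> real) \<times> (nat \<Rightarrow> real)"
  define H where "H t q = (\<lambda>k. c t (snd q) * fst q k / D t q,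
      \<lambda>j. case j of 0 \<Rightarrow> max (- hgt t (snd q) (\<Sum>j<p. snd q (Suc j)) / D t q) 0
         | Suc j \<Rightarrow> max (hgt t (snd q) (snd q (Suc j)) / D t q) 0)"
    for t :: real and q :: "(nat \<Rightarrow> real) \<times> (nat \<Rightarrow> real)"
  have H_arm: "0 < D t (z, arm i h) \<and> H t (z, arm i h) =
      (\<lambda>k. c t (arm i h) * z k / D t (z, arm i h), arm i (((1 - t) * h + t * (2 * max h 0 - 1)) / D t (z, arm i h))) \<and>
      c t (arm i h) = (1 - t) + t * max h 0 \<and>
      D t (z, arm i h) = \<bar>(1 - t) * h + t * (2 * max h 0 - 1)\<bar> + ((1 - t) + t * max h 0) * (\<Sum>k<m. \<bar>z k\<bar>)"
    if i: "i < p" and z: "\<bar>h\<bar> + (\<Sum>k<m. \<bar>z k\<bar>) = 1" and t: "0 \<le> t" "t \<le> 1" for i h z t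
  proof -
    define d where "d = (1 - t) * h + t * (2 * max h 0 - 1)"
    have c: "c t (arm i h) = (1 - t) + t * max h 0"
      by (simp add: c_def sum_arm(1)[OF i])
    have hgt: "hgt t (arm i h) (max h 0) = d"
      by (simp add: hgt_def arm_def d_def max_def)
    have D: "D t (z, arm i h) = \<bar>d\<bar> + ((1 - t) + t * max h 0) * (\<Sum>k<m. \<bar>z k\<bar>)"
      by (simp add: D_def sum_arm(1)[OF i] hgt c)
    have c_nonneg: "0 \<le> (1 - t) + t * max h 0"
      using t by (intro add_nonneg_nonneg mult_nonneg_nonneg) auto
    have D_pos: "0 < D t (z, arm i h)"
    proof (rule ccontr)
      assume "\<not> 0 < D t (z, arm i h)"
      moreover have "0 \<le> ((1 - t) + t * max h 0) * (\<Sum>k<m. \<bar>z k\<bar>)"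
        using c_nonneg by (intro mult_nonneg_nonneg sum_nonneg) auto
      ultimately have d0: "d = 0" and "((1 - t) + t * max h 0) * (\<Sum>k<m. \<bar>z k\<bar>) = 0"
        unfolding D by linarith+
      then consider "(\<Sum>k<m. \<bar>z k\<bar>) = 0" | "(1 - t) + t * max h 0 = 0"
        by auto
      then show False
      proof cases
        case 1
        then have "h = 1 \<or> h = -1"
          using z by auto
        then show False
          using d0 by (auto simp: d_def)
      next
        case 2
        moreover have "0 \<le> t * max h 0"
          using t by auto
        ultimately have "t = 1"
          using t by linarith
        then have "max h 0 = 0"
          using 2 by simp
        then show False
          using d0 \<open>t = 1\<close> by (simp add: d_def)
      qed
    qed
    have other: "hgt t (arm i h) 0 \<le> 0"
    proof -
      have "0 \<le> (1 - t) * max (- h) 0"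
        using t by auto
      moreover have "hgt t (arm i h) 0 = - ((1 - t) * max (- h) 0) - t"
        by (simp add: hgt_def arm_def)
      ultimately show ?thesis
        using t by linarith
    qed
    have "snd (H t (z, arm i h)) j = arm i (d / D t (z, arm i h)) j" for j
    proof (cases j)
      case 0
      then show ?thesis
        by (simp add: H_def sum_arm(1)[OF i] hgt arm_def[of i "d / D t (z, arm i h)"])
    next
      case (Suc j')
      show ?thesis
      proof (cases "j' = i")
        case True
        then show ?thesis
          using hgt by (simp add: Suc H_def arm_def)
      next
        case False
        then have "arm i h (Suc j') = 0"
          by (simp add: arm_def)
        moreover have "hgt t (arm i h) 0 / D t (z, arm i h) \<le> 0"
          using other D_pos by (simp add: divide_nonpos_pos)
        ultimately show ?thesis
          using False by (simp add: Suc H_def arm_def[of i "d / D t (z, arm i h)"])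
      qed
    qed
    then show ?thesis
      using D_pos c D by (auto simp: H_def d_def fun_eq_iff)
  qed
  have M_E: "\<exists>i h z. i < p \<and> q = (z, arm i h) \<and> (\<forall>k\<ge>m. z k = 0) \<and> \<bar>h\<bar> + (\<Sum>k<m. \<bar>z k\<bar>) = 1" if "q \<in> ?M" for q
    using that by (auto simp: octahedra_wedge_def)
  have H_M: "H t q \<in> ?M" if q: "q \<in> ?M" and t: "0 \<le> t" "t \<le> 1" for t q
  proof -
    obtain i h z where *: "i < p" "q = (z, arm i h)" "\<forall>k\<ge>m. z k = 0" "\<bar>h\<bar> + (\<Sum>k<m. \<bar>z k\<bar>) = 1"
      using M_E[OF q] by blast
    define d where "d = (1 - t) * h + t * (2 * max h 0 - 1)"
    define a where "a = (1 - t) + t * max h 0"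
    define E where "E = D t (z, arm i h)"
    have HE: "0 < E" "H t q = (\<lambda>k. a * z k / E, arm i (d / E))" "E = \<bar>d\<bar> + a * (\<Sum>k<m. \<bar>z k\<bar>)"
      using H_arm[OF *(1,4) t] by (simp_all add: *(2) d_def a_def E_def)
    have "0 \<le> a"
      unfolding a_def using t by (intro add_nonneg_nonneg mult_nonneg_nonneg) auto
    then have "\<bar>d / E\<bar> + (\<Sum>k<m. \<bar>a * z k / E\<bar>) = (\<bar>d\<bar> + a * (\<Sum>k<m. \<bar>z k\<bar>)) / E"
      using HE(1) by (simp add: abs_mult sum_divide_distrib[symmetric] sum_distrib_left[symmetric] add_divide_distrib)
    also have "\<dots> = 1"
      using HE(1,3) by simp
    finally have sum1: "\<bar>d / E\<bar> + (\<Sum>k<m. \<bar>a * z k / E\<bar>) = 1" .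
    show ?thesis
      unfolding HE(2) octahedra_wedge_def mem_Collect_eq prod.case
      by (intro exI[of _ i] exI[of _ "d / E"] conjI refl) (use *(1,3) sum1 in simp_all)
  qed
  have H_0: "H 0 q = q" if "q \<in> ?M" for q
  proof -
    obtain i h z where *: "i < p" "q = (z, arm i h)" "\<forall>k\<ge>m. z k = 0" "\<bar>h\<bar> + (\<Sum>k<m. \<bar>z k\<bar>) = 1"
      using M_E[OF \<open>q \<in> ?M\<close>] by blast
    then show ?thesis
      using H_arm[OF *(1,4), of 0] by simp
  qed
  have H_1: "H 1 q = g (f q)" if "q \<in> ?M" for q
  proof -
    obtain i h z where *: "i < p" "q = (z, arm i h)" "\<forall>k\<ge>m. z k = 0" "\<bar>h\<bar> + (\<Sum>k<m. \<bar>z k\<bar>) = 1"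
      using M_E[OF \<open>q \<in> ?M\<close>] by blast
    define s where "s = max h 0"
    define r where "r = raw s z"
    have r: "\<exists>i\<le>m. r i \<noteq> 0"
      using raw_nonzero[OF *(4)] by (simp add: r_def s_def)
    then have np: "0 < nrm r"
      by (rule nrm_pos)
    have "r i = 0" if "m < i" for i
      using *(3) that by (simp add: r_def raw_def)
    then have Nr: "N r \<in> sphere_set m"
      using r by (rule N_sphere)
    have L_N: "L (N r) = L r / nrm r"
      using np by (simp add: L_def N_def sum_divide_distrib)
    have ratio: "N r k / L (N r) = r k / L r" for k
      unfolding L_N using np by (simp add: N_def)
    have gf: "g (f q) = (\<lambda>k. r (Suc k) / L r, arm i (- (r 0 / L r)))"
      unfolding *(2) f_arm s_def[symmetric] r_def[symmetric] g_axis[OF *(1) Nr] ratio ..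
    have "0 \<le> s"
      by (simp add: s_def)
    then have "L r = \<bar>2 * s - 1\<bar> + s * (\<Sum>k<m. \<bar>z k\<bar>)"
      by (simp add: L_split r_def raw_def abs_mult sum_distrib_left abs_minus_commute)
    then have "D 1 q = L r" "H 1 q = (\<lambda>k. s * z k / D 1 q, arm i ((2 * s - 1) / D 1 q))"
      using H_arm[OF *(1,4), of 1] by (simp_all add: *(2) s_def)
    then show ?thesis
      unfolding gf by (simp add: r_def raw_def minus_divide_left)
  qed
  have cont_H: "continuous_on ({0..1} \<times> ?M) (\<lambda>(t, q). H t q)"
  proof -
    let ?I = "{0..1} \<times> ?M"
    have b: "continuous_on ?I (\<lambda>x. fst (snd x) k)" "continuous_on ?I (\<lambda>x. snd (snd x) k)" for k
      by (rule continuous_on_apply[OF continuous_on_fst[OF continuous_on_snd[OF continuous_on_id]]])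
         (rule continuous_on_apply[OF continuous_on_snd[OF continuous_on_snd[OF continuous_on_id]]])
    have cc: "continuous_on ?I (\<lambda>x. c (fst x) (snd (snd x)))"
      unfolding c_def by (intro continuous_intros b)
    have ch: "continuous_on ?I (\<lambda>x. hgt (fst x) (snd (snd x)) (F x))" if "continuous_on ?I F" for F
      unfolding hgt_def by (intro continuous_intros b that)
    have cD: "continuous_on ?I (\<lambda>x. D (fst x) (snd x))"
      unfolding D_def by (intro continuous_intros ch cc b)
    have D0: "D (fst x) (snd x) \<noteq> 0" if "x \<in> ?I" for x
    proof -
      obtain i h z where *: "i < p" "snd x = (z, arm i h)" "\<bar>h\<bar> + (\<Sum>k<m. \<bar>z k\<bar>) = 1"
        using M_E[of "snd x"] \<open>x \<in> ?I\<close> by auto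
      then show ?thesis
        using H_arm[OF *(1,3), of "fst x"] \<open>x \<in> ?I\<close> by auto
    qed
    show ?thesis
      unfolding H_def case_prod_unfold
    proof (intro continuous_on_Pair continuous_on_coordinatewise_then_product)
      show "continuous_on ?I (\<lambda>x. c (fst x) (snd (snd x)) * fst (snd x) k / D (fst x) (snd x))" for k
        by (intro continuous_intros cc cD b) (use D0 in blast)
      show "continuous_on ?I (\<lambda>x. case j of
            0 \<Rightarrow> max (- hgt (fst x) (snd (snd x)) (\<Sum>j<p. snd (snd x) (Suc j)) / D (fst x) (snd x)) 0
          | Suc j \<Rightarrow> max (hgt (fst x) (snd (snd x)) (snd (snd x) (Suc j)) / D (fst x) (snd x)) 0)" for j
      proof (cases j)
        case 0
        show ?thesis
          unfolding 0 nat.case by (intro continuous_intros cD ch b) (use D0 in blast)+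
      next
        case (Suc j')
        show ?thesis
          unfolding Suc nat.case by (intro continuous_intros cD ch b) (use D0 in blast)+
      qed
    qed
  qed
  have hM: "homotopic_with (\<lambda>_. True) (top_of_set ?M) (top_of_set ?M) (g \<circ> f) id"
  proof -
    have "homotopic_with_canon (\<lambda>_. True) ?M ?M (H 0) (H 1)"
      unfolding homotopic_with_def using cont_H H_M
      by (intro exI[of _ "\<lambda>(t, q). H t q"]) auto
    then have "homotopic_with_canon (\<lambda>_. True) ?M ?M id (g \<circ> f)"
      by (rule homotopic_with_eq) (use H_0 H_1 in auto)
    then show ?thesis
      by (simp add: homotopic_with_sym)
  qed
  \<comment> \<open>\<open>mid t v\<close> runs along the straight line from \<open>v\<close> to a positive multiple of the composite map.\<close>
  define s where "s v = max (- (v 0 / L v)) 0" for v :: "nat \<Rightarrow> real"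
  define mid where "mid t v = (\<lambda>i. if i = 0 then (1 - t) * v 0 + t * (1 - 2 * s v)
      else ((1 - t) + t * (s v / L v)) * v i)" for t :: real and v :: "nat \<Rightarrow> real"
  have mid_nonzero: "\<exists>i\<le>m. mid t v i \<noteq> 0" if v: "v \<in> sphere_set m" and t: "0 \<le> t" "t \<le> 1" for t v
  proof (rule ccontr)
    assume "\<not> (\<exists>i\<le>m. mid t v i \<noteq> 0)"
    then have z: "mid t v i = 0" if "i \<le> m" for i
      using that by blast
    have z0: "(1 - t) * v 0 + t * (1 - 2 * s v) = 0"
      using z[of 0] by (simp add: mid_def)
    have s_nonneg: "0 \<le> s v / L v"
      using L_pos[OF v] by (simp add: s_def)
    show False
    proof (cases "(1 - t) + t * (s v / L v) = 0")
      case True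
      moreover have "0 \<le> t * (s v / L v)"
        using s_nonneg t(1) by (rule mult_nonneg_nonneg[rotated])
      ultimately have "t = 1" "t * (s v / L v) = 0"
        using t by linarith+
      then have "t = 1" "s v = 0"
        using L_pos[OF v] by auto
      then show False
        using z0 by simp
    next
      case False
      then have rest: "v (Suc k) = 0" if "k < m" for k
        using z[of "Suc k"] that by (simp add: mid_def)
      then have "L v = \<bar>v 0\<bar>" "(v 0)\<^sup>2 = 1"
        using v unfolding L_split sphere_set_def sum.lessThan_Suc_shift by simp_all
      then have "v 0 = 1 \<and> L v = 1 \<or> v 0 = -1 \<and> L v = 1"
        by (auto simp: power2_eq_1_iff)
      then show False
        using z0 by (auto simp: s_def)
    qed
  qed
  define J where "J t y = (\<lambda>j. N (mid t (y j)))" for t :: real and y :: "nat \<Rightarrow> nat \<Rightarrow> real"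
  have mid_e: "mid t ?e = ?e" for t
  proof
    have "s ?e = 0"
      by (simp add: s_def e L_e)
    then show "mid t ?e i = ?e i" for i
      by (cases i) (simp_all add: mid_def e)
  qed
  have N_mid: "N (mid t v) \<in> sphere_set m" if v: "v \<in> sphere_set m" and t: "0 \<le> t" "t \<le> 1" for t v
  proof -
    have "mid t v i = 0" if "m < i" for i
      using v that by (simp add: mid_def sphere_set_def)
    then show ?thesis
      using mid_nonzero[OF v t] by (intro N_sphere)
  qed
  have J_axis: "J t (\<lambda>j. if j = i then u else ?e) = (\<lambda>j. if j = i then N (mid t u) else ?e)" for t i u
    by (auto simp: J_def mid_e N_e)
  have J_W: "J t y \<in> ?W" if "y \<in> ?W" "0 \<le> t" "t \<le> 1" for t y
  proof -
    obtain i u where *: "i < p" "u \<in> sphere_set m" "y = (\<lambda>j. if j = i then u else ?e)"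
      using \<open>y \<in> ?W\<close> by (auto simp: wedge_axes_def)
    have "N (mid t u) \<in> sphere_set m"
      by (rule N_mid[OF *(2) \<open>0 \<le> t\<close> \<open>t \<le> 1\<close>])
    then show ?thesis
      unfolding *(3) J_axis wedge_axes_def using *(1) by blast
  qed
  have J_0: "J 0 y = y" if "y \<in> ?W" for y
  proof -
    have "N (mid 0 u) = u" if "u \<in> sphere_set m" for u
    proof -
      have "mid 0 u = u"
        by (auto simp: mid_def)
      moreover have "nrm u = 1"
        using that by (simp add: nrm_def sphere_set_def)
      ultimately show ?thesis
        by (simp add: N_def)
    qed
    then show ?thesis
      using that by (auto simp: wedge_axes_def J_axis)
  qed
  have J_1: "J 1 y = f (g y)" if "y \<in> ?W" for y
  proof -
    obtain i u where *: "i < p" "u \<in> sphere_set m" "y = (\<lambda>j. if j = i then u else ?e)"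
      using \<open>y \<in> ?W\<close> by (auto simp: wedge_axes_def)
    have mid1: "mid 1 u = raw (max (- (u 0 / L u)) 0) (\<lambda>k. u (Suc k) / L u)"
      by (auto simp: mid_def raw_def s_def fun_eq_iff)
    show ?thesis
      unfolding *(3) J_axis g_axis[OF *(1,2)] f_arm mid1 ..
  qed
  have cont_J: "continuous_on ({0..1} \<times> ?W) (\<lambda>(t, y). J t y)"
    unfolding case_prod_unfold
  proof (intro continuous_on_coordinatewise_then_product)
    fix j i
    let ?I = "{0..1} \<times> ?W"
    have b: "continuous_on ?I (\<lambda>x. snd x j k)" for k
      by (rule continuous_on_apply[OF continuous_on_apply[OF continuous_on_snd[OF continuous_on_id]]])
    have W_L: "L (snd x j) \<noteq> 0" if "x \<in> ?I" for x
      using L_coord[of "snd x" j] that by auto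
    have cL: "continuous_on ?I (\<lambda>x. L (snd x j))"
      by (intro cont_L b)
    have cs: "continuous_on ?I (\<lambda>x. s (snd x j))"
      unfolding s_def by (intro continuous_intros b cL) (use W_L in blast)
    have cm: "continuous_on ?I (\<lambda>x. mid (fst x) (snd x j) i)" for i
    proof (cases "i = 0")
      case True
      show ?thesis
        unfolding mid_def if_P[OF True] by (intro continuous_intros b cs)
    next
      case False
      show ?thesis
        unfolding mid_def if_not_P[OF False] by (intro continuous_intros b cs cL) (use W_L in blast)
    qed
    have "nrm (mid (fst x) (snd x j)) \<noteq> 0" if "x \<in> ?I" for x
    proof -
      have "snd x j \<in> sphere_set m"
        using that sphere_basepoint_in_sphere_set by (auto simp: wedge_axes_def)
      then have "\<exists>i\<le>m. mid (fst x) (snd x j) i \<noteq> 0"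
        using that by (intro mid_nonzero) auto
      then show ?thesis
        using nrm_pos by fastforce
    qed
    then show "continuous_on ?I (\<lambda>x. J (fst x) (snd x) j i)"
      unfolding J_def N_def nrm_def by (intro continuous_intros cm) blast
  qed
  have hW: "homotopic_with (\<lambda>_. True) (top_of_set ?W) (top_of_set ?W) (f \<circ> g) id"
  proof -
    have "homotopic_with_canon (\<lambda>_. True) ?W ?W (J 0) (J 1)"
      unfolding homotopic_with_def using cont_J J_W
      by (intro exI[of _ "\<lambda>(t, y). J t y"]) auto
    then have "homotopic_with_canon (\<lambda>_. True) ?W ?W id (f \<circ> g)"
      by (rule homotopic_with_eq) (use J_0 J_1 in auto)
    then show ?thesis
      by (simp add: homotopic_with_sym)
  qed
  show ?thesis
    unfolding homotopy_equivalent_space_def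
    using cont_f cont_g f_M g_W hM hW by (intro exI[of _ f] exI[of _ g]) auto
qed

theorem cross_polytope_join_discrete_wedge_of_spheres:
  assumes "0 < p"
  shows "geometric_realization (join (cross_polytope m) (discrete_complex {..<Suc p}))
    homotopy_equivalent_space wedge_of_spheres p m"
proof -
  have "wedge_of_spheres p m homeomorphic_space
      top_of_set (wedge_axes (sphere_set m) sphere_basepoint p)"
    unfolding wedge_of_spheres_def nsphere_eq_sphere_set
    by (rule wedge_sum_homeomorphic_axes[OF sphere_basepoint_in_sphere_set])
  then show ?thesis
    using realization_homeomorphic_octahedra[OF assms] octahedra_homotopy_equivalent_axes[OF assms]
    by (meson homeomorphic_imp_homotopy_equivalent_space homeomorphic_space_sym homotopy_eqv_trans)
qed

theorem cross_polytope_sphere: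
  "geometric_realization (cross_polytope (Suc m)) homotopy_equivalent_space nsphere m"
proof -
  have "geometric_realization (cross_polytope (Suc m)) homotopy_equivalent_space
      geometric_realization (join (cross_polytope m) (discrete_complex {..<2::nat}))"
    using join_equivalent_imp_homotopy_equivalent[OF cross_polytope_Suc]
    by (simp add: homotopy_equivalent_complexes_def)
  also have "\<dots> homotopy_equivalent_space top_of_set (octahedra_wedge m 1)"
    using realization_homeomorphic_octahedra[of 1 m]
    by (intro homeomorphic_imp_homotopy_equivalent_space) (simp add: numeral_2_eq_2)
  also have "\<dots> homotopy_equivalent_space top_of_set (wedge_axes (sphere_set m) sphere_basepoint 1)"
    by (rule octahedra_homotopy_equivalent_axes) simp
  also have "\<dots> homotopy_equivalent_space nsphere m"
    unfolding nsphere_eq_sphere_set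
    by (rule homeomorphic_imp_homotopy_equivalent_space[OF wedge_axes_one_homeomorphic])
  finally show ?thesis .
qed

section \<open>Independent sets in cycles\<close>

lemma mod_Suc_cancel:
  fixes z w n :: nat
  assumes "Suc z mod n = Suc w mod n"
  shows "z mod n = w mod n"
proof (cases "n = 0")
  case False
  have "(Suc z + (n - 1)) mod n = (Suc w + (n - 1)) mod n"
    using assms by (rule mod_add_cong) simp
  then show ?thesis
    using False by simp
qed (use assms in simp)

lemma mod_add_cancel:
  fixes a i j n :: nat
  assumes "(a + i) mod n = (a + j) mod n"
  shows "i mod n = j mod n"
  using assms by (induction a) (auto dest: mod_Suc_cancel)

lemma cycle_graph_adjacent_iff:
  assumes "n \<ge> 3" "x < n" "y < n"
  shows "Suc x \<rightarrow>\<^bsub>cycle_graph n \<restriction> I\<^esub> Suc y \<longleftrightarrow>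
    Suc x \<in> I \<and> Suc y \<in> I \<and> (y = Suc x mod n \<or> x = Suc y mod n)"
proof -
  define E where "E = {(i, i + 1) | i. 1 \<le> i \<and> i < n} \<union> {(1, n)}"
  have E: "(Suc a, Suc b) \<in> E \<longleftrightarrow> b = Suc a \<or> a = 0 \<and> b = n - 1" if "a < n" "b < n" for a b
    using that assms(1) by (auto simp: E_def)
  have "Suc x \<rightarrow>\<^bsub>cycle_graph n \<restriction> I\<^esub> Suc y \<longleftrightarrow> Suc x \<in> I \<and> Suc y \<in> I \<and> ((Suc x, Suc y) \<in> E \<or> (Suc y, Suc x) \<in> E)"
    unfolding cycle_graph_def Let_def E_def[symmetric]
    by (auto simp: arcs_ends_def arc_to_ends_def induce_subgraph_def image_iff)
  moreover have "(Suc x, Suc y) \<in> E \<or> (Suc y, Suc x) \<in> E \<longleftrightarrow> y = Suc x mod n \<or> x = Suc y mod n"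
    unfolding E[OF assms(2,3)] E[OF assms(3,2)] using assms by (auto simp: mod_Suc)
  ultimately show ?thesis
    by blast
qed

text \<open>
  A window of \<open>r + 1\<close> vertices inside \<open>I\<close> is connected and lies in one component. Conversely, let
  \<open>x \<in> I\<close> and let \<open>a\<close> be the last position before \<open>x\<close> that is not in \<open>I\<close>, which exists if there are no such
  windows. The run of \<open>I\<close> that follows \<open>a\<close> has at most \<open>r\<close> vertices, contains \<open>x\<close> and is closed under
  adjacency within \<open>I\<close>, so it contains the component of \<open>x\<close>.
\<close>

lemma r_independent_cycle_iff:
  assumes n: "n \<ge> 3" and r: "r < n"
  shows "r_independent r (cycle_graph n) I \<longleftrightarrow> (\<exists>\<sigma>\<in>cyclic_complex (Suc r) n. I = Suc ` \<sigma>)"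
proof -
  define H where "H = cycle_graph n \<restriction> I"
  interpret G: graph "cycle_graph n"
    using n by (rule graph_cycle_graph)
  interpret H: wf_digraph H
    unfolding H_def by (rule G.wellformed_induce_subgraph)
  have verts_G: "verts (cycle_graph n) = {1..n}"
    by (simp add: cycle_graph_def Let_def)
  have verts_H: "verts H = I"
    by (simp add: H_def)
  have step: "Suc x \<rightarrow>\<^bsub>H\<^esub> Suc y \<longleftrightarrow>
      Suc x \<in> I \<and> Suc y \<in> I \<and> (y = Suc x mod n \<or> x = Suc y mod n)" if "x < n" "y < n" for x y
    unfolding H_def using cycle_graph_adjacent_iff[OF n that] .
  have components: "r_independent r (cycle_graph n) I \<longleftrightarrow>
      I \<subseteq> {1..n} \<and> (\<forall>u\<in>I. finite (H.scc_of u) \<and> card (H.scc_of u) \<le> r)"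
  proof -
    have "(\<forall>C\<in>H.sccs. finite (verts C) \<and> card (verts C) \<le> r) \<longleftrightarrow> (\<forall>S\<in>H.sccs_verts. finite S \<and> card S \<le> r)"
      unfolding H.sccs_verts_conv by blast
    also have "\<dots> \<longleftrightarrow> (\<forall>u\<in>I. finite (H.scc_of u) \<and> card (H.scc_of u) \<le> r)"
      unfolding H.sccs_verts_conv_scc_of verts_H by blast
    finally show ?thesis
      unfolding r_independent_def verts_G H_def[symmetric] by blast
  qed
  define \<sigma> where "\<sigma> = {x. Suc x \<in> I}"
  have I_\<sigma>: "I = Suc ` \<sigma>" "\<sigma> \<subseteq> {..<n}" if "I \<subseteq> {1..n}"
  proof -
    have "v \<in> Suc ` \<sigma>" if "v \<in> I" for v
    proof -
      have "v = Suc (v - 1)"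
        using that \<open>I \<subseteq> {1..n}\<close> by auto
      then show ?thesis
        using that unfolding \<sigma>_def by (metis image_eqI mem_Collect_eq)
    qed
    then show "I = Suc ` \<sigma>"
      by (auto simp: \<sigma>_def)
    show "\<sigma> \<subseteq> {..<n}"
      using that by (auto simp: \<sigma>_def)
  qed
  show ?thesis
  proof
    assume ind: "r_independent r (cycle_graph n) I"
    then have I: "I \<subseteq> {1..n}" and small: "\<And>u. u \<in> I \<Longrightarrow> finite (H.scc_of u) \<and> card (H.scc_of u) \<le> r"
      using components by blast+
    have "\<exists>i<Suc r. (a + i) mod n \<notin> \<sigma>" for a
    proof (rule ccontr)
      assume "\<not> (\<exists>i<Suc r. (a + i) mod n \<notin> \<sigma>)"
      then have in_I: "Suc ((a + i) mod n) \<in> I" if "i \<le> r" for i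
        using that by (auto simp: \<sigma>_def)
      define f where "f i = Suc ((a + i) mod n)" for i
      have edge: "f i \<rightarrow>\<^bsub>H\<^esub> f (Suc i)" "f (Suc i) \<rightarrow>\<^bsub>H\<^esub> f i" if "Suc i \<le> r" for i
        unfolding f_def using in_I[of i] in_I[of "Suc i"] that n
        by (subst step; simp add: mod_Suc_eq)+
      have reach: "f 0 \<rightarrow>\<^sup>*\<^bsub>H\<^esub> f i \<and> f i \<rightarrow>\<^sup>*\<^bsub>H\<^esub> f 0" if "i \<le> r" for i
        using that
      proof (induction i)
        case 0
        have "f 0 \<in> verts H"
          using in_I[of 0] by (simp add: verts_H f_def)
        then show ?case
          by simp
      next
        case (Suc i)
        then show ?case
          using edge[of i] by (meson H.adj_reachable_trans H.reachable_adj_trans Suc_leD)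
      qed
      have "f ` {..r} \<subseteq> H.scc_of (f 0)"
        using reach by (auto simp: H.scc_of_def)
      moreover have "inj_on f {..r}"
      proof (rule inj_onI)
        fix i j assume ij: "i \<in> {..r}" "j \<in> {..r}" "f i = f j"
        have "(a + i) mod n = (a + j) mod n"
          using ij(3) by (simp add: f_def)
        then have "i mod n = j mod n"
          by (rule mod_add_cancel)
        then show "i = j"
          using ij(1,2) r by simp
      qed
      then have "card (f ` {..r}) = Suc r"
        by (simp add: card_image)
      ultimately show False
        using small[of "f 0"] in_I[of 0] card_mono[of "H.scc_of (f 0)" "f ` {..r}"] by (simp add: f_def)
    qed
    then have "\<sigma> \<in> cyclic_complex (Suc r) n"
      using I_\<sigma>(2)[OF I] by (simp add: cyclic_complex_def)
    then show "\<exists>\<sigma>\<in>cyclic_complex (Suc r) n. I = Suc ` \<sigma>"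
      using I_\<sigma>(1)[OF I] by blast
  next
    assume "\<exists>\<sigma>\<in>cyclic_complex (Suc r) n. I = Suc ` \<sigma>"
    then obtain \<sigma>' where \<sigma>': "\<sigma>' \<in> cyclic_complex (Suc r) n" "I = Suc ` \<sigma>'"
      by blast
    then have "\<sigma>' = \<sigma>"
      by (auto simp: \<sigma>_def)
    then have \<sigma>: "\<sigma> \<subseteq> {..<n}" "\<And>a. \<exists>i<Suc r. (a + i) mod n \<notin> \<sigma>" "I = Suc ` \<sigma>"
      using \<sigma>' by (auto simp: cyclic_complex_def)
    have "finite (H.scc_of u) \<and> card (H.scc_of u) \<le> r" if u: "u \<in> I" for u
    proof -
      obtain x where x: "u = Suc x" "x \<in> \<sigma>" "x < n"
        using u \<sigma> by blast
      \<comment> \<open>\<open>x + n - j\<close> stands for \<open>x - j\<close>; the summand \<open>n\<close> keeps the subtraction from being cut off.\<close>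
      define before where "before j \<longleftrightarrow> j \<le> n \<and> (x + n - j) mod n \<notin> \<sigma>" for j
      define j where "j = (LEAST j. before j)"
      have "\<exists>j. before j"
      proof -
        obtain i where i: "i < Suc r" "(x + i) mod n \<notin> \<sigma>"
          using \<sigma>(2) by blast
        then have "before (n - i)"
          using r by (simp add: before_def)
        then show ?thesis ..
      qed
      then have j: "before j" and j_least: "\<And>i. i < j \<Longrightarrow> \<not> before i"
        unfolding j_def by (auto intro: LeastI_ex dest: not_less_Least)
      have "\<not> before 0"
        using x by (simp add: before_def)
      then have "j \<noteq> 0"
        using j by metis
      define a where "a = x + n - j"
      have a: "a mod n \<notin> \<sigma>"
        using j by (simp add: before_def a_def)
      define s where "s = (LEAST s. (Suc a + s) mod n \<notin> \<sigma>)"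
      obtain s0 where s0: "s0 < Suc r" "(Suc a + s0) mod n \<notin> \<sigma>"
        using \<sigma>(2) by blast
      have s: "(Suc a + s) mod n \<notin> \<sigma>" "s \<le> s0"
        unfolding s_def using s0(2) by (rule LeastI, rule Least_le)
      have run: "(Suc a + i) mod n \<in> \<sigma>" if "i < j" for i
      proof -
        have "j \<le> n" "Suc a + i = x + n - (j - Suc i)" "j - Suc i < j"
          using that j by (auto simp: a_def before_def)
        then show ?thesis
          using j_least[of "j - Suc i"] by (simp add: before_def)
      qed
      have "j \<le> s"
        using run[of s] s(1) by (meson not_le)
      define R where "R = (\<lambda>i. Suc ((Suc a + i) mod n)) ` {..<s}"
      have card_R: "finite R" "card R \<le> r"
        using card_image_le[of "{..<s}" "\<lambda>i. Suc ((Suc a + i) mod n)"] s(2) s0(1) by (auto simp: R_def)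
      have "u \<in> R"
      proof -
        have "Suc a + (j - 1) = x + n"
          using \<open>j \<noteq> 0\<close> j by (simp add: a_def before_def)
        then have "u = Suc ((Suc a + (j - 1)) mod n)"
          using x by simp
        then show ?thesis
          using \<open>j \<le> s\<close> \<open>j \<noteq> 0\<close> unfolding R_def by (intro image_eqI[of _ _ "j - 1"]) auto
      qed
      have closed: "v' \<in> R" if v: "v \<in> R" and e: "v \<rightarrow>\<^bsub>H\<^esub> v'" for v v'
      proof -
        obtain i where i: "i < s" "v = Suc ((Suc a + i) mod n)"
          using v by (auto simp: R_def)
        have "v' \<in> I"
          using H.adj_in_verts(2)[OF e] by (simp add: verts_H)
        then obtain z where z: "v' = Suc z" "z < n" "z \<in> \<sigma>"
          using \<sigma> by blast
        have "(Suc a + i) mod n < n"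
          using n by simp
        then consider "z = Suc ((Suc a + i) mod n) mod n" | "(Suc a + i) mod n = Suc z mod n"
          using e step[OF _ z(2), of "(Suc a + i) mod n"] unfolding i(2) z(1) by blast
        then show ?thesis
        proof cases
          case 1
          then have "z = (Suc a + Suc i) mod n"
            by (simp add: mod_Suc_eq)
          moreover from this have "Suc i \<noteq> s"
            using s(1) z(3) by auto
          ultimately show ?thesis
            using i(1) z(1) unfolding R_def by (intro image_eqI[of _ _ "Suc i"]) auto
        next
          case 2
          then have "z = (a + i) mod n"
            using mod_Suc_cancel[of z n "a + i"] z(2) by simp
          then have "i \<noteq> 0"
            using a z(3) by (metis add.right_neutral)
          then have "z = (Suc a + (i - 1)) mod n"
            using \<open>z = (a + i) mod n\<close> by simp
          then show ?thesis
            using i(1) z(1) unfolding R_def by (intro image_eqI[of _ _ "i - 1"]) auto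
        qed
      qed
      have "v \<in> R" if "u \<rightarrow>\<^sup>*\<^bsub>H\<^esub> v" for v
        using that
      proof (induction rule: H.reachable_induct)
        case base
        show ?case
          by (rule \<open>u \<in> R\<close>)
      next
        case (step v w)
        then show ?case
          using closed by blast
      qed
      then have "H.scc_of u \<subseteq> R"
        by (auto simp: H.scc_of_def)
      then show ?thesis
        using card_R by (meson card_mono finite_subset le_trans)
    qed
    moreover have "I \<subseteq> {1..n}"
      using \<sigma> by auto
    ultimately show "r_independent r (cycle_graph n) I"
      unfolding components by blast
  qed
qed

lemma independence_complex_cycle_isomorphic:
  assumes "n \<ge> 3" "r < n"
  shows "cyclic_complex (Suc r) n \<cong>\<^sub>c independence_complex r (cycle_graph n)"
proof (rule isomorphic_complexesI[of Suc])
  show "independence_complex r (cycle_graph n) = (`) Suc ` cyclic_complex (Suc r) n"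
    unfolding independence_complex_def r_independent_cycle_iff[OF assms] by blast
qed simp

lemma cyclic_complex_short_cycle:
  assumes "0 < n" "n \<le> w"
  shows "cyclic_complex w n = simplex_boundary {..<n}"
proof -
  have "\<sigma> \<in> cyclic_complex w n \<longleftrightarrow> \<sigma> \<subset> {..<n}" for \<sigma>
  proof (cases "\<sigma> \<subseteq> {..<n}")
    case True
    then have "\<sigma> \<inter> {..<n} = \<sigma>"
      by blast
    then show ?thesis
      using True full_not_in_cyclic_complex[of n \<sigma> w] not_in_cyclic_complex_small[of n w \<sigma>] assms by auto
  qed (auto simp: cyclic_complex_def)
  then show ?thesis
    by (auto simp: simplex_boundary_def)
qed

text \<open>
  Every window misses exactly one position.
\<close>

lemma cyclic_complex_Suc:
  "cyclic_complex w (Suc w) = missing_two {..<Suc w}"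
proof -
  have "\<sigma> \<in> cyclic_complex w (Suc w) \<longleftrightarrow> \<sigma> \<in> missing_two {..<Suc w}" for \<sigma>
  proof
    assume "\<sigma> \<in> missing_two {..<Suc w}"
    then have \<sigma>: "\<sigma> \<subseteq> {..<Suc w}" "\<And>x. x < Suc w \<Longrightarrow> \<not> {..<Suc w} - {x} \<subseteq> \<sigma>"
      by (auto simp: missing_two_def)
    have "\<exists>i<w. (a + i) mod Suc w \<notin> \<sigma>" for a
    proof -
      define x where "x = (a + w) mod Suc w"
      have "x < Suc w"
        by (simp add: x_def)
      then obtain y where y: "y < Suc w" "y \<noteq> x" "y \<notin> \<sigma>"
        using \<sigma>(2)[of x] by blast
      define i where "i = (y + (Suc w - a mod Suc w)) mod Suc w"
      have "(a + i) mod Suc w = (a mod Suc w + (y + (Suc w - a mod Suc w))) mod Suc w"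
        by (simp add: i_def mod_simps)
      also have "a mod Suc w \<le> Suc w"
        by (simp add: less_imp_le)
      then have "a mod Suc w + (y + (Suc w - a mod Suc w)) = y + Suc w"
        by linarith
      also have "(y + Suc w) mod Suc w = y"
        using y(1) by (simp only: mod_add_self2 mod_less)
      finally have "(a + i) mod Suc w = y" .
      moreover have "i \<noteq> w"
        using calculation y(2) by (auto simp: x_def)
      then have "i < w"
        using mod_less_divisor[of "Suc w" "y + (Suc w - a mod Suc w)"] unfolding i_def by linarith
      ultimately show ?thesis
        using y(3) by blast
    qed
    then show "\<sigma> \<in> cyclic_complex w (Suc w)"
      using \<sigma>(1) by (simp add: cyclic_complex_def)
  next
    assume \<sigma>: "\<sigma> \<in> cyclic_complex w (Suc w)"
    have "\<not> {..<Suc w} - {x} \<subseteq> \<sigma>" if "x < Suc w" for x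
    proof
      assume *: "{..<Suc w} - {x} \<subseteq> \<sigma>"
      obtain i where i: "i < w" "(Suc x + i) mod Suc w \<notin> \<sigma>"
        using \<sigma> unfolding cyclic_complex_def by blast
      have "(Suc x + i) mod Suc w \<noteq> x"
      proof (cases "Suc x + i < Suc w")
        case False
        then have "(Suc x + i) mod Suc w = Suc x + i - Suc w"
          using i(1) that by (simp add: mod_if)
        then show ?thesis
          using i(1) False by simp
      qed simp
      then have "(Suc x + i) mod Suc w \<in> {..<Suc w} - {x}"
        by simp
      then show False
        using * i(2) by blast
    qed
    then show "\<sigma> \<in> missing_two {..<Suc w}"
      using \<sigma> by (auto simp: missing_two_def cyclic_complex_def)
  qed
  then show ?thesis
    by blast
qed

text \<open>
  Each block contributes the boundary of a simplex on \<open>w\<close> vertices, that is, a cross-polytope with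
  \<open>w - 1\<close> pairs of vertices.
\<close>

lemma cyclic_complex_add_blocks:
  assumes n: "0 < n" and w: "2 \<le> w"
  shows "cyclic_complex w (n + j * Suc w) \<approx>\<^sub>c join (cyclic_complex w n) (cross_polytope (j * (w - 1)))"
proof (induction j)
  case 0
  have "cyclic_complex w n \<approx>\<^sub>c join (cyclic_complex w n) ({{}} :: nat set set)"
    using w by (intro isomorphic_imp_join_equivalent join_empty_face simplicial_complex_cyclic_complex) simp
  then show ?case
    by (simp add: cross_polytope_0)
next
  case (Suc j)
  let ?C = "cyclic_complex w n" and ?q = "j * (w - 1)"
  have C: "simplicial_complex (cyclic_complex w n')" for n'
    using w by (intro simplicial_complex_cyclic_complex) simp
  note c = C simplicial_complex_cross_polytope simplicial_complex_join
  have "cyclic_complex w ((n + j * Suc w) + w + 1) \<approx>\<^sub>c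
      join (cyclic_complex w (n + j * Suc w)) (simplex_boundary {..<w})"
    using n w by (intro cyclic_complex_add_block) auto
  also have "\<dots> \<approx>\<^sub>c join (cyclic_complex w (n + j * Suc w)) (cross_polytope (w - 1))"
    using simplex_boundary_cross_polytope[of "w - 1"] w by (intro join_equivalent_join_right c) simp
  also have "\<dots> \<approx>\<^sub>c join (join ?C (cross_polytope ?q)) (cross_polytope (w - 1))"
    by (intro join_equivalent_join Suc.IH c)
  also have "\<dots> \<approx>\<^sub>c join ?C (join (cross_polytope ?q) (cross_polytope (w - 1)))"
    by (rule isomorphic_imp_join_equivalent[OF join_assoc]) (intro c)
  also have "\<dots> \<approx>\<^sub>c join ?C (cross_polytope (?q + (w - 1)))"
    by (intro join_equivalent_join_right join_cross_polytopes c)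
  also have "?q + (w - 1) = Suc j * (w - 1)"
    by simp
  finally show ?case
    by (simp add: add_ac)
qed

section \<open>The homotopy type\<close>

theorem theorem4p6:
  fixes n d k t :: nat
  assumes "d \<ge> 3" and "n \<ge> d"
    and "n = d * k + t" and "k \<ge> 1" and "t \<in> {0..d - 1}"
  shows "(t = 0 \<longrightarrow>
            geometric_realization (independence_complex (d - 2) (cycle_graph n))
              homotopy_equivalent_space wedge_of_spheres (d - 1) (d * k - 2 * k - 1)) \<and>
         (t \<in> {1..d - 1} \<longrightarrow>
            geometric_realization (independence_complex (d - 2) (cycle_graph n))
              homotopy_equivalent_space nsphere (d * k - 2 * k + t - 2))"
proof -
  define w where "w = d - 1"
  have w: "2 \<le> w" "Suc w = d" "Suc (d - 2) = w" "w - 1 = d - 2"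
    using assms(1) by (auto simp: w_def)
  have C: "simplicial_complex (cyclic_complex w n')" for n'
    using w(1) by (intro simplicial_complex_cyclic_complex) simp
  note c = C simplicial_complex_cross_polytope simplicial_complex_join
  have "cyclic_complex w n \<cong>\<^sub>c independence_complex (d - 2) (cycle_graph n)"
    using independence_complex_cycle_isomorphic[of n "d - 2"] assms(1,2) w(3) by simp
  then have "cyclic_complex w n \<simeq>\<^sub>c independence_complex (d - 2) (cycle_graph n)"
    using C by (rule isomorphic_complexes_imp_homotopy_equivalent)
  then have Ind: "independence_complex (d - 2) (cycle_graph n) \<simeq>\<^sub>c K" if "cyclic_complex w n \<approx>\<^sub>c K" for K :: "'k set set"
    using join_equivalent_imp_homotopy_equivalent[OF that]
    by (meson homotopy_equivalent_complexes_sym homotopy_equivalent_complexes_trans)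
  have "geometric_realization (independence_complex (d - 2) (cycle_graph n))
      homotopy_equivalent_space wedge_of_spheres (d - 1) (d * k - 2 * k - 1)" if "t = 0"
  proof -
    define q where "q = (k - 1) * (d - 2)"
    let ?D = "discrete_complex {..<d}"
    have D: "simplicial_complex ?D"
      by (rule simplicial_complex_discrete_complex) simp
    have n: "n = d + (k - 1) * d"
      using assms(3,4) that by (cases k) (auto simp: algebra_simps)
    have "cyclic_complex w n \<approx>\<^sub>c join (cyclic_complex w d) (cross_polytope q)"
      using cyclic_complex_add_blocks[of d w "k - 1"] w assms(1) by (simp add: n q_def)
    also have "\<dots> \<approx>\<^sub>c join (join (cross_polytope (d - 3)) ?D) (cross_polytope q)"
    proof (rule join_equivalent_join)
      have "{..<Suc w} = insert (d - 2) (insert (d - 1) {..<d - 2})"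
        using assms(1) by (auto simp: w(2))
      then have "cyclic_complex w d = missing_two (insert (d - 2) (insert (d - 1) {..<d - 2}))"
        using cyclic_complex_Suc[of w] by (simp add: w(2))
      also have "\<dots> \<approx>\<^sub>c join (simplex_boundary {..<card {..<d - 2}}) (discrete_complex {..<card {..<d - 2} + 2})"
      proof (rule missing_two_equivalent)
        have "0 \<in> {..<d - 2}"
          using assms(1) by simp
        then show "{..<d - 2} \<noteq> {}"
          by blast
      qed (use assms(1) in auto)
      also have "\<dots> = join (simplex_boundary {..<Suc (d - 3)}) ?D"
      proof -
        have "card {..<d - 2} = Suc (d - 3)" "card {..<d - 2} + 2 = d"
          using assms(1) by auto
        then show ?thesis
          by (simp only:)
      qed
      also have "\<dots> \<approx>\<^sub>c join (cross_polytope (d - 3)) ?D"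
        by (intro join_equivalent_join simplex_boundary_cross_polytope D)
      finally show "cyclic_complex w d \<approx>\<^sub>c join (cross_polytope (d - 3)) ?D" .
    qed (rule simplicial_complex_cross_polytope)
    also have "\<dots> \<approx>\<^sub>c join (cross_polytope (d - 3)) (join ?D (cross_polytope q))"
      by (rule isomorphic_imp_join_equivalent[OF join_assoc]) (intro c D)
    also have "\<dots> \<approx>\<^sub>c join (cross_polytope (d - 3)) (join (cross_polytope q) ?D)"
      by (intro join_equivalent_join_right isomorphic_imp_join_equivalent[OF join_commute] c D)
    also have "\<dots> \<approx>\<^sub>c join (join (cross_polytope (d - 3)) (cross_polytope q)) ?D"
      by (rule join_equivalent_sym[OF isomorphic_imp_join_equivalent[OF join_assoc]]) (intro c D)
    also have "\<dots> \<approx>\<^sub>c join (cross_polytope (d - 3 + q)) ?D"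
      by (intro join_equivalent_join join_cross_polytopes D)
    finally have "independence_complex (d - 2) (cycle_graph n) \<simeq>\<^sub>c join (cross_polytope (d - 3 + q)) ?D"
      by (rule Ind)
    moreover have "geometric_realization (join (cross_polytope (d - 3 + q)) ?D)
        homotopy_equivalent_space wedge_of_spheres (d - 1) (d - 3 + q)"
      using cross_polytope_join_discrete_wedge_of_spheres[of "d - 1" "d - 3 + q"] assms(1) by simp
    moreover have "d - 3 + q = d * k - 2 * k - 1"
    proof -
      obtain e l where "d = e + 3" "k = l + 1"
        using assms(1,4) by (metis le_add_diff_inverse2)
      then show ?thesis
        by (simp add: q_def algebra_simps)
    qed
    ultimately show ?thesis
      unfolding homotopy_equivalent_complexes_def by (metis homotopy_eqv_trans)
  qed
  moreover have "geometric_realization (independence_complex (d - 2) (cycle_graph n))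
      homotopy_equivalent_space nsphere (d * k - 2 * k + t - 2)" if t: "t \<in> {1..d - 1}"
  proof -
    have n: "t + k * Suc w = n"
      using assms(3) w(2) by simp
    have "cyclic_complex w n \<approx>\<^sub>c join (cyclic_complex w t) (cross_polytope (k * (d - 2)))"
      using cyclic_complex_add_blocks[of t w k, unfolded n w(4)] w(1) t by simp
    also have "cyclic_complex w t = simplex_boundary {..<Suc (t - 1)}"
      using cyclic_complex_short_cycle[of t w] t by (simp add: w_def)
    also have "join (simplex_boundary {..<Suc (t - 1)}) (cross_polytope (k * (d - 2))) \<approx>\<^sub>c
        join (cross_polytope (t - 1)) (cross_polytope (k * (d - 2)))"
      by (intro join_equivalent_join simplex_boundary_cross_polytope c)
    also have "\<dots> \<approx>\<^sub>c cross_polytope (t - 1 + k * (d - 2))"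
      by (rule join_cross_polytopes)
    also have "t - 1 + k * (d - 2) = Suc (d * k - 2 * k + t - 2)"
    proof -
      obtain e l u where "d = e + 3" "k = l + 1" "t = u + 1"
        using assms(1,4) t by (metis atLeastAtMost_iff le_add_diff_inverse2)
      then show ?thesis
        by (simp add: algebra_simps)
    qed
    finally show ?thesis
      using Ind cross_polytope_sphere homotopy_eqv_trans unfolding homotopy_equivalent_complexes_def by blast
  qed
  ultimately show ?thesis
    by blast
qed

end
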